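(* Over $\mathsf{RCA}_0$, $\mathsf{HT}^{=3}_2$ with apartness (equivalently, $\mathsf{FUT}^{=3}_2$) is equivalent to $\mathsf{RT}^3_2$.
   Context: $\mathbb{N}$ denotes the positive integers, $\mathbb{N}_0=\mathbb{N}\cup\{0\}$. $\mathsf{RCA}_0$ is the standard base system of reverse mathematics. $\mathsf{RT}^3_2$ is Ramsey's theorem for 2-colourings of 3-element subsets of $\mathbb{N}$. For $m\in\mathbb{N}$, $\lambda(m)$ and $\mu(m)$ are the least and greatest exponents in the binary expansion of $m$; $X\subseteq\mathbb{N}$ is apart if for all $x<x'$ in $X$, $\mu(x)<\lambda(x')$. $\mathrm{FS}^{=3}(H)$ is the set of sums of exactly three distinct elements of $H$. $\mathsf{HT}^{=3}_2$ with apartness: for every $f:\mathbb{N}\to 2$ there is an infinite apart $H\subseteq\mathbb{N}$ with $\mathrm{FS}^{=3}(H)$ monochromatic for $f$. $\mathsf{FUT}^{=3}_2$: for every colouring of finite subsets of $\mathbb{N}_0$ in 2 colours there is an infinite sequence $(X_i)$ of nonempty finite subsets of $\mathbb{N}$ with $\max X_i<\min X_j$ for $i<j$ such that all unions of exactly three distinct $X_i$ have the same colour. *)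

theory Defs
  imports Main
begin

section \<open>The language of second-order arithmetic\<close>

text \<open>De Bruijn indices are used, with separate index spaces for number variables and for set
  variables: \<open>AllN\<close> binds number variable 0 and \<open>AllS\<close> binds set variable 0. Equality is primitive
  for numbers only.\<close>

datatype tm = Var nat | Zero | One | Add tm tm | Mul tm tm

datatype fm =
    Eq tm tm
  | Less tm tm
  | Mem tm nat
  | Falsum
  | Imp fm fm (infixr "\<^bold>\<longrightarrow>" 25)
  | AllN fm
  | AllS fm

abbreviation Neg :: "fm \<Rightarrow> fm" ("\<^bold>\<not> _" [40] 40) where
  "\<^bold>\<not> \<phi> \<equiv> \<phi> \<^bold>\<longrightarrow> Falsum"

abbreviation And :: "fm \<Rightarrow> fm \<Rightarrow> fm" (infixr "\<^bold>\<and>" 35) where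
  "\<phi> \<^bold>\<and> \<psi> \<equiv> \<^bold>\<not> (\<phi> \<^bold>\<longrightarrow> \<^bold>\<not> \<psi>)"

abbreviation Or :: "fm \<Rightarrow> fm \<Rightarrow> fm" (infixr "\<^bold>\<or>" 30) where
  "\<phi> \<^bold>\<or> \<psi> \<equiv> \<^bold>\<not> \<phi> \<^bold>\<longrightarrow> \<psi>"

abbreviation Iff :: "fm \<Rightarrow> fm \<Rightarrow> fm" (infixr "\<^bold>\<longleftrightarrow>" 25) where
  "\<phi> \<^bold>\<longleftrightarrow> \<psi> \<equiv> (\<phi> \<^bold>\<longrightarrow> \<psi>) \<^bold>\<and> (\<psi> \<^bold>\<longrightarrow> \<phi>)"

abbreviation ExN :: "fm \<Rightarrow> fm" where
  "ExN \<phi> \<equiv> \<^bold>\<not> AllN (\<^bold>\<not> \<phi>)"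

abbreviation ExS :: "fm \<Rightarrow> fm" where
  "ExS \<phi> \<equiv> \<^bold>\<not> AllS (\<^bold>\<not> \<phi>)"

primrec tsub :: "(nat \<Rightarrow> tm) \<Rightarrow> tm \<Rightarrow> tm" where
  "tsub \<sigma> (Var n) = \<sigma> n"
| "tsub \<sigma> Zero = Zero"
| "tsub \<sigma> One = One"
| "tsub \<sigma> (Add s t) = Add (tsub \<sigma> s) (tsub \<sigma> t)"
| "tsub \<sigma> (Mul s t) = Mul (tsub \<sigma> s) (tsub \<sigma> t)"

definition up :: "nat \<Rightarrow> tm \<Rightarrow> tm" where
  "up k = tsub (\<lambda>n. Var (n + k))"

text \<open>Simultaneous capture-avoiding substitution for number variables and renaming of set
  variables.\<close>

primrec nsub :: "(nat \<Rightarrow> tm) \<Rightarrow> fm \<Rightarrow> fm" where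
  "nsub \<sigma> (Eq s t) = Eq (tsub \<sigma> s) (tsub \<sigma> t)"
| "nsub \<sigma> (Less s t) = Less (tsub \<sigma> s) (tsub \<sigma> t)"
| "nsub \<sigma> (Mem t X) = Mem (tsub \<sigma> t) X"
| "nsub \<sigma> Falsum = Falsum"
| "nsub \<sigma> (\<phi> \<^bold>\<longrightarrow> \<psi>) = (nsub \<sigma> \<phi> \<^bold>\<longrightarrow> nsub \<sigma> \<psi>)"
| "nsub \<sigma> (AllN \<phi>) = AllN (nsub (case_nat (Var 0) (\<lambda>n. up 1 (\<sigma> n))) \<phi>)"
| "nsub \<sigma> (AllS \<phi>) = AllS (nsub \<sigma> \<phi>)"

primrec ssub :: "(nat \<Rightarrow> nat) \<Rightarrow> fm \<Rightarrow> fm" where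
  "ssub \<rho> (Eq s t) = Eq s t"
| "ssub \<rho> (Less s t) = Less s t"
| "ssub \<rho> (Mem t X) = Mem t (\<rho> X)"
| "ssub \<rho> Falsum = Falsum"
| "ssub \<rho> (\<phi> \<^bold>\<longrightarrow> \<psi>) = (ssub \<rho> \<phi> \<^bold>\<longrightarrow> ssub \<rho> \<psi>)"
| "ssub \<rho> (AllN \<phi>) = AllN (ssub \<rho> \<phi>)"
| "ssub \<rho> (AllS \<phi>) = AllS (ssub (case_nat 0 (\<lambda>n. Suc (\<rho> n))) \<phi>)"

definition instN :: "tm \<Rightarrow> fm \<Rightarrow> fm" where
  "instN t = nsub (case_nat t Var)"

definition instS :: "nat \<Rightarrow> fm \<Rightarrow> fm" where
  "instS X = ssub (case_nat X (\<lambda>n. n))"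

definition liftN :: "fm \<Rightarrow> fm" where
  "liftN = nsub (\<lambda>n. Var (Suc n))"

definition liftS :: "fm \<Rightarrow> fm" where
  "liftS = ssub Suc"


section \<open>Provability\<close>

text \<open>A Hilbert calculus for classical two-sorted first-order logic with equality. Because of the
  unrestricted generalisation rules, an open formula in \<open>T\<close> has the same effect as its universal
  closure.\<close>

inductive proves :: "fm set \<Rightarrow> fm \<Rightarrow> bool" (infix "\<turnstile>" 20) for T :: "fm set" where
  Axiom: "\<phi> \<in> T \<Longrightarrow> T \<turnstile> \<phi>"
| MP: "T \<turnstile> \<phi> \<^bold>\<longrightarrow> \<psi> \<Longrightarrow> T \<turnstile> \<phi> \<Longrightarrow> T \<turnstile> \<psi>"
| PropK: "T \<turnstile> \<phi> \<^bold>\<longrightarrow> \<psi> \<^bold>\<longrightarrow> \<phi>"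
| PropS: "T \<turnstile> (\<phi> \<^bold>\<longrightarrow> \<psi> \<^bold>\<longrightarrow> \<chi>) \<^bold>\<longrightarrow> (\<phi> \<^bold>\<longrightarrow> \<psi>) \<^bold>\<longrightarrow> \<phi> \<^bold>\<longrightarrow> \<chi>"
| DNeg: "T \<turnstile> \<^bold>\<not> \<^bold>\<not> \<phi> \<^bold>\<longrightarrow> \<phi>"
| EqRefl: "T \<turnstile> Eq t t"
| EqSubst: "T \<turnstile> Eq s t \<^bold>\<longrightarrow> instN s \<phi> \<^bold>\<longrightarrow> instN t \<phi>"
| InstN: "T \<turnstile> AllN \<phi> \<^bold>\<longrightarrow> instN t \<phi>"
| DistN: "T \<turnstile> AllN (\<phi> \<^bold>\<longrightarrow> \<psi>) \<^bold>\<longrightarrow> AllN \<phi> \<^bold>\<longrightarrow> AllN \<psi>"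
| VacN: "T \<turnstile> \<phi> \<^bold>\<longrightarrow> AllN (liftN \<phi>)"
| GenN: "T \<turnstile> \<phi> \<Longrightarrow> T \<turnstile> AllN \<phi>"
| InstS: "T \<turnstile> AllS \<phi> \<^bold>\<longrightarrow> instS X \<phi>"
| DistS: "T \<turnstile> AllS (\<phi> \<^bold>\<longrightarrow> \<psi>) \<^bold>\<longrightarrow> AllS \<phi> \<^bold>\<longrightarrow> AllS \<psi>"
| VacS: "T \<turnstile> \<phi> \<^bold>\<longrightarrow> AllS (liftS \<phi>)"
| GenS: "T \<turnstile> \<phi> \<Longrightarrow> T \<turnstile> AllS \<phi>"


section \<open>The system $\mathsf{RCA}_0$\<close>

inductive Sigma00 :: "fm \<Rightarrow> bool" where
  "Sigma00 (Eq s t)"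
| "Sigma00 (Less s t)"
| "Sigma00 (Mem t X)"
| "Sigma00 Falsum"
| "Sigma00 \<phi> \<Longrightarrow> Sigma00 \<psi> \<Longrightarrow> Sigma00 (\<phi> \<^bold>\<longrightarrow> \<psi>)"
| "Sigma00 \<phi> \<Longrightarrow> Sigma00 (AllN (Less (Var 0) (up 1 t) \<^bold>\<longrightarrow> \<phi>))"
| "Sigma00 \<phi> \<Longrightarrow> Sigma00 (ExN (Less (Var 0) (up 1 t) \<^bold>\<and> \<phi>))"

definition Sigma01 :: "fm set" where
  "Sigma01 = {ExN \<phi> | \<phi>. Sigma00 \<phi>}"

definition Pi01 :: "fm set" where
  "Pi01 = {AllN \<phi> | \<phi>. Sigma00 \<phi>}"

definition basic_axioms :: "fm set" where
  "basic_axioms = (let m = Var 0; n = Var 1 in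
    {\<^bold>\<not> Eq (Add n One) Zero,
     Eq (Add m One) (Add n One) \<^bold>\<longrightarrow> Eq m n,
     Eq (Add m Zero) m,
     Eq (Add m (Add n One)) (Add (Add m n) One),
     Eq (Mul m Zero) Zero,
     Eq (Mul m (Add n One)) (Add (Mul m n) m),
     \<^bold>\<not> Less m Zero,
     Less m (Add n One) \<^bold>\<longleftrightarrow> (Less m n \<^bold>\<or> Eq m n)})"

definition induction :: "fm \<Rightarrow> fm" where
  "induction \<phi> =
    (instN Zero \<phi> \<^bold>\<and>
     AllN (\<phi> \<^bold>\<longrightarrow> nsub (case_nat (Add (Var 0) One) (\<lambda>n. Var (Suc n))) \<phi>) \<^bold>\<longrightarrow> AllN \<phi>)"

definition comprehension :: "fm \<Rightarrow> fm \<Rightarrow> fm" where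
  "comprehension \<phi> \<psi> =
    (AllN (\<phi> \<^bold>\<longleftrightarrow> \<psi>) \<^bold>\<longrightarrow> ExS (AllN (Mem (Var 0) 0 \<^bold>\<longleftrightarrow> liftS \<phi>)))"

definition RCA0 :: "fm set" where
  "RCA0 = basic_axioms
    \<union> {induction \<phi> | \<phi>. \<phi> \<in> Sigma01}
    \<union> {comprehension \<phi> \<psi> | \<phi> \<psi>. \<phi> \<in> Sigma01 \<and> \<psi> \<in> Pi01}"


section \<open>Coding in second-order arithmetic\<close>

text \<open>Number quantifiers range over $\mathbb{N}_0$; membership in $\mathbb{N}$ is positivity. Where
  a formula below places an argument term under number quantifiers, the term is shifted by
  \<open>up\<close>.\<close>

abbreviation Two :: tm where
  "Two \<equiv> Add One One"

definition Le :: "tm \<Rightarrow> tm \<Rightarrow> fm" where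
  "Le s t = (Less s t \<^bold>\<or> Eq s t)"

definition any_number :: "tm \<Rightarrow> fm" where
  "any_number t = Eq t t"

definition positive :: "tm \<Rightarrow> fm" where
  "positive t = Less Zero t"

definition colour :: "tm \<Rightarrow> fm" where
  "colour t = Less t Two"

text \<open>The usual injective pairing $(x,y) = (x+y)^2 + x$.\<close>

definition pair :: "tm \<Rightarrow> tm \<Rightarrow> tm" where
  "pair x y = Add (Mul (Add x y) (Add x y)) x"

definition triple :: "tm \<Rightarrow> tm \<Rightarrow> tm \<Rightarrow> tm" where
  "triple x y z = pair (pair x y) z"

text \<open>The set with index \<open>F\<close> is (the graph of) a function from \<open>D\<close> to \<open>R\<close>; \<open>D\<close> and \<open>R\<close> are
  meant to have no variables other than those of the argument term.\<close>

definition is_function :: "(tm \<Rightarrow> fm) \<Rightarrow> (tm \<Rightarrow> fm) \<Rightarrow> nat \<Rightarrow> fm" where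
  "is_function D R F =
    (AllN (Mem (Var 0) F \<^bold>\<longrightarrow>
       ExN (ExN (Eq (Var 2) (pair (Var 1) (Var 0)) \<^bold>\<and> D (Var 1) \<^bold>\<and> R (Var 0)))) \<^bold>\<and>
     AllN (D (Var 0) \<^bold>\<longrightarrow>
       ExN (Mem (pair (Var 1) (Var 0)) F \<^bold>\<and>
            AllN (Mem (pair (Var 2) (Var 0)) F \<^bold>\<longrightarrow> Eq (Var 0) (Var 1)))))"

definition infinite_set :: "nat \<Rightarrow> fm" where
  "infinite_set X = AllN (ExN (Less (Var 1) (Var 0) \<^bold>\<and> Mem (Var 0) X))"

definition positive_set :: "nat \<Rightarrow> fm" where
  "positive_set X = AllN (Mem (Var 0) X \<^bold>\<longrightarrow> positive (Var 0))"

text \<open>$2^e = p$, where exponentiation is the function given by its recursion equations.\<close>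

definition pow2 :: "tm \<Rightarrow> tm \<Rightarrow> fm" where
  "pow2 e p =
    ExS (is_function any_number any_number 0 \<^bold>\<and>
         Mem (pair Zero One) 0 \<^bold>\<and>
         AllN (AllN (Mem (pair (Var 1) (Var 0)) 0 \<^bold>\<longrightarrow>
                     Mem (pair (Add (Var 1) One) (Mul Two (Var 0))) 0)) \<^bold>\<and>
         Mem (pair e p) 0)"

text \<open>$e$ is an exponent in the binary expansion of $m$, that is, $m = (2q+1)2^e + r$ with
  $r < 2^e$. Read as a statement about the finite set with binary code $m$, it says that $e$ is an
  element of that set; \<open>is_lambda\<close> and \<open>is_mu\<close> then express its minimum and maximum.\<close>

definition is_exponent :: "tm \<Rightarrow> tm \<Rightarrow> fm" where
  "is_exponent e m =
    (let p = Var 2; q = Var 1; r = Var 0 in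
     ExN (ExN (ExN (pow2 (up 3 e) p \<^bold>\<and> Less r p \<^bold>\<and>
       Eq (up 3 m) (Add (Mul (Add (Mul Two q) One) p) r)))))"

definition is_lambda :: "tm \<Rightarrow> tm \<Rightarrow> fm" where
  "is_lambda m l =
    (is_exponent l m \<^bold>\<and> AllN (is_exponent (Var 0) (up 1 m) \<^bold>\<longrightarrow> Le (up 1 l) (Var 0)))"

definition is_mu :: "tm \<Rightarrow> tm \<Rightarrow> fm" where
  "is_mu m u =
    (is_exponent u m \<^bold>\<and> AllN (is_exponent (Var 0) (up 1 m) \<^bold>\<longrightarrow> Le (Var 0) (up 1 u)))"

definition mu_less_lambda :: "tm \<Rightarrow> tm \<Rightarrow> fm" where
  "mu_less_lambda m n =
    AllN (AllN (is_mu (up 2 m) (Var 1) \<^bold>\<and> is_lambda (up 2 n) (Var 0) \<^bold>\<longrightarrow>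
      Less (Var 1) (Var 0)))"

definition apart :: "nat \<Rightarrow> fm" where
  "apart X =
    AllN (AllN (Mem (Var 1) X \<^bold>\<and> Mem (Var 0) X \<^bold>\<and> Less (Var 1) (Var 0) \<^bold>\<longrightarrow>
      mu_less_lambda (Var 1) (Var 0)))"

definition distinct3 :: "tm \<Rightarrow> tm \<Rightarrow> tm \<Rightarrow> fm" where
  "distinct3 x y z = (\<^bold>\<not> Eq x y \<^bold>\<and> \<^bold>\<not> Eq x z \<^bold>\<and> \<^bold>\<not> Eq y z)"


section \<open>The three combinatorial principles\<close>

text \<open>A 3-element subset of $\mathbb{N}$ is coded by the triple listing it in increasing order.\<close>

definition positive_3subset :: "tm \<Rightarrow> fm" where
  "positive_3subset t =
    (let x = Var 2; y = Var 1; z = Var 0 in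
     ExN (ExN (ExN (positive x \<^bold>\<and> Less x y \<^bold>\<and> Less y z \<^bold>\<and> Eq (up 3 t) (triple x y z)))))"

definition RT32 :: fm where
  "RT32 =
    AllS (is_function positive_3subset colour 0 \<^bold>\<longrightarrow>
      ExS (let f = 1; H = 0; c = Var 3; x = Var 2; y = Var 1; z = Var 0 in
        positive_set H \<^bold>\<and> infinite_set H \<^bold>\<and>
        ExN (colour (Var 0) \<^bold>\<and>
          AllN (AllN (AllN (Mem x H \<^bold>\<and> Mem y H \<^bold>\<and> Mem z H \<^bold>\<and> Less x y \<^bold>\<and> Less y z \<^bold>\<longrightarrow>
            Mem (pair (triple x y z) c) f))))))"

definition HT32_apart :: fm where
  "HT32_apart =
    AllS (is_function positive colour 0 \<^bold>\<longrightarrow>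
      ExS (let f = 1; H = 0; c = Var 3; x = Var 2; y = Var 1; z = Var 0 in
        positive_set H \<^bold>\<and> infinite_set H \<^bold>\<and> apart H \<^bold>\<and>
        ExN (colour (Var 0) \<^bold>\<and>
          AllN (AllN (AllN (Mem x H \<^bold>\<and> Mem y H \<^bold>\<and> Mem z H \<^bold>\<and> distinct3 x y z \<^bold>\<longrightarrow>
            Mem (pair (Add (Add x y) z) c) f))))))"

text \<open>Finite subsets of $\mathbb{N}_0$ are identified with their binary codes, so that every
  number codes exactly one finite set.\<close>

definition nonempty_positive_code :: "tm \<Rightarrow> fm" where
  "nonempty_positive_code s =
    (ExN (is_exponent (Var 0) (up 1 s)) \<^bold>\<and> AllN (is_exponent (Var 0) (up 1 s) \<^bold>\<longrightarrow> positive (Var 0)))"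

definition is_union3 :: "tm \<Rightarrow> tm \<Rightarrow> tm \<Rightarrow> tm \<Rightarrow> fm" where
  "is_union3 u r s t =
    AllN (is_exponent (Var 0) (up 1 u) \<^bold>\<longleftrightarrow>
      (is_exponent (Var 0) (up 1 r) \<^bold>\<or> is_exponent (Var 0) (up 1 s) \<^bold>\<or> is_exponent (Var 0) (up 1 t)))"

text \<open>The block sequence is a function from indices to codes.\<close>

definition block_sequence :: "nat \<Rightarrow> fm" where
  "block_sequence S =
    (is_function any_number nonempty_positive_code S \<^bold>\<and>
     (let i = Var 3; j = Var 2; s = Var 1; t = Var 0 in
      AllN (AllN (AllN (AllN (Mem (pair i s) S \<^bold>\<and> Mem (pair j t) S \<^bold>\<and> Less i j \<^bold>\<longrightarrow>
        mu_less_lambda s t))))))"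

definition FUT32 :: fm where
  "FUT32 =
    AllS (is_function any_number colour 0 \<^bold>\<longrightarrow>
      ExS (let f = 1; S = 0; c = Var 7; i = Var 6; j = Var 5; k = Var 4;
               r = Var 3; s = Var 2; t = Var 1; u = Var 0 in
        block_sequence S \<^bold>\<and>
        ExN (colour (Var 0) \<^bold>\<and>
          AllN (AllN (AllN (AllN (AllN (AllN (AllN
            (distinct3 i j k \<^bold>\<and>
             Mem (pair i r) S \<^bold>\<and> Mem (pair j s) S \<^bold>\<and> Mem (pair k t) S \<^bold>\<and>
             is_union3 u r s t \<^bold>\<longrightarrow>
             Mem (pair u c) f))))))))))"

end

theory Submission
  imports Defs "HOL-Library.Countable_Set"
begin

text \<open>By completeness it suffices to argue in an arbitrary model of $\mathsf{RCA}_0$. There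
  $\mathsf{RT}^3_2$ yields $\mathsf{HT}^{=3}_2$ with apartness by giving $\{x,y,z\}$ the colour of
  $2^x+2^y+2^z$, and apart sets of numbers are block sequences of finite sets read in binary. For
  the converse, fix a $\Sigma^0_1$ set $A$ and colour $m$ by the parity of the number of its very
  short gaps, that is, of pairs of consecutive exponents $e<j$ such that some $n\le e$ enters $A$
  after stage $j$ and before stage $\mu(m)$. If all sums of three elements of an apart set $H$ have
  the same colour, letting the last one or two summands tend to infinity shows that no
  $n\le\mu(x)$ enters $A$ after stage $\lambda(y)$ for $x<y$ in $H$, so $H$ computes $A$. This gives
  arithmetical comprehension, from which Ramsey's theorem for triples follows by deciding the limit
  colours of pairs and of points and then choosing a homogeneous set greedily.\<close>

section \<open>Substitution\<close>

text \<open>True membership in A cannot enter a colouring that must exist in the model, so the top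
  exponent of m serves as a stage of the enumeration. Three summands let this stage be sent far away
  while one gap stays free: for x < y < z with z far, the gap between y and z is not short, the gap
  between x and y is judged correctly, and the parity of z alone cancels when two such sums are
  compared. Triples that are far apart have no short gap in between, which makes the limit parities
  of single elements equal; a short gap between close x and y would then flip the colour. The other
  obstacle is the weakness of the system. Models may be nonstandard and have induction only for
  Sigma^0_1 and comprehension only for Delta^0_1 formulas, so every induction, minimum and recursion
  comes with a proof that its predicate is definable; in a fixed structure whose carrier is a type,
  rule application does this and type classes supply the algebra. Even powers of 2 have to be built
  from addition and multiplication by Goedel's coding. In the proof of Ramsey's theorem, decreasing
  families of unbounded sets stand in for an ultrafilter.\<close>

lemma tsub_tsub: "tsub \<sigma> (tsub \<tau> t) = tsub (\<lambda>n. tsub \<sigma> (\<tau> n)) t"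
  by (induction t) auto

lemma tsub_Var [simp]: "tsub Var t = t"
  by (induction t) auto

lemma tsub_up: "tsub \<sigma> (up k t) = tsub (\<lambda>n. \<sigma> (n + k)) t"
  by (simp add: up_def tsub_tsub)

lemma up_tsub: "up k (tsub \<sigma> t) = tsub (\<lambda>n. up k (\<sigma> n)) t"
  by (simp add: up_def tsub_tsub)

lemma nsub_nsub: "nsub \<sigma> (nsub \<tau> \<phi>) = nsub (\<lambda>n. tsub \<sigma> (\<tau> n)) \<phi>"
proof (induction \<phi> arbitrary: \<sigma> \<tau>)
  case (AllN \<phi>)
  have "(\<lambda>n. tsub (case_nat (Var 0) (\<lambda>n. up 1 (\<sigma> n))) (case n of 0 \<Rightarrow> Var 0 | Suc n \<Rightarrow> up 1 (\<tau> n)))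
      = case_nat (Var 0) (\<lambda>n. up 1 (tsub \<sigma> (\<tau> n)))"
    by (rule ext) (simp add: tsub_up up_tsub split: nat.split)
  then show ?case by (simp only: nsub.simps AllN.IH)
qed (auto simp: tsub_tsub)

lemma nsub_Var [simp]: "nsub Var \<phi> = \<phi>"
proof (induction \<phi>)
  case (AllN \<phi>)
  have "case_nat (Var 0) (\<lambda>n. up 1 (Var n)) = Var"
    by (rule ext) (simp add: up_def split: nat.split)
  then show ?case using AllN by simp
qed auto

lemma ssub_ssub: "ssub \<rho> (ssub \<rho>' \<phi>) = ssub (\<lambda>n. \<rho> (\<rho>' n)) \<phi>"
proof (induction \<phi> arbitrary: \<rho> \<rho>')
  case (AllS \<phi>)
  have "(\<lambda>n. case case n of 0 \<Rightarrow> 0 | Suc n \<Rightarrow> Suc (\<rho>' n) of 0 \<Rightarrow> 0 | Suc n \<Rightarrow> Suc (\<rho> n))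
      = case_nat 0 (\<lambda>n. Suc (\<rho> (\<rho>' n)))"
    by (rule ext) (simp split: nat.split)
  then show ?case by (simp add: AllS.IH)
qed auto

lemma ssub_id [simp]: "ssub (\<lambda>n. n) \<phi> = \<phi>"
proof (induction \<phi>)
  case (AllS \<phi>)
  have "case_nat 0 (\<lambda>n. Suc n) = (\<lambda>n. n)"
    by (rule ext) (simp split: nat.split)
  then show ?case using AllS by simp
qed auto

lemma nsub_ssub: "nsub \<sigma> (ssub \<rho> \<phi>) = ssub \<rho> (nsub \<sigma> \<phi>)"
  by (induction \<phi> arbitrary: \<sigma> \<rho>) auto

lemma instN_liftN [simp]: "instN t (liftN \<phi>) = \<phi>"
  by (simp add: instN_def liftN_def nsub_nsub)

lemma instS_liftS [simp]: "instS X (liftS \<phi>) = \<phi>"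
  by (simp add: instS_def liftS_def ssub_ssub)

lemma tsub_bounded: "\<exists>N. \<forall>\<sigma> \<tau>. (\<forall>n<N. \<sigma> n = \<tau> n) \<longrightarrow> tsub \<sigma> t = tsub \<tau> t"
proof (induction t)
  case (Var x)
  then show ?case by (intro exI[of _ "Suc x"]) auto
next
  case (Add s t)
  then obtain M N where "\<forall>\<sigma> \<tau>. (\<forall>n<M. \<sigma> n = \<tau> n) \<longrightarrow> tsub \<sigma> s = tsub \<tau> s"
    "\<forall>\<sigma> \<tau>. (\<forall>n<N. \<sigma> n = \<tau> n) \<longrightarrow> tsub \<sigma> t = tsub \<tau> t" by blast
  then show ?case by (intro exI[of _ "max M N"]) (fastforce simp: less_max_iff_disj)
next
  case (Mul s t)
  then obtain M N where "\<forall>\<sigma> \<tau>. (\<forall>n<M. \<sigma> n = \<tau> n) \<longrightarrow> tsub \<sigma> s = tsub \<tau> s"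
    "\<forall>\<sigma> \<tau>. (\<forall>n<N. \<sigma> n = \<tau> n) \<longrightarrow> tsub \<sigma> t = tsub \<tau> t" by blast
  then show ?case by (intro exI[of _ "max M N"]) (fastforce simp: less_max_iff_disj)
qed auto

text \<open>A formula mentions finitely many variables; a bound on them replaces a function that
  computes free variables. Under \<open>AllN\<close> the bound of the body still works, since
  \<open>case_nat\<close> only shifts indices up.\<close>

lemma nsub_bounded: "\<exists>N. \<forall>\<sigma> \<tau>. (\<forall>n<N. \<sigma> n = \<tau> n) \<longrightarrow> nsub \<sigma> \<phi> = nsub \<tau> \<phi>"
proof (induction \<phi>)
  case (Eq s t)
  obtain M N where "\<forall>\<sigma> \<tau>. (\<forall>n<M. \<sigma> n = \<tau> n) \<longrightarrow> tsub \<sigma> s = tsub \<tau> s"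
    "\<forall>\<sigma> \<tau>. (\<forall>n<N. \<sigma> n = \<tau> n) \<longrightarrow> tsub \<sigma> t = tsub \<tau> t" using tsub_bounded by metis
  then show ?case by (intro exI[of _ "max M N"]) (fastforce simp: less_max_iff_disj)
next
  case (Less s t)
  obtain M N where "\<forall>\<sigma> \<tau>. (\<forall>n<M. \<sigma> n = \<tau> n) \<longrightarrow> tsub \<sigma> s = tsub \<tau> s"
    "\<forall>\<sigma> \<tau>. (\<forall>n<N. \<sigma> n = \<tau> n) \<longrightarrow> tsub \<sigma> t = tsub \<tau> t" using tsub_bounded by metis
  then show ?case by (intro exI[of _ "max M N"]) (fastforce simp: less_max_iff_disj)
next
  case (Mem t X)
  then show ?case using tsub_bounded[of t] by auto
next
  case (Imp \<phi> \<psi>)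
  then obtain M N where "\<forall>\<sigma> \<tau>. (\<forall>n<M. \<sigma> n = \<tau> n) \<longrightarrow> nsub \<sigma> \<phi> = nsub \<tau> \<phi>"
    "\<forall>\<sigma> \<tau>. (\<forall>n<N. \<sigma> n = \<tau> n) \<longrightarrow> nsub \<sigma> \<psi> = nsub \<tau> \<psi>" by blast
  then show ?case by (intro exI[of _ "max M N"]) (fastforce simp: less_max_iff_disj)
next
  case (AllN \<phi>)
  then obtain N where N: "\<And>\<sigma> \<tau>. (\<forall>n<N. \<sigma> n = \<tau> n) \<Longrightarrow> nsub \<sigma> \<phi> = nsub \<tau> \<phi>" by blast
  show ?case
    by (intro exI[of _ N] allI impI) (auto intro!: N split: nat.split)
qed auto

lemma ssub_bounded: "\<exists>N. \<forall>\<rho> \<rho>'. (\<forall>n<N. \<rho> n = \<rho>' n) \<longrightarrow> ssub \<rho> \<phi> = ssub \<rho>' \<phi>"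
proof (induction \<phi>)
  case (Mem t X)
  then show ?case by (intro exI[of _ "Suc X"]) auto
next
  case (Imp \<phi> \<psi>)
  then obtain M N where "\<forall>\<sigma> \<tau>. (\<forall>n<M. \<sigma> n = \<tau> n) \<longrightarrow> ssub \<sigma> \<phi> = ssub \<tau> \<phi>"
    "\<forall>\<sigma> \<tau>. (\<forall>n<N. \<sigma> n = \<tau> n) \<longrightarrow> ssub \<sigma> \<psi> = ssub \<tau> \<psi>" by blast
  then show ?case by (intro exI[of _ "max M N"]) (fastforce simp: less_max_iff_disj)
next
  case (AllS \<phi>)
  then obtain N where N: "\<And>\<sigma> \<tau>. (\<forall>n<N. \<sigma> n = \<tau> n) \<Longrightarrow> ssub \<sigma> \<phi> = ssub \<tau> \<phi>" by blast
  show ?case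
    by (intro exI[of _ N] allI impI) (auto intro!: N split: nat.split)
qed auto

text \<open>The calculus only instantiates variable 0, so the substitution is done one variable at a
  time by \<open>GenN\<close> and \<open>InstN\<close>; the bound on the variables of
  \<open>\<phi>\<close> makes finitely many rounds enough.\<close>

lemma proves_nsub:
  assumes "T \<turnstile> \<phi>"
  shows "T \<turnstile> nsub \<sigma> \<phi>"
proof -
  have step: "T \<turnstile> nsub (\<lambda>n. if n < k then \<sigma> n else Var (n - k)) \<phi>" if "T \<turnstile> \<phi>" for k \<sigma> \<phi>
    using that
  proof (induction k arbitrary: \<phi> \<sigma>)
    case 0
    then show ?case by simp
  next
    case (Suc k)
    \<comment> \<open>Each of the \<open>k\<close> rounds still to come lowers the remaining
      variables by one; lifting \<open>\<sigma> 0\<close> by \<open>k\<close> protects it from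
      them.\<close>
    have "T \<turnstile> instN (up k (\<sigma> 0)) \<phi>"
      using Suc.prems proves.GenN proves.InstN proves.MP by blast
    from Suc.IH[OF this, of "\<lambda>n. \<sigma> (Suc n)"]
    have "T \<turnstile> nsub (\<lambda>n. tsub (\<lambda>n. if n < k then \<sigma> (Suc n) else Var (n - k))
        (case n of 0 \<Rightarrow> up k (\<sigma> 0) | Suc n \<Rightarrow> Var n)) \<phi>"
      by (simp add: instN_def nsub_nsub)
    moreover have "(\<lambda>n. tsub (\<lambda>n. if n < k then \<sigma> (Suc n) else Var (n - k))
        (case n of 0 \<Rightarrow> up k (\<sigma> 0) | Suc n \<Rightarrow> Var n))
      = (\<lambda>n. if n < Suc k then \<sigma> n else Var (n - Suc k))"
      by (rule ext) (auto simp: tsub_up split: nat.split)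
    ultimately show ?case by simp
  qed
  obtain N where "\<And>\<sigma> \<tau>. (\<forall>n<N. \<sigma> n = \<tau> n) \<Longrightarrow> nsub \<sigma> \<phi> = nsub \<tau> \<phi>"
    using nsub_bounded by blast
  then have "nsub (\<lambda>n. if n < N then \<sigma> n else Var (n - N)) \<phi> = nsub \<sigma> \<phi>" by simp
  then show ?thesis using step[OF assms, of N \<sigma>] by simp
qed

lemma proves_ssub:
  assumes "T \<turnstile> \<phi>"
  shows "T \<turnstile> ssub \<rho> \<phi>"
proof -
  have step: "T \<turnstile> ssub (\<lambda>n. if n < k then \<rho> n else n - k) \<phi>" if "T \<turnstile> \<phi>" for k \<rho> \<phi>
    using that
  proof (induction k arbitrary: \<phi> \<rho>)
    case 0
    then show ?case by simp
  next
    case (Suc k)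
    have "T \<turnstile> instS (\<rho> 0 + k) \<phi>"
      using Suc.prems proves.GenS proves.InstS proves.MP by blast
    from Suc.IH[OF this, of "\<lambda>n. \<rho> (Suc n)"]
    have "T \<turnstile> ssub (\<lambda>n. (\<lambda>n. if n < k then \<rho> (Suc n) else n - k)
        (case n of 0 \<Rightarrow> \<rho> 0 + k | Suc n \<Rightarrow> n)) \<phi>"
      by (simp add: instS_def ssub_ssub)
    moreover have "(\<lambda>n. (\<lambda>n. if n < k then \<rho> (Suc n) else n - k)
        (case n of 0 \<Rightarrow> \<rho> 0 + k | Suc n \<Rightarrow> n))
      = (\<lambda>n. if n < Suc k then \<rho> n else n - Suc k)"
      by (rule ext) (auto split: nat.split)
    ultimately show ?case by simp
  qed
  obtain N where "\<And>\<sigma> \<tau>. (\<forall>n<N. \<sigma> n = \<tau> n) \<Longrightarrow> ssub \<sigma> \<phi> = ssub \<tau> \<phi>"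
    using ssub_bounded by blast
  then have "ssub (\<lambda>n. if n < N then \<rho> n else n - N) \<phi> = ssub \<rho> \<phi>" by simp
  then show ?thesis using step[OF assms, of N \<rho>] by simp
qed


section \<open>Completeness of the calculus\<close>

instance tm :: countable by countable_datatype
instance fm :: countable by countable_datatype

text \<open>Closed under modus ponens but not under generalisation: free variables of adjoined
  formulas act as parameters and must not be generalised.\<close>

definition deductive_filter :: "fm set \<Rightarrow> fm set \<Rightarrow> bool" where
  "deductive_filter T F \<longleftrightarrow> (\<forall>\<phi>. (T \<turnstile> \<phi>) \<longrightarrow> \<phi> \<in> F) \<and> (\<forall>\<phi> \<psi>. (\<phi> \<^bold>\<longrightarrow> \<psi>) \<in> F \<longrightarrow> \<phi> \<in> F \<longrightarrow> \<psi> \<in> F)"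

text \<open>The deduction theorem is built in, so that \<open>PropK\<close> and \<open>PropS\<close>
  give closure under modus ponens.\<close>

definition adjoin :: "fm set \<Rightarrow> fm \<Rightarrow> fm set" where
  "adjoin F \<psi> = {\<chi>. (\<psi> \<^bold>\<longrightarrow> \<chi>) \<in> F}"

text \<open>The language gets no Henkin constants; variables above a threshold serve as fresh names.
  Freshness of \<open>x\<close> is insensitivity of \<open>\<chi>\<close> to the value at
  \<open>Suc x\<close>, as \<open>\<chi>\<close> stands under a binder. Unlike closure under
  \<open>GenN\<close>, this property survives the adjoining of a formula.\<close>

definition generalizesN :: "fm set \<Rightarrow> bool" where
  "generalizesN F \<longleftrightarrow> (\<exists>N. \<forall>\<chi>. \<forall>x\<ge>N.
     (\<forall>\<sigma> \<tau>. (\<forall>n. n \<noteq> Suc x \<longrightarrow> \<sigma> n = \<tau> n) \<longrightarrow> nsub \<sigma> \<chi> = nsub \<tau> \<chi>) \<longrightarrow>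
     instN (Var x) \<chi> \<in> F \<longrightarrow> AllN \<chi> \<in> F)"

definition generalizesS :: "fm set \<Rightarrow> bool" where
  "generalizesS F \<longleftrightarrow> (\<exists>N. \<forall>\<chi>. \<forall>x\<ge>N.
     (\<forall>\<sigma> \<tau>. (\<forall>n. n \<noteq> Suc x \<longrightarrow> \<sigma> n = \<tau> n) \<longrightarrow> ssub \<sigma> \<chi> = ssub \<tau> \<chi>) \<longrightarrow>
     instS x \<chi> \<in> F \<longrightarrow> AllS \<chi> \<in> F)"

lemma deductive_filter_mp:
  "deductive_filter T F \<Longrightarrow> (\<phi> \<^bold>\<longrightarrow> \<psi>) \<in> F \<Longrightarrow> \<phi> \<in> F \<Longrightarrow> \<psi> \<in> F"
  by (auto simp: deductive_filter_def)

lemma deductive_filter_theorem: "deductive_filter T F \<Longrightarrow> T \<turnstile> \<phi> \<Longrightarrow> \<phi> \<in> F"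
  by (auto simp: deductive_filter_def)

lemma deductive_filter_adjoin:
  assumes F: "deductive_filter T F"
  shows "deductive_filter T (adjoin F \<psi>)" and "F \<subseteq> adjoin F \<psi>" and "\<psi> \<in> adjoin F \<psi>"
proof -
  have K: "(\<psi> \<^bold>\<longrightarrow> \<chi>) \<in> F" if "\<chi> \<in> F" for \<chi>
    using deductive_filter_mp[OF F deductive_filter_theorem[OF F proves.PropK] that] .
  then show "F \<subseteq> adjoin F \<psi>" by (auto simp: adjoin_def)
  have S: "(\<psi> \<^bold>\<longrightarrow> \<chi>) \<in> F" if "(\<psi> \<^bold>\<longrightarrow> \<phi> \<^bold>\<longrightarrow> \<chi>) \<in> F" "(\<psi> \<^bold>\<longrightarrow> \<phi>) \<in> F" for \<phi> \<chi>
    using deductive_filter_mp[OF F deductive_filter_mp[OF F deductive_filter_theorem[OF F proves.PropS] that(1)] that(2)] .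
  show "\<psi> \<in> adjoin F \<psi>"
    using S[of "\<psi> \<^bold>\<longrightarrow> \<psi>" \<psi>] deductive_filter_theorem[OF F proves.PropK] by (simp add: adjoin_def)
  show "deductive_filter T (adjoin F \<psi>)"
    unfolding deductive_filter_def adjoin_def
    using K S deductive_filter_theorem[OF F] by blast
qed

text \<open>Above the variables of \<open>\<psi>\<close>, \<open>x\<close> is also fresh for the
  implication from \<open>liftN \<psi>\<close> to \<open>\<chi>\<close>. Generalise there and then
  pull \<open>\<psi>\<close> out by \<open>DistN\<close> and \<open>VacN\<close>; only the threshold
  grows.\<close>

lemma generalizesN_adjoin:
  assumes F: "deductive_filter T F" and gen: "generalizesN F"
  shows "generalizesN (adjoin F \<psi>)"
proof -
  obtain N where N: "\<And>\<chi> x. x \<ge> N \<Longrightarrow>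
     (\<forall>\<sigma> \<tau>. (\<forall>n. n \<noteq> Suc x \<longrightarrow> \<sigma> n = \<tau> n) \<longrightarrow> nsub \<sigma> \<chi> = nsub \<tau> \<chi>) \<Longrightarrow>
     instN (Var x) \<chi> \<in> F \<Longrightarrow> AllN \<chi> \<in> F"
    using gen unfolding generalizesN_def by blast
  obtain M where M: "\<And>\<sigma> \<tau>. (\<forall>n<M. \<sigma> n = \<tau> n) \<Longrightarrow> nsub \<sigma> \<psi> = nsub \<tau> \<psi>"
    using nsub_bounded by blast
  have "AllN \<chi> \<in> adjoin F \<psi>" if x: "x \<ge> max M N"
    and ind: "\<forall>\<sigma> \<tau>. (\<forall>n. n \<noteq> Suc x \<longrightarrow> \<sigma> n = \<tau> n) \<longrightarrow> nsub \<sigma> \<chi> = nsub \<tau> \<chi>"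
    and inst: "instN (Var x) \<chi> \<in> adjoin F \<psi>" for \<chi> x
  proof -
    have "instN (Var x) (liftN \<psi> \<^bold>\<longrightarrow> \<chi>) = (\<psi> \<^bold>\<longrightarrow> instN (Var x) \<chi>)"
      using instN_liftN[of "Var x" \<psi>] by (simp add: instN_def)
    then have 1: "instN (Var x) (liftN \<psi> \<^bold>\<longrightarrow> \<chi>) \<in> F" using inst by (simp add: adjoin_def)
    have "AllN (liftN \<psi> \<^bold>\<longrightarrow> \<chi>) \<in> F"
    proof (rule N[OF _ _ 1])
      show "\<forall>\<sigma> \<tau>. (\<forall>n. n \<noteq> Suc x \<longrightarrow> \<sigma> n = \<tau> n) \<longrightarrow>
          nsub \<sigma> (liftN \<psi> \<^bold>\<longrightarrow> \<chi>) = nsub \<tau> (liftN \<psi> \<^bold>\<longrightarrow> \<chi>)"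
      proof (intro allI impI)
        fix \<sigma> \<tau> :: "nat \<Rightarrow> tm" assume eq: "\<forall>n. n \<noteq> Suc x \<longrightarrow> \<sigma> n = \<tau> n"
        have "nsub (\<lambda>n. \<sigma> (Suc n)) \<psi> = nsub (\<lambda>n. \<tau> (Suc n)) \<psi>"
          by (rule M) (use eq x in auto)
        then show "nsub \<sigma> (liftN \<psi> \<^bold>\<longrightarrow> \<chi>) = nsub \<tau> (liftN \<psi> \<^bold>\<longrightarrow> \<chi>)"
          using ind eq by (simp add: liftN_def nsub_nsub)
      qed
    qed (use x in simp)
    then have "(AllN (liftN \<psi>) \<^bold>\<longrightarrow> AllN \<chi>) \<in> F"
      using deductive_filter_mp[OF F deductive_filter_theorem[OF F proves.DistN]] by blast
    then have "(AllN (liftN \<psi>) \<^bold>\<longrightarrow> AllN \<chi>) \<in> adjoin F \<psi>" "AllN (liftN \<psi>) \<in> adjoin F \<psi>"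
      using deductive_filter_adjoin(2)[OF F] deductive_filter_theorem[OF F proves.VacN]
      by (auto simp: adjoin_def)
    then show ?thesis using deductive_filter_mp[OF deductive_filter_adjoin(1)[OF F]] by blast
  qed
  then show ?thesis unfolding generalizesN_def by blast
qed

lemma generalizesS_adjoin:
  assumes F: "deductive_filter T F" and gen: "generalizesS F"
  shows "generalizesS (adjoin F \<psi>)"
proof -
  obtain N where N: "\<And>\<chi> x. x \<ge> N \<Longrightarrow>
     (\<forall>\<sigma> \<tau>. (\<forall>n. n \<noteq> Suc x \<longrightarrow> \<sigma> n = \<tau> n) \<longrightarrow> ssub \<sigma> \<chi> = ssub \<tau> \<chi>) \<Longrightarrow>
     instS x \<chi> \<in> F \<Longrightarrow> AllS \<chi> \<in> F"
    using gen unfolding generalizesS_def by blast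
  obtain M where M: "\<And>\<sigma> \<tau>. (\<forall>n<M. \<sigma> n = \<tau> n) \<Longrightarrow> ssub \<sigma> \<psi> = ssub \<tau> \<psi>"
    using ssub_bounded by blast
  have "AllS \<chi> \<in> adjoin F \<psi>" if x: "x \<ge> max M N"
    and ind: "\<forall>\<sigma> \<tau>. (\<forall>n. n \<noteq> Suc x \<longrightarrow> \<sigma> n = \<tau> n) \<longrightarrow> ssub \<sigma> \<chi> = ssub \<tau> \<chi>"
    and inst: "instS x \<chi> \<in> adjoin F \<psi>" for \<chi> x
  proof -
    have "instS x (liftS \<psi> \<^bold>\<longrightarrow> \<chi>) = (\<psi> \<^bold>\<longrightarrow> instS x \<chi>)"
      using instS_liftS[of x \<psi>] by (simp add: instS_def)
    then have 1: "instS x (liftS \<psi> \<^bold>\<longrightarrow> \<chi>) \<in> F" using inst by (simp add: adjoin_def)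
    have "AllS (liftS \<psi> \<^bold>\<longrightarrow> \<chi>) \<in> F"
    proof (rule N[OF _ _ 1])
      show "\<forall>\<sigma> \<tau>. (\<forall>n. n \<noteq> Suc x \<longrightarrow> \<sigma> n = \<tau> n) \<longrightarrow>
          ssub \<sigma> (liftS \<psi> \<^bold>\<longrightarrow> \<chi>) = ssub \<tau> (liftS \<psi> \<^bold>\<longrightarrow> \<chi>)"
      proof (intro allI impI)
        fix \<sigma> \<tau> :: "nat \<Rightarrow> nat" assume eq: "\<forall>n. n \<noteq> Suc x \<longrightarrow> \<sigma> n = \<tau> n"
        have "ssub (\<lambda>n. \<sigma> (Suc n)) \<psi> = ssub (\<lambda>n. \<tau> (Suc n)) \<psi>"
          by (rule M) (use eq x in auto)
        then show "ssub \<sigma> (liftS \<psi> \<^bold>\<longrightarrow> \<chi>) = ssub \<tau> (liftS \<psi> \<^bold>\<longrightarrow> \<chi>)"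
          using ind eq by (simp add: liftS_def ssub_ssub)
      qed
    qed (use x in simp)
    then have "(AllS (liftS \<psi>) \<^bold>\<longrightarrow> AllS \<chi>) \<in> F"
      using deductive_filter_mp[OF F deductive_filter_theorem[OF F proves.DistS]] by blast
    then have "(AllS (liftS \<psi>) \<^bold>\<longrightarrow> AllS \<chi>) \<in> adjoin F \<psi>" "AllS (liftS \<psi>) \<in> adjoin F \<psi>"
      using deductive_filter_adjoin(2)[OF F] deductive_filter_theorem[OF F proves.VacS]
      by (auto simp: adjoin_def)
    then show ?thesis using deductive_filter_mp[OF deductive_filter_adjoin(1)[OF F]] by blast
  qed
  then show ?thesis unfolding generalizesS_def by blast
qed

text \<open>Renaming \<open>x\<close> to 0 and shifting the other variables up turns the instance
  back into \<open>\<chi>\<close>, to which \<open>GenN\<close> applies.\<close>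

lemma generalizesN_theorems: "generalizesN {\<psi>. T \<turnstile> \<psi>}"
proof -
  have "T \<turnstile> AllN \<chi>" if ind: "\<forall>\<sigma> \<tau>. (\<forall>n. n \<noteq> Suc x \<longrightarrow> \<sigma> n = \<tau> n) \<longrightarrow> nsub \<sigma> \<chi> = nsub \<tau> \<chi>"
    and "T \<turnstile> instN (Var x) \<chi>" for \<chi> x
  proof -
    let ?\<tau> = "\<lambda>n. if n = x then Var 0 else Var (Suc n)"
    have "T \<turnstile> nsub ?\<tau> (instN (Var x) \<chi>)" using that(2) by (rule proves_nsub)
    moreover have "nsub ?\<tau> (instN (Var x) \<chi>) = nsub (\<lambda>n. tsub ?\<tau> (case_nat (Var x) Var n)) \<chi>"
      by (simp add: instN_def nsub_nsub)
    moreover have "\<dots> = nsub Var \<chi>"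
      by (rule ind[rule_format]) (auto split: nat.split)
    ultimately show ?thesis by (simp add: proves.GenN)
  qed
  then show ?thesis unfolding generalizesN_def by blast
qed

lemma generalizesS_theorems: "generalizesS {\<psi>. T \<turnstile> \<psi>}"
proof -
  have "T \<turnstile> AllS \<chi>" if ind: "\<forall>\<sigma> \<tau>. (\<forall>n. n \<noteq> Suc x \<longrightarrow> \<sigma> n = \<tau> n) \<longrightarrow> ssub \<sigma> \<chi> = ssub \<tau> \<chi>"
    and "T \<turnstile> instS x \<chi>" for \<chi> x
  proof -
    let ?\<tau> = "\<lambda>n. if n = x then 0 else Suc n"
    have "T \<turnstile> ssub ?\<tau> (instS x \<chi>)" using that(2) by (rule proves_ssub)
    moreover have "ssub ?\<tau> (instS x \<chi>) = ssub (\<lambda>n. ?\<tau> (case_nat x (\<lambda>n. n) n)) \<chi>"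
      by (simp add: instS_def ssub_ssub)
    moreover have "\<dots> = ssub (\<lambda>n. n) \<chi>"
      by (rule ind[rule_format]) (auto split: nat.split)
    ultimately show ?thesis by (simp add: proves.GenS)
  qed
  then show ?thesis unfolding generalizesS_def by blast
qed

definition consistent_filter :: "fm set \<Rightarrow> fm set \<Rightarrow> bool" where
  "consistent_filter T F \<longleftrightarrow>
     deductive_filter T F \<and> Falsum \<notin> F \<and> generalizesN F \<and> generalizesS F"

text \<open>Maximality and the witness property for both sorts of quantifiers in one condition that
  persists when the filter grows.\<close>

definition decides :: "fm set \<Rightarrow> fm \<Rightarrow> bool" where
  "decides G \<psi> \<longleftrightarrow> \<psi> \<in> G \<or> (\<^bold>\<not> \<psi>) \<in> G \<and>
     (\<forall>\<chi>. \<psi> = AllN \<chi> \<longrightarrow> (\<exists>t. (\<^bold>\<not> instN t \<chi>) \<in> G)) \<and>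
     (\<forall>\<chi>. \<psi> = AllS \<chi> \<longrightarrow> (\<exists>X. (\<^bold>\<not> instS X \<chi>) \<in> G))"

lemma decides_mono: "decides F \<psi> \<Longrightarrow> F \<subseteq> G \<Longrightarrow> decides G \<psi>"
  unfolding decides_def by blast

lemma consistent_filter_adjoin:
  assumes "consistent_filter T F" "(\<^bold>\<not> \<psi>) \<notin> F"
  shows "consistent_filter T (adjoin F \<psi>)"
  using assms deductive_filter_adjoin(1) generalizesN_adjoin generalizesS_adjoin
  unfolding consistent_filter_def by (auto simp: adjoin_def)

lemma consistent_filter_extend:
  assumes F: "consistent_filter T F"
  shows "\<exists>G. consistent_filter T G \<and> F \<subseteq> G \<and> decides G \<psi>"
proof (cases "(\<^bold>\<not> \<psi>) \<in> F")
  case False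
  then show ?thesis
    using consistent_filter_adjoin[OF F False] deductive_filter_adjoin[of T F \<psi>] F
    unfolding decides_def consistent_filter_def by blast
next
  case neg: True
  have D: "deductive_filter T F" using F by (simp add: consistent_filter_def)
  have notin: "\<psi> \<notin> F" using neg D F deductive_filter_mp unfolding consistent_filter_def by blast
  have witness: ?thesis if "(\<^bold>\<not> \<theta>) \<notin> F" "decides (adjoin F \<theta>) \<psi>" for \<theta>
    using consistent_filter_adjoin[OF F that(1)] deductive_filter_adjoin[OF D] that by blast
  have dneg: "\<chi> \<in> F" if "(\<^bold>\<not> \<^bold>\<not> \<chi>) \<in> F" for \<chi>
    using deductive_filter_mp[OF D deductive_filter_theorem[OF D proves.DNeg] that] .
  have neg': "(\<^bold>\<not> \<psi>) \<in> adjoin F \<theta>" for \<theta> using neg deductive_filter_adjoin(2)[OF D] by blast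
  show ?thesis
  proof (cases \<psi>)
    case (AllN \<chi>)
    obtain N where N: "\<And>\<chi> x. x \<ge> N \<Longrightarrow>
     (\<forall>\<sigma> \<tau>. (\<forall>n. n \<noteq> Suc x \<longrightarrow> \<sigma> n = \<tau> n) \<longrightarrow> nsub \<sigma> \<chi> = nsub \<tau> \<chi>) \<Longrightarrow>
     instN (Var x) \<chi> \<in> F \<Longrightarrow> AllN \<chi> \<in> F"
      using F unfolding consistent_filter_def generalizesN_def by blast
    obtain M where M: "\<And>\<sigma> \<tau>. (\<forall>n<M. \<sigma> n = \<tau> n) \<Longrightarrow> nsub \<sigma> \<chi> = nsub \<tau> \<chi>"
      using nsub_bounded by blast
    \<comment> \<open>The variable is fresh for \<open>\<chi>\<close> and above the threshold, so
      with this instance \<open>AllN \<chi>\<close> would be in \<open>F\<close> too, against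
      \<open>notin\<close>.\<close>
    have "instN (Var (max M N)) \<chi> \<notin> F"
    proof
      assume 1: "instN (Var (max M N)) \<chi> \<in> F"
      have "AllN \<chi> \<in> F" by (rule N[OF _ _ 1]) (auto intro!: M)
      then show False using notin AllN by simp
    qed
    then have *: "(\<^bold>\<not> \<^bold>\<not> instN (Var (max M N)) \<chi>) \<notin> F" using dneg by blast
    show ?thesis
      by (rule witness[OF *]) (use neg' deductive_filter_adjoin(3)[OF D] AllN in \<open>auto simp: decides_def\<close>)
  next
    case (AllS \<chi>)
    obtain N where N: "\<And>\<chi> x. x \<ge> N \<Longrightarrow>
     (\<forall>\<sigma> \<tau>. (\<forall>n. n \<noteq> Suc x \<longrightarrow> \<sigma> n = \<tau> n) \<longrightarrow> ssub \<sigma> \<chi> = ssub \<tau> \<chi>) \<Longrightarrow>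
     instS x \<chi> \<in> F \<Longrightarrow> AllS \<chi> \<in> F"
      using F unfolding consistent_filter_def generalizesS_def by blast
    obtain M where M: "\<And>\<sigma> \<tau>. (\<forall>n<M. \<sigma> n = \<tau> n) \<Longrightarrow> ssub \<sigma> \<chi> = ssub \<tau> \<chi>"
      using ssub_bounded by blast
    have "instS (max M N) \<chi> \<notin> F"
    proof
      assume 1: "instS (max M N) \<chi> \<in> F"
      have "AllS \<chi> \<in> F" by (rule N[OF _ _ 1]) (auto intro!: M)
      then show False using notin AllS by simp
    qed
    then have *: "(\<^bold>\<not> \<^bold>\<not> instS (max M N) \<chi>) \<notin> F" using dneg by blast
    show ?thesis
      by (rule witness[OF *]) (use neg' deductive_filter_adjoin(3)[OF D] AllS in \<open>auto simp: decides_def\<close>)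
  qed (use F neg in \<open>auto simp: decides_def\<close>)
qed

lemma henkin_filter_exists:
  assumes "\<not> (T \<turnstile> \<theta>)"
  shows "\<exists>U. deductive_filter T U \<and> Falsum \<notin> U \<and> (\<^bold>\<not> \<theta>) \<in> U \<and> (\<forall>\<psi>. decides U \<psi>)"
proof -
  let ?T = "{\<psi>. T \<turnstile> \<psi>}"
  have T: "deductive_filter T ?T" unfolding deductive_filter_def using proves.MP by blast
  have nn: "(\<^bold>\<not> \<^bold>\<not> \<theta>) \<notin> ?T" using assms proves.MP proves.DNeg by blast
  then have "Falsum \<notin> ?T" using proves.MP proves.PropK by blast
  then have "consistent_filter T ?T"
    using T generalizesN_theorems generalizesS_theorems by (simp add: consistent_filter_def)
  then have start: "consistent_filter T (adjoin ?T (\<^bold>\<not> \<theta>))"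
    using nn consistent_filter_adjoin by blast
  \<comment> \<open>Only the stages have to provide fresh variables; their union already contains
    the witnesses that were put in on the way.\<close>
  have "\<exists>f. \<forall>n. (consistent_filter T (f n) \<and> (\<^bold>\<not> \<theta>) \<in> f n) \<and>
      (f n \<subseteq> f (Suc n) \<and> decides (f (Suc n)) (from_nat n))"
  proof (rule dependent_nat_choice)
    show "\<exists>F. consistent_filter T F \<and> (\<^bold>\<not> \<theta>) \<in> F"
      using start deductive_filter_adjoin(3)[OF T] by blast
    show "\<exists>G. (consistent_filter T G \<and> (\<^bold>\<not> \<theta>) \<in> G) \<and> F \<subseteq> G \<and> decides G (from_nat n)"
      if "consistent_filter T F \<and> (\<^bold>\<not> \<theta>) \<in> F" for F n
      using consistent_filter_extend that by blast
  qed
  then obtain f where f: "\<And>n. consistent_filter T (f n)" "\<And>n. (\<^bold>\<not> \<theta>) \<in> f n"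
    "\<And>n. f n \<subseteq> f (Suc n)" "\<And>n. decides (f (Suc n)) (from_nat n)" by blast
  have mono: "f m \<subseteq> f n" if "m \<le> n" for m n
    using lift_Suc_mono_le[of f, OF f(3) that] .
  let ?U = "\<Union>n. f n"
  have "deductive_filter T ?U"
    unfolding deductive_filter_def
  proof (intro conjI allI impI)
    show "\<phi> \<in> ?U" if "T \<turnstile> \<phi>" for \<phi>
      using f(1) that unfolding consistent_filter_def deductive_filter_def by blast
    show "\<psi> \<in> ?U" if "(\<phi> \<^bold>\<longrightarrow> \<psi>) \<in> ?U" "\<phi> \<in> ?U" for \<phi> \<psi>
    proof -
      obtain m n where "(\<phi> \<^bold>\<longrightarrow> \<psi>) \<in> f m" "\<phi> \<in> f n" using \<open>(\<phi> \<^bold>\<longrightarrow> \<psi>) \<in> ?U\<close> \<open>\<phi> \<in> ?U\<close> by blast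
      then have "(\<phi> \<^bold>\<longrightarrow> \<psi>) \<in> f (max m n)" "\<phi> \<in> f (max m n)"
        using mono[of m "max m n"] mono[of n "max m n"] by auto
      then have "\<psi> \<in> f (max m n)"
        using f(1) deductive_filter_mp unfolding consistent_filter_def by blast
      then show ?thesis by blast
    qed
  qed
  moreover have "Falsum \<notin> ?U" using f(1) unfolding consistent_filter_def by blast
  moreover have "(\<^bold>\<not> \<theta>) \<in> ?U" using f(2) by blast
  moreover have "decides ?U \<psi>" for \<psi>
    using f(4)[of "to_nat \<psi>"] decides_mono[of "f (Suc (to_nat \<psi>))" \<psi> ?U] by auto
  ultimately show ?thesis by blast
qed

section \<open>Structures for the language and Tarskian truth\<close>

record 'a interp =
  izero :: 'a
  ione :: 'a
  iadd :: "'a \<Rightarrow> 'a \<Rightarrow> 'a"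
  imul :: "'a \<Rightarrow> 'a \<Rightarrow> 'a"
  iless :: "'a \<Rightarrow> 'a \<Rightarrow> bool"
  isets :: "'a set set"

primrec tval :: "'a interp \<Rightarrow> (nat \<Rightarrow> 'a) \<Rightarrow> tm \<Rightarrow> 'a" where
  "tval M e (Var n) = e n"
| "tval M e Zero = izero M"
| "tval M e One = ione M"
| "tval M e (Add s t) = iadd M (tval M e s) (tval M e t)"
| "tval M e (Mul s t) = imul M (tval M e s) (tval M e t)"

primrec sat :: "'a interp \<Rightarrow> (nat \<Rightarrow> 'a) \<Rightarrow> (nat \<Rightarrow> 'a set) \<Rightarrow> fm \<Rightarrow> bool" where
  "sat M e s (Eq t u) \<longleftrightarrow> tval M e t = tval M e u"
| "sat M e s (Less t u) \<longleftrightarrow> iless M (tval M e t) (tval M e u)"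
| "sat M e s (Mem t X) \<longleftrightarrow> tval M e t \<in> s X"
| "sat M e s Falsum \<longleftrightarrow> False"
| "sat M e s (\<phi> \<^bold>\<longrightarrow> \<psi>) \<longleftrightarrow> (sat M e s \<phi> \<longrightarrow> sat M e s \<psi>)"
| "sat M e s (AllN \<phi>) \<longleftrightarrow> (\<forall>x. sat M (case_nat x e) s \<phi>)"
| "sat M e s (AllS \<phi>) \<longleftrightarrow> (\<forall>X \<in> isets M. sat M e (case_nat X s) \<phi>)"

definition models :: "'a interp \<Rightarrow> fm set \<Rightarrow> bool" where
  "models M T \<longleftrightarrow> isets M \<noteq> {} \<and> (\<forall>\<phi>\<in>T. \<forall>e s. range s \<subseteq> isets M \<longrightarrow> sat M e s \<phi>)"

primrec numeral_tm :: "nat \<Rightarrow> tm" where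
  "numeral_tm 0 = Zero"
| "numeral_tm (Suc n) = Add (numeral_tm n) One"

text \<open>The carrier is an arbitrary countably infinite type: the distinctness of the numerals makes
  the quotient of the terms infinite.\<close>

theorem completeness:
  fixes g :: "'a \<Rightarrow> nat" and T :: "fm set"
  assumes g: "bij g"
    and succ_nonzero: "\<And>t. T \<turnstile> \<^bold>\<not> Eq (Add t One) Zero"
    and succ_inj: "\<And>t u. T \<turnstile> Eq (Add t One) (Add u One) \<^bold>\<longrightarrow> Eq t u"
    and unprovable: "\<not> (T \<turnstile> \<theta>)"
  shows "\<exists>M :: 'a interp. models M T \<and> (\<exists>e s. range s \<subseteq> isets M \<and> \<not> sat M e s \<theta>)"
proof -
  obtain U where U: "deductive_filter T U" "Falsum \<notin> U" "(\<^bold>\<not> \<theta>) \<in> U" "\<And>\<psi>. decides U \<psi>"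
    using henkin_filter_exists[OF unprovable] by blast
  note thm_U = deductive_filter_theorem[OF U(1)] and mp = deductive_filter_mp[OF U(1)]
  have neg: "(\<^bold>\<not> \<psi>) \<in> U \<longleftrightarrow> \<psi> \<notin> U" for \<psi>
    using U(4)[of \<psi>] mp[of \<psi> Falsum] U(2) unfolding decides_def by blast
  have imp: "(\<phi> \<^bold>\<longrightarrow> \<psi>) \<in> U \<longleftrightarrow> (\<phi> \<in> U \<longrightarrow> \<psi> \<in> U)" for \<phi> \<psi>
  proof
    show "(\<phi> \<^bold>\<longrightarrow> \<psi>) \<in> U \<Longrightarrow> \<phi> \<in> U \<longrightarrow> \<psi> \<in> U" using mp by blast
    assume R: "\<phi> \<in> U \<longrightarrow> \<psi> \<in> U"
    show "(\<phi> \<^bold>\<longrightarrow> \<psi>) \<in> U"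
    proof (cases "\<psi> \<in> U")
      case True
      then show ?thesis using mp[OF thm_U[OF proves.PropK]] by blast
    next
      case False
      then have n: "(\<^bold>\<not> \<phi>) \<in> U" using R neg by blast
      have "(\<phi> \<^bold>\<longrightarrow> Falsum \<^bold>\<longrightarrow> \<psi>) \<in> U"
      proof -
        have "(Falsum \<^bold>\<longrightarrow> \<psi>) \<in> U"
        proof -
          have "(Falsum \<^bold>\<longrightarrow> \<^bold>\<not> \<^bold>\<not> \<psi>) \<in> U" by (rule thm_U[OF proves.PropK])
          moreover have "(Falsum \<^bold>\<longrightarrow> \<^bold>\<not> \<^bold>\<not> \<psi> \<^bold>\<longrightarrow> \<psi>) \<in> U"
            using mp[OF thm_U[OF proves.PropK] thm_U[OF proves.DNeg]] .
          ultimately show ?thesis using mp[OF mp[OF thm_U[OF proves.PropS]]] by blast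
        qed
        then show ?thesis using mp[OF thm_U[OF proves.PropK]] by blast
      qed
      then show ?thesis using mp[OF mp[OF thm_U[OF proves.PropS]] n] by blast
    qed
  qed
  have allN: "AllN \<chi> \<in> U \<longleftrightarrow> (\<forall>t. instN t \<chi> \<in> U)" for \<chi>
    using U(4)[of "AllN \<chi>"] neg mp[OF thm_U[OF proves.InstN]] unfolding decides_def by blast
  have allS: "AllS \<chi> \<in> U \<longleftrightarrow> (\<forall>X. instS X \<chi> \<in> U)" for \<chi>
    using U(4)[of "AllS \<chi>"] neg mp[OF thm_U[OF proves.InstS]] unfolding decides_def by blast
  have refl: "Eq t t \<in> U" for t by (rule thm_U[OF proves.EqRefl])
  have inst_up: "tsub (case_nat t Var) (up (Suc 0) u) = u" for t u by (simp add: tsub_up)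
  have subst: "instN u \<phi> \<in> U" if "Eq t u \<in> U" "instN t \<phi> \<in> U" for t u \<phi>
    using mp[OF mp[OF thm_U[OF proves.EqSubst] that(1)] that(2)] .
  have sym: "Eq u t \<in> U" if "Eq t u \<in> U" for t u
    using subst[OF that, of "Eq (Var 0) (up (Suc 0) t)"] refl by (simp add: instN_def inst_up)
  have trans: "Eq t v \<in> U" if "Eq t u \<in> U" "Eq u v \<in> U" for t u v
    using subst[OF that(2), of "Eq (up (Suc 0) t) (Var 0)"] that(1) by (simp add: instN_def inst_up)
  have cong1: "Eq (F t w) (F u w) \<in> U" if "Eq t u \<in> U"
    "\<And>a b. tsub (case_nat a Var) (F (Var 0) (up (Suc 0) b)) = F a b"
    "\<And>a b c. tsub (case_nat c Var) (F (up (Suc 0) a) (up (Suc 0) b)) = F a b" for F t u w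
    using subst[OF that(1), of "Eq (F (up (Suc 0) t) (up (Suc 0) w)) (F (Var 0) (up (Suc 0) w))"] refl
    by (simp add: instN_def that(2,3))
  have cong2: "Eq (F w t) (F w u) \<in> U" if "Eq t u \<in> U"
    "\<And>a b. tsub (case_nat a Var) (F (up (Suc 0) b) (Var 0)) = F b a"
    "\<And>a b c. tsub (case_nat c Var) (F (up (Suc 0) a) (up (Suc 0) b)) = F a b" for F t u w
    using subst[OF that(1), of "Eq (F (up (Suc 0) w) (up (Suc 0) t)) (F (up (Suc 0) w) (Var 0))"] refl
    by (simp add: instN_def that(2,3))
  define cls where "cls t = {u. Eq t u \<in> U}" for t
  have cls_eq: "cls t = cls u \<longleftrightarrow> Eq t u \<in> U" for t u
    unfolding cls_def using sym trans refl by blast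
  have num_inj: "inj (\<lambda>n. cls (numeral_tm n))"
  proof (rule injI)
    fix m n assume "cls (numeral_tm m) = cls (numeral_tm n)"
    then have "Eq (numeral_tm m) (numeral_tm n) \<in> U" by (simp add: cls_eq)
    then show "m = n"
    proof (induction m arbitrary: n)
      case 0
      show ?case
      proof (cases n)
        case (Suc k)
        then show ?thesis using 0 sym[of Zero] thm_U[OF succ_nonzero] neg by auto
      qed simp
    next
      case (Suc m)
      show ?case
      proof (cases n)
        case 0
        then show ?thesis using Suc.prems thm_U[OF succ_nonzero] neg by simp
      next
        case (Suc k)
        then show ?thesis using Suc.prems Suc.IH mp[OF thm_U[OF succ_inj]] by simp
      qed
    qed
  qed
  have "infinite (range (\<lambda>n. cls (numeral_tm n)))"
    using num_inj by (rule range_inj_infinite)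
  then have inf: "infinite (range cls)"
    by (rule contrapos_nn) (erule finite_subset[rotated], auto)
  have count: "countable (range cls)" by simp
  obtain q where q: "bij_betw q (range cls) (UNIV :: nat set)"
    using countableE_infinite[OF count inf] by blast
  \<comment> \<open>The element denoted by a term: classes are numbered by \<open>q\<close> and
    moved to the prescribed carrier along \<open>g\<close>.\<close>
  define h where "h t = inv g (q (cls t))" for t
  have h_eq: "h t = h u \<longleftrightarrow> Eq t u \<in> U" for t u
  proof -
    have "h t = h u \<longleftrightarrow> q (cls t) = q (cls u)"
      unfolding h_def using bij_is_surj[OF g] by (metis surj_f_inv_f)
    also have "\<dots> \<longleftrightarrow> cls t = cls u" using q by (auto simp: bij_betw_def inj_on_def)
    finally show ?thesis by (simp add: cls_eq)
  qed
  have h_surj: "\<exists>t. h t = x" for x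
  proof -
    have "g x \<in> q ` range cls" using q by (simp add: bij_betw_def)
    then obtain t where "g x = q (cls t)" by blast
    then have "h t = x" unfolding h_def using g by (metis bij_is_inj inv_f_f)
    then show ?thesis ..
  qed
  define r where "r x = (SOME t. h t = x)" for x
  have hr: "h (r x) = x" for x unfolding r_def using h_surj by (rule someI_ex)
  have rh: "Eq (r (h t)) t \<in> U" for t using hr[of "h t"] h_eq by blast
  define I where "I X = {h t | t. Mem t X \<in> U}" for X
  define M where "M = \<lparr>izero = h Zero, ione = h One, iadd = (\<lambda>x y. h (Add (r x) (r y))),
    imul = (\<lambda>x y. h (Mul (r x) (r y))), iless = (\<lambda>x y. Less (r x) (r y) \<in> U), isets = range I\<rparr>"
  have less_cong: "Less t u \<in> U \<longleftrightarrow> Less t' u' \<in> U" if "Eq t t' \<in> U" "Eq u u' \<in> U" for t t' u u'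
  proof -
    have "Less t' u' \<in> U" if "Eq t t' \<in> U" "Eq u u' \<in> U" "Less t u \<in> U" for t t' u u'
    proof -
      have "Less t' u \<in> U"
        using subst[OF that(1), of "Less (Var 0) (up (Suc 0) u)"] that(3) by (simp add: instN_def inst_up)
      then show ?thesis
        using subst[OF that(2), of "Less (up (Suc 0) t') (Var 0)"] by (simp add: instN_def inst_up)
    qed
    then show ?thesis using that sym by blast
  qed
  have mem_cong: "Mem t' X \<in> U" if "Eq t t' \<in> U" "Mem t X \<in> U" for t t' X
    using subst[OF that(1), of "Mem (Var 0) X"] that(2) by (simp add: instN_def)
  have add_cong: "Eq (Add t u) (Add t' u') \<in> U" if "Eq t t' \<in> U" "Eq u u' \<in> U" for t t' u u'
    using trans[OF cong1[of _ _ Add u, OF that(1)] cong2[of _ _ Add t', OF that(2)]]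
    by (simp add: inst_up)
  have mul_cong: "Eq (Mul t u) (Mul t' u') \<in> U" if "Eq t t' \<in> U" "Eq u u' \<in> U" for t t' u u'
    using trans[OF cong1[of _ _ Mul u, OF that(1)] cong2[of _ _ Mul t', OF that(2)]]
    by (simp add: inst_up)
  have tval: "tval M (\<lambda>n. h (\<sigma> n)) t = h (tsub \<sigma> t)" for \<sigma> t
  proof (induction t)
    case (Add t u)
    then show ?case using add_cong rh by (simp add: M_def h_eq)
  next
    case (Mul t u)
    then show ?case using mul_cong rh by (simp add: M_def h_eq)
  qed (auto simp: M_def)
  \<comment> \<open>Assignments are given by terms and set indices, so that a quantifier only
    extends \<open>\<sigma>\<close> or \<open>\<rho>\<close>; every element and every set of the
    structure has such a name.\<close>
  have truth: "sat M (\<lambda>n. h (\<sigma> n)) (\<lambda>n. I (\<rho> n)) \<phi> \<longleftrightarrow> nsub \<sigma> (ssub \<rho> \<phi>) \<in> U" for \<sigma> \<rho> \<phi>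
  proof (induction \<phi> arbitrary: \<sigma> \<rho>)
    case (Eq t u)
    then show ?case by (simp add: tval h_eq)
  next
    case (Less t u)
    then show ?case by (simp add: tval) (simp add: M_def less_cong rh)
  next
    case (Mem t X)
    then show ?case using refl by (auto simp: tval I_def h_eq intro: mem_cong sym)
  next
    case Falsum
    then show ?case using U(2) by simp
  next
    case (Imp \<phi> \<psi>)
    then show ?case by (simp add: imp)
  next
    case (AllN \<phi>)
    have "sat M (\<lambda>n. h (\<sigma> n)) (\<lambda>n. I (\<rho> n)) (AllN \<phi>) \<longleftrightarrow>
        (\<forall>t. sat M (case_nat (h t) (\<lambda>n. h (\<sigma> n))) (\<lambda>n. I (\<rho> n)) \<phi>)"
      by simp (metis h_surj)
    moreover have "case_nat (h t) (\<lambda>n. h (\<sigma> n)) = (\<lambda>n. h (case_nat t \<sigma> n))" for t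
      by (rule ext) (simp split: nat.split)
    moreover have "instN t (nsub (case_nat (Var 0) (\<lambda>n. up 1 (\<sigma> n))) (ssub \<rho> \<phi>))
        = nsub (case_nat t \<sigma>) (ssub \<rho> \<phi>)" for t
      unfolding instN_def nsub_nsub
      by (rule arg_cong[of _ _ "\<lambda>\<sigma>. nsub \<sigma> _"], rule ext) (simp add: tsub_up split: nat.split)
    ultimately show ?case using allN AllN.IH by simp
  next
    case (AllS \<phi>)
    have "sat M (\<lambda>n. h (\<sigma> n)) (\<lambda>n. I (\<rho> n)) (AllS \<phi>) \<longleftrightarrow>
        (\<forall>X. sat M (\<lambda>n. h (\<sigma> n)) (case_nat (I X) (\<lambda>n. I (\<rho> n))) \<phi>)"
      by (simp add: M_def)
    moreover have "case_nat (I X) (\<lambda>n. I (\<rho> n)) = (\<lambda>n. I (case_nat X \<rho> n))" for X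
      by (rule ext) (simp split: nat.split)
    moreover have "instS X (nsub \<sigma> (ssub (case_nat 0 (\<lambda>n. Suc (\<rho> n))) \<phi>))
        = nsub \<sigma> (ssub (case_nat X \<rho>) \<phi>)" for X
      unfolding instS_def nsub_ssub ssub_ssub
      by (rule arg_cong[of _ _ "\<lambda>\<rho>. ssub \<rho> _"], rule ext) (simp split: nat.split)
    ultimately show ?case using allS AllS.IH by simp
  qed
  have "models M T"
    unfolding models_def
  proof (intro conjI ballI allI impI)
    show "isets M \<noteq> {}" by (simp add: M_def)
    fix \<phi> and e :: "nat \<Rightarrow> 'a" and s :: "nat \<Rightarrow> 'a set"
    assume \<phi>: "\<phi> \<in> T" and s: "range s \<subseteq> isets M"
    obtain \<rho> where \<rho>: "s = (\<lambda>n. I (\<rho> n))"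
      using s unfolding M_def by simp (metis (no_types) range_subsetD image_iff ext)
    have "nsub (\<lambda>n. r (e n)) (ssub \<rho> \<phi>) \<in> U"
      using \<phi> by (intro thm_U proves_nsub proves_ssub proves.Axiom)
    then show "sat M e s \<phi>" using truth[of "\<lambda>n. r (e n)" \<rho> \<phi>] by (simp add: hr \<rho>)
  qed
  moreover have "\<not> sat M (\<lambda>n. h (Var n)) (\<lambda>n. I n) \<theta>"
    using truth[of Var "\<lambda>n. n" \<theta>] U(3) neg by simp
  moreover have "range (\<lambda>n. I n) \<subseteq> isets M" by (auto simp: M_def)
  ultimately show ?thesis by blast
qed


section \<open>A generic model of $\mathsf{RCA}_0$\<close>

lemma tval_tsub: "tval M e (tsub \<sigma> t) = tval M (\<lambda>n. tval M e (\<sigma> n)) t"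
  by (induction t) auto

lemma tval_up [simp]: "tval M e (up k t) = tval M (\<lambda>n. e (n + k)) t"
  by (simp add: up_def tval_tsub)

lemma sat_nsub: "sat M e s (nsub \<sigma> \<phi>) \<longleftrightarrow> sat M (\<lambda>n. tval M e (\<sigma> n)) s \<phi>"
proof (induction \<phi> arbitrary: e s \<sigma>)
  case (AllN \<phi>)
  have "(\<lambda>n. tval M (case_nat x e) (case_nat (Var 0) (\<lambda>n. up 1 (\<sigma> n)) n))
      = case_nat x (\<lambda>n. tval M e (\<sigma> n))" for x
    by (rule ext) (simp split: nat.split)
  then show ?case by (simp only: nsub.simps sat.simps AllN.IH)
qed (auto simp: tval_tsub)

lemma sat_ssub: "sat M e s (ssub \<rho> \<phi>) \<longleftrightarrow> sat M e (\<lambda>n. s (\<rho> n)) \<phi>"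
proof (induction \<phi> arbitrary: e s \<rho>)
  case (AllS \<phi>)
  have "(\<lambda>n. case_nat X s (case_nat 0 (\<lambda>n. Suc (\<rho> n)) n)) = case_nat X (\<lambda>n. s (\<rho> n))" for X
    by (rule ext) (simp split: nat.split)
  then show ?case by (simp only: ssub.simps sat.simps AllS.IH)
qed auto

lemma sat_instN: "sat M e s (instN t \<phi>) \<longleftrightarrow> sat M (case_nat (tval M e t) e) s \<phi>"
proof -
  have "(\<lambda>n. tval M e (case_nat t Var n)) = case_nat (tval M e t) e"
    by (rule ext) (simp split: nat.split)
  then show ?thesis by (simp only: instN_def sat_nsub)
qed

lemma sat_liftS: "sat M e (case_nat X s) (liftS \<phi>) \<longleftrightarrow> sat M e s \<phi>"
  by (simp add: liftS_def sat_ssub)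

lemma sat_induction:
  "sat M e s (induction \<phi>) \<longleftrightarrow>
    (sat M (case_nat (izero M) e) s \<phi> \<and>
     (\<forall>x. sat M (case_nat x e) s \<phi> \<longrightarrow> sat M (case_nat (iadd M x (ione M)) e) s \<phi>) \<longrightarrow>
     (\<forall>x. sat M (case_nat x e) s \<phi>))"
proof -
  have "(\<lambda>n. tval M (case_nat x e) (case_nat (Add (Var 0) One) (\<lambda>n. Var (Suc n)) n))
      = case_nat (iadd M x (ione M)) e" for x
    by (rule ext) (simp split: nat.split)
  then show ?thesis by (simp add: induction_def sat_instN sat_nsub)
qed

lemma sat_comprehension:
  "sat M e s (comprehension \<phi> \<psi>) \<longleftrightarrow>
    ((\<forall>x. sat M (case_nat x e) s \<phi> \<longleftrightarrow> sat M (case_nat x e) s \<psi>) \<longrightarrow>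
     (\<exists>X \<in> isets M. \<forall>x. x \<in> X \<longleftrightarrow> sat M (case_nat x e) s \<phi>))"
  by (auto simp: comprehension_def sat_liftS)

text \<open>A copy of \<open>nat\<close> without class instances, so that a model can supply them;
  being countably infinite, it is a carrier that \<open>completeness\<close> accepts.\<close>

typedef mnat = "UNIV :: nat set" ..

definition standard_interp :: "mnat interp" where
  "standard_interp = \<lparr>izero = Abs_mnat 0, ione = Abs_mnat 1,
     iadd = (\<lambda>x y. Abs_mnat (Rep_mnat x + Rep_mnat y)),
     imul = (\<lambda>x y. Abs_mnat (Rep_mnat x * Rep_mnat y)),
     iless = (\<lambda>x y. Rep_mnat x < Rep_mnat y), isets = UNIV\<rparr>"

text \<open>Ensures that the choice in \<open>generic_interp\<close> yields a model even if there is
  no counterexample.\<close>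

lemma models_standard_interp: "models standard_interp RCA0"
proof -
  have basic: "sat standard_interp e s \<phi>" if "\<phi> \<in> basic_axioms" for e s \<phi>
    using that
    by (auto simp: basic_axioms_def standard_interp_def Let_def Abs_mnat_inject Abs_mnat_inverse
        Rep_mnat_inverse Rep_mnat_inject[symmetric] less_Suc_eq)
  have ind: "sat standard_interp e s (induction \<phi>)" for e s \<phi>
    unfolding sat_induction
  proof (intro impI allI, elim conjE)
    fix x
    assume 0: "sat standard_interp (case_nat (izero standard_interp) e) s \<phi>"
      and step: "\<forall>x. sat standard_interp (case_nat x e) s \<phi> \<longrightarrow>
        sat standard_interp (case_nat (iadd standard_interp x (ione standard_interp)) e) s \<phi>"
    have "sat standard_interp (case_nat (Abs_mnat n) e) s \<phi>" for n
    proof (induction n)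
      case 0
      then show ?case using 0 \<open>sat standard_interp (case_nat (izero standard_interp) e) s \<phi>\<close>
        by (simp add: standard_interp_def)
    next
      case (Suc n)
      then show ?case using step by (auto simp: standard_interp_def Abs_mnat_inverse)
    qed
    then show "sat standard_interp (case_nat x e) s \<phi>" by (metis Rep_mnat_inverse)
  qed
  have "sat standard_interp e s (comprehension \<phi> \<psi>)" for e s \<phi> \<psi>
  proof -
    have "\<exists>X \<in> isets standard_interp. \<forall>x. x \<in> X \<longleftrightarrow> sat standard_interp (case_nat x e) s \<phi>"
      by (rule bexI[of _ "{x. sat standard_interp (case_nat x e) s \<phi>}"])
        (auto simp: standard_interp_def)
    then show ?thesis unfolding sat_comprehension by blast
  qed
  then show ?thesis using basic ind unfolding models_def RCA0_def
    by (auto simp: standard_interp_def)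
qed

definition valid_in :: "'a interp \<Rightarrow> fm \<Rightarrow> bool" where
  "valid_in M \<phi> \<longleftrightarrow> (\<forall>e s. range s \<subseteq> isets M \<longrightarrow> sat M e s \<phi>)"

text \<open>Both equivalences together, so that a single structure serves for the two provability
  claims.\<close>

definition refutes_equivalence :: "mnat interp \<Rightarrow> bool" where
  "refutes_equivalence M \<longleftrightarrow>
     \<not> (valid_in M (HT32_apart \<^bold>\<longleftrightarrow> RT32) \<and> valid_in M (HT32_apart \<^bold>\<longleftrightarrow> FUT32))"

text \<open>A model of $\mathsf{RCA}_0$ that is a counterexample to the theorem if there is one. Making it
  a type, rather than reasoning about an arbitrary structure, gives access to the arithmetic of
  the type classes.\<close>

definition generic_interp :: "mnat interp" where
  "generic_interp = (SOME M. models M RCA0 \<and>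
     ((\<exists>M'. models M' RCA0 \<and> refutes_equivalence M') \<longrightarrow> refutes_equivalence M))"

lemma generic_interp:
  "models generic_interp RCA0 \<and>
    ((\<exists>M'. models M' RCA0 \<and> refutes_equivalence M') \<longrightarrow> refutes_equivalence generic_interp)"
  unfolding generic_interp_def by (rule someI_ex) (use models_standard_interp in blast)

text \<open>If one of the equivalences were unprovable, completeness would give a countermodel on
  \<open>mnat\<close>, and then the choice of \<open>generic_interp\<close> would have fallen on a
  refuting model.\<close>

lemma provable_by_generic_interp:
  assumes "\<not> refutes_equivalence generic_interp"
  shows "(RCA0 \<turnstile> HT32_apart \<^bold>\<longleftrightarrow> RT32) \<and> (RCA0 \<turnstile> HT32_apart \<^bold>\<longleftrightarrow> FUT32)"
proof -
  have bij: "bij Rep_mnat"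
    by (rule o_bij[of Abs_mnat]) (auto simp: Abs_mnat_inverse Rep_mnat_inverse)
  have "RCA0 \<turnstile> \<^bold>\<not> Eq (Add (Var 1) One) Zero"
    and "RCA0 \<turnstile> Eq (Add (Var 0) One) (Add (Var 1) One) \<^bold>\<longrightarrow> Eq (Var 0) (Var 1)"
    by (auto intro!: proves.Axiom simp: RCA0_def basic_axioms_def Let_def)
  \<comment> \<open>Substitution turns the two axioms on variables into the schemes over all terms
    that \<open>completeness\<close> asks for.\<close>
  from this[THEN proves_nsub, of "case_nat _ (\<lambda>_. _)"]
  have "RCA0 \<turnstile> \<^bold>\<not> Eq (Add t One) Zero" "RCA0 \<turnstile> Eq (Add t One) (Add u One) \<^bold>\<longrightarrow> Eq t u" for t u
    by simp_all
  then have "\<exists>M :: mnat interp. models M RCA0 \<and> \<not> valid_in M \<theta>" if "\<not> (RCA0 \<turnstile> \<theta>)" for \<theta>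
    using completeness[OF bij, of RCA0 \<theta>] that unfolding valid_in_def by blast
  then show ?thesis
    using assms generic_interp unfolding refutes_equivalence_def by blast
qed

instantiation mnat :: "{zero, one, plus, times, ord}"
begin
definition "0 = izero generic_interp"
definition "1 = ione generic_interp"
definition "x + y = iadd generic_interp x y"
definition "x * y = imul generic_interp x y"
definition "x < y \<longleftrightarrow> iless generic_interp x y"
definition "x \<le> y \<longleftrightarrow> x < y \<or> x = (y :: mnat)"
instance ..
end

definition coll :: "mnat set set" where
  "coll = isets generic_interp"

definition val :: "(nat \<Rightarrow> mnat) \<Rightarrow> tm \<Rightarrow> mnat" where
  "val = tval generic_interp"

definition holds :: "(nat \<Rightarrow> mnat) \<Rightarrow> (nat \<Rightarrow> mnat set) \<Rightarrow> fm \<Rightarrow> bool" where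
  "holds = sat generic_interp"

lemma val_simps [simp]:
  "val e (Var n) = e n"
  "val e Zero = 0"
  "val e One = 1"
  "val e (Add t u) = val e t + val e u"
  "val e (Mul t u) = val e t * val e u"
  by (auto simp: val_def zero_mnat_def one_mnat_def plus_mnat_def times_mnat_def)

lemma holds_simps [simp]:
  "holds e s (Eq t u) \<longleftrightarrow> val e t = val e u"
  "holds e s (Less t u) \<longleftrightarrow> val e t < val e u"
  "holds e s (Mem t X) \<longleftrightarrow> val e t \<in> s X"
  "holds e s Falsum \<longleftrightarrow> False"
  "holds e s (\<phi> \<^bold>\<longrightarrow> \<psi>) \<longleftrightarrow> (holds e s \<phi> \<longrightarrow> holds e s \<psi>)"
  "holds e s (AllN \<phi>) \<longleftrightarrow> (\<forall>x. holds (case_nat x e) s \<phi>)"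
  "holds e s (AllS \<phi>) \<longleftrightarrow> (\<forall>X \<in> coll. holds e (case_nat X s) \<phi>)"
  by (auto simp: val_def holds_def less_mnat_def coll_def)

lemma val_tsub: "val e (tsub \<sigma> t) = val (\<lambda>n. val e (\<sigma> n)) t"
  by (simp add: val_def tval_tsub)

lemma val_up [simp]: "val e (up k t) = val (\<lambda>n. e (n + k)) t"
  by (simp add: val_def)

lemma holds_nsub: "holds e s (nsub \<sigma> \<phi>) \<longleftrightarrow> holds (\<lambda>n. val e (\<sigma> n)) s \<phi>"
  by (simp add: holds_def val_def sat_nsub)

lemma holds_ssub: "holds e s (ssub \<rho> \<phi>) \<longleftrightarrow> holds e (\<lambda>n. s (\<rho> n)) \<phi>"
  by (simp add: holds_def sat_ssub)

lemma coll_nonempty: "coll \<noteq> {}"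
  using generic_interp by (simp add: models_def coll_def)

lemma holds_RCA0: "\<phi> \<in> RCA0 \<Longrightarrow> range s \<subseteq> coll \<Longrightarrow> holds e s \<phi>"
  using generic_interp unfolding models_def holds_def coll_def by blast

lemma basic_arithmetic:
  fixes m n :: mnat
  shows "n + 1 \<noteq> 0" "m + 1 = n + 1 \<Longrightarrow> m = n" "m + 0 = m" "m + (n + 1) = (m + n) + 1"
    "m * 0 = 0" "m * (n + 1) = m * n + m" "\<not> m < 0" "m < n + 1 \<longleftrightarrow> m < n \<or> m = n"
proof -
  obtain X where X: "X \<in> coll" using coll_nonempty by blast
  have "holds (case_nat m (case_nat n (\<lambda>_. 0))) (\<lambda>_. X) \<phi>" if "\<phi> \<in> basic_axioms" for \<phi>
    using holds_RCA0[of \<phi>] that X by (auto simp: RCA0_def)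
  then show "n + 1 \<noteq> 0" "m + 1 = n + 1 \<Longrightarrow> m = n" "m + 0 = m" "m + (n + 1) = (m + n) + 1"
    "m * 0 = 0" "m * (n + 1) = m * n + m" "\<not> m < 0" "m < n + 1 \<longleftrightarrow> m < n \<or> m = n"
    unfolding basic_axioms_def Let_def by force+
qed


section \<open>Definability by $\Sigma^0_0$ formulas with parameters\<close>

text \<open>Entries below \<open>k\<close> are arguments, the later ones parameters from the
  model.\<close>

definition conc :: "nat \<Rightarrow> (nat \<Rightarrow> 'a) \<Rightarrow> (nat \<Rightarrow> 'a) \<Rightarrow> nat \<Rightarrow> 'a" where
  "conc k e p n = (if n < k then e n else p (n - k))"

text \<open>Interleaves two lists of parameters, so that two formulas can be put over a common one;
  \<open>spread\<close> is the matching renaming of variables.\<close>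

definition mix :: "(nat \<Rightarrow> 'a) \<Rightarrow> (nat \<Rightarrow> 'a) \<Rightarrow> nat \<Rightarrow> 'a" where
  "mix p q n = (if even n then p (n div 2) else q (n div 2))"

text \<open>\<open>P\<close> depends on the first \<open>k\<close> entries of the environment only; number and set parameters
  from the model are allowed.\<close>

definition sig :: "nat \<Rightarrow> ((nat \<Rightarrow> mnat) \<Rightarrow> bool) \<Rightarrow> bool" where
  "sig k P \<longleftrightarrow> (\<exists>\<phi> s p. Sigma00 \<phi> \<and> range s \<subseteq> coll \<and> (\<forall>e. P e \<longleftrightarrow> holds (conc k e p) s \<phi>))"

definition trm :: "nat \<Rightarrow> ((nat \<Rightarrow> mnat) \<Rightarrow> mnat) \<Rightarrow> bool" where
  "trm k t \<longleftrightarrow> (\<exists>u p. \<forall>e. t e = val (conc k e p) u)"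

lemma case_nat_conc: "case_nat x (conc k e p) = conc (Suc k) (case_nat x e) p"
  by (rule ext) (auto simp: conc_def split: nat.split)

lemma conc_2: "conc 2 (case_nat x (case_nat y e)) p = case_nat x (case_nat y p)"
  by (rule ext) (auto simp: conc_def numeral_2_eq_2 split: nat.split)

lemma Sigma00_nsub: "Sigma00 \<phi> \<Longrightarrow> Sigma00 (nsub \<sigma> \<phi>)"
proof (induction arbitrary: \<sigma> rule: Sigma00.induct)
  case (6 \<phi> t)
  have "tsub (case_nat (Var 0) (\<lambda>n. up 1 (\<sigma> n))) (up 1 t) = up 1 (tsub \<sigma> t)"
    by (simp add: tsub_up up_tsub)
  then show ?case using Sigma00.intros(6)[OF "6.IH"] by simp
next
  case (7 \<phi> t)
  have "tsub (case_nat (Var 0) (\<lambda>n. up 1 (\<sigma> n))) (up 1 t) = up 1 (tsub \<sigma> t)"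
    by (simp add: tsub_up up_tsub)
  then show ?case using Sigma00.intros(7)[OF "7.IH"] by simp
qed (auto intro: Sigma00.intros)

lemma Sigma00_ssub: "Sigma00 \<phi> \<Longrightarrow> Sigma00 (ssub \<rho> \<phi>)"
  by (induction arbitrary: \<rho> rule: Sigma00.induct)
    (simp_all only: ssub.simps Sigma00.intros)

definition spread :: "nat \<Rightarrow> nat \<Rightarrow> nat \<Rightarrow> tm" where
  "spread k b n = Var (if n < k then n else k + (2 * (n - k) + b))"

lemma conc_spread:
  "val (conc k e (mix p q)) (spread k 0 n) = conc k e p n"
  "val (conc k e (mix p q)) (spread k (Suc 0) n) = conc k e q n"
  by (auto simp: conc_def mix_def spread_def)

lemma sigE:
  assumes "sig k P"
  obtains \<phi> s p where "Sigma00 \<phi>" "range s \<subseteq> coll" "\<And>e. P e \<longleftrightarrow> holds (conc k e p) s \<phi>"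
  using assms unfolding sig_def by blast

lemma sig_common:
  assumes "sig k P" "sig l Q"
  obtains \<phi> \<psi> s p where "Sigma00 \<phi>" "Sigma00 \<psi>" "range s \<subseteq> coll"
    "\<And>e. P e \<longleftrightarrow> holds (conc k e p) s \<phi>" "\<And>e. Q e \<longleftrightarrow> holds (conc l e p) s \<psi>"
proof -
  obtain \<phi> s p where 1: "Sigma00 \<phi>" "range s \<subseteq> coll" "\<And>e. P e \<longleftrightarrow> holds (conc k e p) s \<phi>"
    using assms(1) unfolding sig_def by blast
  obtain \<psi> r q where 2: "Sigma00 \<psi>" "range r \<subseteq> coll" "\<And>e. Q e \<longleftrightarrow> holds (conc l e q) r \<psi>"
    using assms(2) unfolding sig_def by blast
  have "(\<lambda>n. mix s r (2 * n)) = s" "(\<lambda>n. mix s r (Suc (2 * n))) = r" by (auto simp: mix_def)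
  then show ?thesis
    by (intro that[of "nsub (spread k 0) (ssub (\<lambda>n. 2 * n) \<phi>)"
        "nsub (spread l (Suc 0)) (ssub (\<lambda>n. Suc (2 * n)) \<psi>)" "mix s r" "mix p q"])
      (use 1 2 in \<open>auto simp: holds_nsub holds_ssub conc_spread mix_def
         intro!: Sigma00_nsub Sigma00_ssub\<close>)
qed

lemma trm_common:
  assumes "trm k t" "trm k u"
  obtains t' u' p where "\<And>e. t e = val (conc k e p) t'" "\<And>e. u e = val (conc k e p) u'"
proof -
  obtain t' p u' q where "\<And>e. t e = val (conc k e p) t'" "\<And>e. u e = val (conc k e q) u'"
    using assms unfolding trm_def by blast
  then show ?thesis
    by (intro that[of "mix p q" "tsub (spread k 0) t'" "tsub (spread k (Suc 0)) u'"])
      (auto simp: val_tsub conc_spread)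
qed

lemma sig_trm_common:
  assumes "trm k t" "sig l Q"
  obtains t' \<psi> s p where "Sigma00 \<psi>" "range s \<subseteq> coll"
    "\<And>e. t e = val (conc k e p) t'" "\<And>e. Q e \<longleftrightarrow> holds (conc l e p) s \<psi>"
proof -
  obtain t' p where 1: "\<And>e. t e = val (conc k e p) t'"
    using assms(1) unfolding trm_def by blast
  obtain \<psi> r q where 2: "Sigma00 \<psi>" "range r \<subseteq> coll" "\<And>e. Q e \<longleftrightarrow> holds (conc l e q) r \<psi>"
    using assms(2) unfolding sig_def by blast
  show ?thesis
    by (intro that[of "nsub (spread l (Suc 0)) \<psi>" r "mix p q" "tsub (spread k 0) t'" ])
      (use 1 2 in \<open>auto simp: holds_nsub val_tsub conc_spread intro!: Sigma00_nsub\<close>)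
qed

lemma trm_var: "n < k \<Longrightarrow> trm k (\<lambda>e. e n)"
  unfolding trm_def by (rule exI[of _ "Var n"]) (simp add: conc_def)

lemma trm_const: "trm k (\<lambda>e. c)"
  unfolding trm_def by (rule exI[of _ "Var k"], rule exI[of _ "\<lambda>_. c"]) (simp add: conc_def)

lemma trm_add:
  assumes "trm k t" "trm k u" shows "trm k (\<lambda>e. t e + u e)"
proof -
  obtain t' u' p where "\<And>e. t e = val (conc k e p) t'" "\<And>e. u e = val (conc k e p) u'"
    using trm_common[OF assms] by metis
  then show ?thesis unfolding trm_def by (intro exI[of _ "Add t' u'"] exI[of _ p]) simp
qed

lemma trm_mult:
  assumes "trm k t" "trm k u" shows "trm k (\<lambda>e. t e * u e)"
proof -
  obtain t' u' p where "\<And>e. t e = val (conc k e p) t'" "\<And>e. u e = val (conc k e p) u'"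
    using trm_common[OF assms] by metis
  then show ?thesis unfolding trm_def by (intro exI[of _ "Mul t' u'"] exI[of _ p]) simp
qed

lemma sig_False: "sig k (\<lambda>e. False)"
proof -
  obtain X where "X \<in> coll" using coll_nonempty by blast
  then show ?thesis unfolding sig_def
    by (intro exI[of _ Falsum] exI[of _ "\<lambda>_. X"]) (auto intro: Sigma00.intros)
qed

lemma sig_imp:
  assumes "sig k P" "sig k Q" shows "sig k (\<lambda>e. P e \<longrightarrow> Q e)"
proof -
  obtain \<phi> \<psi> s p where "Sigma00 \<phi>" "Sigma00 \<psi>" "range s \<subseteq> coll"
    "\<And>e. P e \<longleftrightarrow> holds (conc k e p) s \<phi>" "\<And>e. Q e \<longleftrightarrow> holds (conc k e p) s \<psi>"
    by (rule sig_common[OF assms]) (rule that, assumption+)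
  then show ?thesis unfolding sig_def
    by (intro exI[of _ "\<phi> \<^bold>\<longrightarrow> \<psi>"] exI[of _ s] exI[of _ p]) (simp add: Sigma00.intros)
qed

lemma sig_not: "sig k P \<Longrightarrow> sig k (\<lambda>e. \<not> P e)"
  using sig_imp[OF _ sig_False] by simp

lemma sig_True: "sig k (\<lambda>e. True)"
  using sig_not[OF sig_False] by simp

lemma sig_disj: "sig k P \<Longrightarrow> sig k Q \<Longrightarrow> sig k (\<lambda>e. P e \<or> Q e)"
  using sig_imp[OF sig_not, of k P Q] by (simp add: disj_imp)

lemma sig_conj: "sig k P \<Longrightarrow> sig k Q \<Longrightarrow> sig k (\<lambda>e. P e \<and> Q e)"
  using sig_not[OF sig_imp[OF _ sig_not], of k P Q] by simp

lemma sig_iff: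
  assumes "sig k P" "sig k Q" shows "sig k (\<lambda>e. P e = Q e)"
proof -
  have "(\<lambda>e. P e = Q e) = (\<lambda>e. (P e \<longrightarrow> Q e) \<and> (Q e \<longrightarrow> P e))" by blast
  then show ?thesis using sig_conj[OF sig_imp[OF assms] sig_imp[OF assms(2,1)]] by presburger
qed

lemma trm_eq:
  assumes "trm k t" "trm k u" shows "sig k (\<lambda>e. t e = u e)"
proof -
  obtain t' u' p where "\<And>e. t e = val (conc k e p) t'" "\<And>e. u e = val (conc k e p) u'"
    using trm_common[OF assms] by metis
  moreover obtain X where "X \<in> coll" using coll_nonempty by blast
  ultimately show ?thesis unfolding sig_def
    by (intro exI[of _ "Eq t' u'"] exI[of _ "\<lambda>_. X"] exI[of _ p]) (auto intro: Sigma00.intros)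
qed

lemma trm_less:
  assumes "trm k t" "trm k u" shows "sig k (\<lambda>e. t e < u e)"
proof -
  obtain t' u' p where "\<And>e. t e = val (conc k e p) t'" "\<And>e. u e = val (conc k e p) u'"
    using trm_common[OF assms] by metis
  moreover obtain X where "X \<in> coll" using coll_nonempty by blast
  ultimately show ?thesis unfolding sig_def
    by (intro exI[of _ "Less t' u'"] exI[of _ "\<lambda>_. X"] exI[of _ p]) (auto intro: Sigma00.intros)
qed

lemma trm_mem:
  assumes "trm k t" "X \<in> coll" shows "sig k (\<lambda>e. t e \<in> X)"
proof -
  obtain t' p where "\<And>e. t e = val (conc k e p) t'" using assms(1) unfolding trm_def by blast
  then show ?thesis unfolding sig_def
    by (intro exI[of _ "Mem t' 0"] exI[of _ "\<lambda>_. X"] exI[of _ p])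
      (use assms(2) in \<open>auto intro: Sigma00.intros\<close>)
qed

lemma trm_ball:
  assumes "trm k t" "sig (Suc k) (\<lambda>e. Q (e 0) (\<lambda>n. e (Suc n)))"
  shows "sig k (\<lambda>e. \<forall>x<t e. Q x e)"
proof -
  obtain t' \<psi> s p where *: "Sigma00 \<psi>" "range s \<subseteq> coll" "\<And>e. t e = val (conc k e p) t'"
    "\<And>e. Q (e 0) (\<lambda>n. e (Suc n)) \<longleftrightarrow> holds (conc (Suc k) e p) s \<psi>"
    by (rule sig_trm_common[OF assms]) (rule that, assumption+)
  have "Q x e \<longleftrightarrow> holds (case_nat x (conc k e p)) s \<psi>" for x e
    using *(4)[of "case_nat x e"] by (simp add: case_nat_conc)
  then show ?thesis
    unfolding sig_def
    using Sigma00.intros(6)[OF *(1), of t'] *(2,3)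
    by (intro exI[of _ "AllN (Less (Var 0) (up 1 t') \<^bold>\<longrightarrow> \<psi>)"] exI[of _ s] exI[of _ p]) simp
qed

text \<open>The only access to the induction axioms; every induction inside the model goes through
  it.\<close>

lemma sig_induct_Sigma01:
  assumes "sig 2 (\<lambda>e. Q (e 1) (e 0))" "\<exists>x. Q 0 x" "\<And>n x. Q n x \<Longrightarrow> \<exists>y. Q (n + 1) y"
  shows "\<exists>x. Q n x"
proof -
  obtain \<phi> s p where *: "Sigma00 \<phi>" "range s \<subseteq> coll" "\<And>e. Q (e 1) (e 0) \<longleftrightarrow> holds (conc 2 e p) s \<phi>"
    by (rule sigE[OF assms(1)]) (rule that, assumption+)
  have Q: "Q n x \<longleftrightarrow> holds (case_nat x (case_nat n p)) s \<phi>" for n x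
    using *(3)[of "case_nat x (case_nat n p)"] by (simp add: conc_2)
  have I: "holds p s (induction (ExN \<phi>))"
    by (rule holds_RCA0) (use *(1,2) in \<open>auto simp: RCA0_def Sigma01_def\<close>)
  have E: "holds (case_nat n p) s (ExN \<phi>) \<longleftrightarrow> (\<exists>x. Q n x)" for n by (simp add: Q)
  have "(\<exists>x. Q 0 x) \<and> (\<forall>n. (\<exists>x. Q n x) \<longrightarrow> (\<exists>x. Q (n + 1) x)) \<longrightarrow> (\<forall>n. \<exists>x. Q n x)"
    using I[unfolded holds_def sat_induction]
    unfolding E[unfolded holds_def] zero_mnat_def one_mnat_def plus_mnat_def .
  moreover have "(\<exists>x. Q (n + 1) x)" if "\<exists>x. Q n x" for n using that assms(3)[of n] by metis
  ultimately have "\<forall>n. \<exists>x. Q n x" using assms(2) by metis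
  then show ?thesis ..
qed

text \<open>The only access to the comprehension axioms.\<close>

lemma sig_comprehension:
  assumes "sig 2 (\<lambda>e. Q (e 1) (e 0))" "sig 2 (\<lambda>e. R (e 1) (e 0))"
    "\<And>n. (\<exists>x. Q n x) \<longleftrightarrow> (\<forall>x. R n x)"
  shows "{n. \<exists>x. Q n x} \<in> coll"
proof -
  obtain \<phi> \<psi> s p where *: "Sigma00 \<phi>" "Sigma00 \<psi>" "range s \<subseteq> coll"
    "\<And>e. Q (e 1) (e 0) \<longleftrightarrow> holds (conc 2 e p) s \<phi>" "\<And>e. R (e 1) (e 0) \<longleftrightarrow> holds (conc 2 e p) s \<psi>"
    by (rule sig_common[OF assms(1,2)]) (rule that, assumption+)
  have Q: "Q n x \<longleftrightarrow> holds (case_nat x (case_nat n p)) s \<phi>"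
    "R n x \<longleftrightarrow> holds (case_nat x (case_nat n p)) s \<psi>" for n x
    using *(4)[of "case_nat x (case_nat n p)"] *(5)[of "case_nat x (case_nat n p)"]
    by (simp_all add: conc_2)
  have C: "holds p s (comprehension (ExN \<phi>) (AllN \<psi>))"
    using *(1-3) by (intro holds_RCA0) (unfold RCA0_def Sigma01_def Pi01_def, blast+)
  have E: "holds (case_nat n p) s (ExN \<phi>) \<longleftrightarrow> (\<exists>x. Q n x)"
    "holds (case_nat n p) s (AllN \<psi>) \<longleftrightarrow> (\<forall>x. R n x)" for n by (simp_all add: Q)
  have "(\<forall>n. (\<exists>x. Q n x) \<longleftrightarrow> (\<forall>x. R n x)) \<longrightarrow> (\<exists>X\<in>coll. \<forall>n. n \<in> X \<longleftrightarrow> (\<exists>x. Q n x))"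
    using C[unfolded holds_def sat_comprehension] unfolding E[unfolded holds_def] coll_def .
  then obtain X where "X \<in> coll" "\<forall>n. n \<in> X \<longleftrightarrow> (\<exists>x. Q n x)" using assms(3) by blast
  then have "{n. \<exists>x. Q n x} = X" by blast
  then show ?thesis using \<open>X \<in> coll\<close> by simp
qed

text \<open>Permuting arguments and replacing them by terms is one substitution, which also moves
  the parameters from position \<open>k\<close> to position \<open>l\<close>.\<close>

lemma sig_reindex:
  assumes "sig k P" "\<And>i e p. i < k \<Longrightarrow> f i e = val (conc l e p) (u i)"
  shows "sig l (\<lambda>e. P (\<lambda>i. f i e))"
proof -
  obtain \<phi> s p where *: "Sigma00 \<phi>" "range s \<subseteq> coll" "\<And>e. P e \<longleftrightarrow> holds (conc k e p) s \<phi>"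
    using assms(1) unfolding sig_def by blast
  let ?\<sigma> = "\<lambda>n. if n < k then u n else Var (l + (n - k))"
  have "conc k (\<lambda>i. f i e) p = (\<lambda>n. val (conc l e p) (?\<sigma> n))" for e
  proof (rule ext)
    fix n show "conc k (\<lambda>i. f i e) p n = val (conc l e p) (?\<sigma> n)"
    proof (cases "n < k")
      case False
      have "conc l e p (l + (n - k)) = p (n - k)" unfolding conc_def by (simp del: diff_add_assoc)
      then show ?thesis using False by (simp add: conc_def[of k])
    qed (simp add: assms(2)[of n e p] conc_def[of k])
  qed
  then show ?thesis
    unfolding sig_def
    by (intro exI[of _ "nsub ?\<sigma> \<phi>"] exI[of _ s] exI[of _ p])
      (use * in \<open>auto simp: holds_nsub intro: Sigma00_nsub\<close>)
qed

lemma sig_cong_env: "sig k P \<Longrightarrow> (\<And>n. n < k \<Longrightarrow> e n = e' n) \<Longrightarrow> P e \<longleftrightarrow> P e'"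
proof -
  assume "sig k P" and e: "\<And>n. n < k \<Longrightarrow> e n = e' n"
  have "conc k e p = conc k e' p" for p by (rule ext) (simp add: conc_def e)
  then show ?thesis using \<open>sig k P\<close> unfolding sig_def by metis
qed

lemma sig_0: "sig 0 (\<lambda>e. P)"
  using sig_True sig_False by (cases P) auto


section \<open>Arithmetic of the model\<close>

text \<open>A dummy witness turns the Sigma^0_0 predicate into a Sigma^0_1 one, the form in which
  induction is given.\<close>

lemma sig_induct0:
  assumes "P 0" "\<And>n. P n \<Longrightarrow> P (n + 1)" "sig 1 (\<lambda>e. P (e 0))"
  shows "P (n :: mnat)"
proof -
  have "sig 2 (\<lambda>e. P (e 1))"
    using sig_reindex[OF assms(3), of "\<lambda>i e. e 1" 2 "\<lambda>i. Var 1"] by (simp add: conc_def)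
  then have "\<exists>x::mnat. P n"
    by (rule sig_induct_Sigma01[where Q = "\<lambda>n x. P n"]) (use assms(1,2) in auto)
  then show ?thesis by simp
qed

lemmas trm_intros = trm_const trm_add trm_mult trm_var trm_eq trm_less trm_mem
  sig_imp sig_not sig_disj sig_conj sig_iff sig_True sig_False

lemma peano_zero_add: "0 + n = (n :: mnat)"
  by (rule sig_induct0[where P = "\<lambda>n. 0 + n = n"])
    (auto intro!: trm_intros simp: basic_arithmetic(3,4))

lemma peano_succ_add: "(m + 1) + n = (m + n) + (1 :: mnat)"
  by (rule sig_induct0[where P = "\<lambda>n. (m + 1) + n = (m + n) + 1"])
    (auto intro!: trm_intros simp: basic_arithmetic(3,4))

lemma peano_add_commute: "m + n = n + (m :: mnat)"
  by (rule sig_induct0[where P = "\<lambda>n. m + n = n + m"])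
    (auto intro!: trm_intros simp: basic_arithmetic(3,4) peano_zero_add peano_succ_add)

lemma peano_add_assoc: "(l + m) + n = l + (m + (n :: mnat))"
  by (rule sig_induct0[where P = "\<lambda>n. (l + m) + n = l + (m + n)"])
    (auto intro!: trm_intros simp: basic_arithmetic(3,4))

lemma peano_add_left_commute: "l + (m + n) = m + (l + (n :: mnat))"
  using peano_add_assoc[of l m n] peano_add_assoc[of m l n] peano_add_commute[of l m] by simp

lemmas peano_add_ac = peano_add_assoc peano_add_commute peano_add_left_commute

lemma peano_zero_mult: "0 * n = (0 :: mnat)"
  by (rule sig_induct0[where P = "\<lambda>n. 0 * n = 0"])
    (auto intro!: trm_intros simp: basic_arithmetic(3-6))

lemma peano_succ_mult: "(m + 1) * n = m * n + (n :: mnat)"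
proof (rule sig_induct0[where P = "\<lambda>n. (m + 1) * n = m * n + n"])
  fix n assume "(m + 1) * n = m * n + n"
  then have "(m + 1) * (n + 1) = (m * n + n) + (m + 1)" by (simp only: basic_arithmetic(6))
  also have "\<dots> = (m * n + m) + (n + 1)"
    by (simp add: peano_add_ac)
  finally show "(m + 1) * (n + 1) = m * (n + 1) + (n + 1)" by (simp only: basic_arithmetic(6))
qed (auto intro!: trm_intros simp: basic_arithmetic(3-6))

lemma peano_mult_commute: "m * n = n * (m :: mnat)"
  by (rule sig_induct0[where P = "\<lambda>n. m * n = n * m"])
    (auto intro!: trm_intros simp: basic_arithmetic(3-6) peano_zero_mult peano_succ_mult)

lemma peano_distrib: "l * (m + n) = l * m + l * (n :: mnat)"
proof (rule sig_induct0[where P = "\<lambda>n. l * (m + n) = l * m + l * n"])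
  fix n assume "l * (m + n) = l * m + l * n"
  then show "l * (m + (n + 1)) = l * m + l * (n + 1)"
    using basic_arithmetic(4)[of m n] basic_arithmetic(6)[of l "m + n"]
      basic_arithmetic(6)[of l n] peano_add_assoc[of "l * m" "l * n" l] by simp
qed (auto intro!: trm_intros simp: basic_arithmetic(3-6))

lemma peano_mult_assoc: "(l * m) * n = l * (m * (n :: mnat))"
  by (rule sig_induct0[where P = "\<lambda>n. (l * m) * n = l * (m * n)"])
    (auto intro!: trm_intros simp: basic_arithmetic(3-6) peano_distrib[of l "m * _" m])

lemma peano_add_cancel: "l + m = l + n \<Longrightarrow> m = (n :: mnat)"
proof -
  have "l + m = l + n \<longrightarrow> m = n"
    by (rule sig_induct0[where P = "\<lambda>l. l + m = l + n \<longrightarrow> m = n"])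
      (auto intro!: trm_intros dest: basic_arithmetic(2) simp: peano_zero_add peano_succ_add)
  then show "l + m = l + n \<Longrightarrow> m = n" by simp
qed

lemma peano_cases: "n = 0 \<or> (\<exists>m :: mnat. n = m + 1)"
proof -
  have "\<exists>m. n = 0 \<or> n = m + 1"
    by (rule sig_induct_Sigma01[where Q = "\<lambda>n m. n = 0 \<or> n = m + 1"]) (auto intro!: trm_intros)
  then show ?thesis by blast
qed

lemma peano_less_add: "m < m + (n + (1 :: mnat))"
  by (rule sig_induct0[where P = "\<lambda>n. m < m + (n + 1)"])
    (auto intro!: trm_intros simp: basic_arithmetic(4,8) peano_zero_add)

lemma peano_less_iff: "m < n \<longleftrightarrow> (\<exists>d. n = m + (d + (1 :: mnat)))"
proof
  \<comment> \<open>The difference is an existential witness, which brings the claim under Sigma^0_1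
    induction.\<close>
  have "\<exists>d. m < n \<longrightarrow> n = m + (d + 1)"
  proof (rule sig_induct_Sigma01[where Q = "\<lambda>n d. m < n \<longrightarrow> n = m + (d + 1)"])
    fix n d assume IH: "m < n \<longrightarrow> n = m + (d + 1)"
    show "\<exists>d. m < n + 1 \<longrightarrow> n + 1 = m + (d + 1)"
    proof (cases "m < n")
      case True
      then have "n + 1 = m + ((d + 1) + 1)" using IH by (simp add: peano_add_assoc)
      then show ?thesis by blast
    next
      case False
      then show ?thesis
        by (intro exI[of _ 0]) (auto simp: basic_arithmetic(8) peano_zero_add)
    qed
  qed (auto intro!: trm_intros simp: basic_arithmetic(7))
  then show "m < n \<Longrightarrow> \<exists>d. n = m + (d + 1)" by blast
qed (auto simp: peano_less_add)

lemma peano_linear: "m < n \<or> m = n \<or> n < (m :: mnat)"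
proof (rule sig_induct0[where P = "\<lambda>n. m < n \<or> m = n \<or> n < m"])
  show "m < 0 \<or> m = 0 \<or> 0 < m"
    using peano_cases[of m] peano_less_add[of 0] by (auto simp: peano_zero_add)
  fix n assume IH: "m < n \<or> m = n \<or> n < m"
  show "m < n + 1 \<or> m = n + 1 \<or> n + 1 < m"
  proof (cases "n < m")
    case True
    then obtain d where d: "m = n + (d + 1)" using peano_less_iff by blast
    show ?thesis
    proof (cases "d = 0")
      case True
      then show ?thesis using d by (simp add: peano_zero_add)
    next
      case False
      then obtain d' where "d = d' + 1" using peano_cases by blast
      then have "m = (n + 1) + (d' + 1)" using d by (simp add: peano_add_ac)
      then show ?thesis using peano_less_add by blast
    qed
  next
    case False
    then show ?thesis using IH basic_arithmetic(8) by blast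
  qed
qed (auto intro!: trm_intros)

lemma peano_less_irrefl: "\<not> m < (m :: mnat)"
proof
  assume "m < m"
  then obtain d where "m = m + (d + 1)" unfolding peano_less_iff by blast
  then have "m + 0 = m + (d + 1)" by (simp add: basic_arithmetic(3))
  then show False using peano_add_cancel basic_arithmetic(1)[of d] by fastforce
qed

lemma peano_less_trans: "l < m \<Longrightarrow> m < n \<Longrightarrow> l < (n :: mnat)"
proof -
  assume "l < m" "m < n"
  then obtain d d' where "m = l + (d + 1)" "n = m + (d' + 1)" unfolding peano_less_iff by blast
  then have "n = l + ((d + 1 + d') + 1)" by (simp add: peano_add_assoc)
  then show ?thesis unfolding peano_less_iff by blast
qed

lemma peano_le_iff: "m \<le> n \<longleftrightarrow> (\<exists>d. n = m + (d :: mnat))"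
proof
  assume "m \<le> n"
  then show "\<exists>d. n = m + d"
    unfolding less_eq_mnat_def peano_less_iff using basic_arithmetic(3)[of m, symmetric] by auto
next
  assume "\<exists>d. n = m + d"
  then obtain d where "n = m + d" ..
  then show "m \<le> n"
    using peano_cases[of d] peano_less_add[of m] by (auto simp: less_eq_mnat_def basic_arithmetic(3))
qed

text \<open>Truncated as on \<open>nat\<close>: the class \<open>comm_semiring_1_cancel\<close>
  wants \<open>a - b - c = a - (b + c)\<close> throughout.\<close>

instantiation mnat :: minus
begin
definition "m - n = (if n \<le> m then (THE d. m = n + d) else (0 :: mnat))"
instance ..
end

lemma peano_diff_add: "(n + d) - n = (d :: mnat)"
proof -
  have "(THE d'. n + d = n + d') = d" by (rule the_equality) (auto dest: peano_add_cancel)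
  then show ?thesis unfolding minus_mnat_def using peano_le_iff by auto
qed

instance mnat :: linorder
proof
  fix x y z :: mnat
  show "x < y \<longleftrightarrow> x \<le> y \<and> \<not> y \<le> x"
    unfolding less_eq_mnat_def by (metis peano_less_irrefl peano_less_trans)
  show "x \<le> x" by (simp add: less_eq_mnat_def)
  show "x \<le> y \<Longrightarrow> y \<le> z \<Longrightarrow> x \<le> z" unfolding less_eq_mnat_def by (metis peano_less_trans)
  show "x \<le> y \<Longrightarrow> y \<le> x \<Longrightarrow> x = y"
    unfolding less_eq_mnat_def by (metis peano_less_irrefl peano_less_trans)
  show "x \<le> y \<or> y \<le> x" unfolding less_eq_mnat_def using peano_linear by blast
qed

instance mnat :: comm_semiring_1
proof
  fix a b c :: mnat
  show "a + b + c = a + (b + c)" by (rule peano_add_assoc)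
  show "a + b = b + a" by (rule peano_add_commute)
  show "0 + a = a" by (rule peano_zero_add)
  show "a * b * c = a * (b * c)" by (rule peano_mult_assoc)
  show "a * b = b * a" by (rule peano_mult_commute)
  show "1 * a = a"
    using peano_succ_mult[of 0 a] by (simp add: peano_zero_mult peano_zero_add)
  show "(a + b) * c = a * c + b * c"
    using peano_distrib[of c a b] by (simp add: peano_mult_commute)
  show "0 * a = 0" by (rule peano_zero_mult)
  show "a * 0 = 0" by (rule basic_arithmetic(5))
  show "0 \<noteq> (1 :: mnat)" using basic_arithmetic(1)[of 0] by (simp add: peano_zero_add)
qed

lemma mnat_diff_cases:
  fixes a b :: mnat
  obtains d where "a = b + d" "a - b = d" | d where "b = a + d" "a - b = 0"
proof (cases "b \<le> a")
  case True
  then obtain d where "a = b + d" using peano_le_iff by blast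
  then show ?thesis using that(1) peano_diff_add by blast
next
  case False
  then have "a \<le> b" by simp
  then show ?thesis using that(2) False peano_le_iff by (metis minus_mnat_def)
qed

lemma mnat_diff_zero: "(a :: mnat) - (a + d) = 0"
proof (cases a "a + d" rule: mnat_diff_cases)
  case (1 d')
  then have "a + 0 = a + (d + d')" by (simp add: add.assoc)
  then have "0 = d + d'" by (rule peano_add_cancel)
  then have "d' = 0" using peano_cases[of d'] basic_arithmetic(1)[of "d + _"] by (auto simp: add.assoc)
  then show ?thesis using 1 by simp
qed

instance mnat :: comm_semiring_1_cancel
proof
  fix a b c :: mnat
  show "a + b - a = b" by (rule peano_diff_add)
  show "a - b - c = a - (b + c)"
  proof (cases a b rule: mnat_diff_cases)
    case (1 d)
    show ?thesis
    proof (cases d c rule: mnat_diff_cases)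
      case (1 d')
      then show ?thesis using \<open>a = b + d\<close> \<open>a - b = d\<close> peano_diff_add[of "b + c" d']
        by (simp add: add.assoc)
    next
      case (2 d')
      then show ?thesis using \<open>a = b + d\<close> \<open>a - b = d\<close> mnat_diff_zero[of "b + d" d']
        by (simp add: add.assoc)
    qed
  next
    case (2 d)
    then show ?thesis using mnat_diff_zero[of a "d + c"] mnat_diff_zero[of 0 c]
      by (simp add: add.assoc)
  qed
  show "a * (b - c) = a * b - a * c"
  proof (cases b c rule: mnat_diff_cases)
    case (1 d)
    then show ?thesis using peano_diff_add[of "a * c" "a * d"] by (simp add: peano_distrib)
  next
    case (2 d)
    then show ?thesis using mnat_diff_zero[of "a * b" "a * d"] by (simp add: peano_distrib)
  qed
qed

lemma mnat_mult_succ_pos: "0 < (m + 1) * (n + (1 :: mnat))"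
  using peano_less_add[of 0 "(m + 1) * n + m"] by (simp add: distrib_left add.assoc)

instance mnat :: linordered_semidom
proof
  fix a b c :: mnat
  show "a \<le> b \<Longrightarrow> c + a \<le> c + b" unfolding peano_le_iff by (auto simp: add.assoc)
  show "c * a < c * b" if "a < b" "0 < c"
  proof -
    obtain d where d: "b = a + (d + 1)" using \<open>a < b\<close> peano_less_iff by blast
    obtain c' where "c = c' + 1" using \<open>0 < c\<close> peano_less_iff by (metis add_0)
    then have "c * b = c * a + (c' + 1) * (d + 1)" using d by (simp add: distrib_left)
    moreover obtain d' where "(c' + 1) * (d + 1) = d' + 1"
      using mnat_mult_succ_pos peano_less_iff by (metis add_0)
    ultimately show ?thesis using peano_less_add by metis
  qed
  show "0 < (1 :: mnat)" using peano_less_add[of 0 0] by simp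
  show "a \<noteq> 0 \<Longrightarrow> b \<noteq> 0 \<Longrightarrow> a * b \<noteq> 0"
    using peano_cases[of a] peano_cases[of b] mnat_mult_succ_pos peano_less_irrefl by metis
  show "b \<le> a \<Longrightarrow> a - b + b = a"
    unfolding peano_le_iff by (auto simp: peano_diff_add add.commute)
qed

instance mnat :: canonically_ordered_monoid_add
  by standard (rule peano_le_iff)

lemma mnat_less_iff: "m < n \<longleftrightarrow> m + 1 \<le> (n :: mnat)"
  unfolding peano_less_iff peano_le_iff by (metis add.assoc add.commute)

lemma mnat_less_succ: "m < n + 1 \<longleftrightarrow> m \<le> (n :: mnat)"
  by (simp add: basic_arithmetic(8) less_eq_mnat_def)

lemma mnat_cases: obtains "n = 0" | m where "n = m + (1 :: mnat)"
  using peano_cases by blast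

lemma mnat_zero_less: "0 < n \<longleftrightarrow> n \<noteq> (0 :: mnat)"
  by (simp add: zero_less_iff_neq_zero)

text \<open>The ordered ring of integers of the model makes linear arithmetic available.\<close>

definition mintrel :: "mnat \<times> mnat \<Rightarrow> mnat \<times> mnat \<Rightarrow> bool" where
  "mintrel = (\<lambda>(x, y) (u, v). x + v = u + y)"

lemma mintrel_iff [simp]: "mintrel (x, y) (u, v) \<longleftrightarrow> x + v = u + y"
  by (simp add: mintrel_def)

lemma mintrel_trans: "x + v = u + y \<Longrightarrow> u + w = z + v \<Longrightarrow> x + w = z + (y :: mnat)"
proof -
  assume "x + v = u + y" "u + w = z + v"
  then have "(x + w) + v = (z + y) + v" by (metis add.assoc add.commute)
  then show ?thesis by simp
qed

quotient_type mint = "mnat \<times> mnat" / mintrel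
  morphisms Rep_mint Abs_mint
proof (rule equivpI)
  show "reflp mintrel" by (auto simp: reflp_def)
  show "symp mintrel" by (auto simp: symp_def)
  show "transp mintrel" by (auto simp: transp_def intro: mintrel_trans)
qed

instantiation mint :: comm_ring_1
begin

lift_definition zero_mint :: mint is "(0, 0)" .

lift_definition one_mint :: mint is "(1, 0)" .

lift_definition plus_mint :: "mint \<Rightarrow> mint \<Rightarrow> mint" is "\<lambda>(x, y) (u, v). (x + u, y + v)"
  by (clarsimp simp: algebra_simps) (metis add.assoc add.commute)

lift_definition uminus_mint :: "mint \<Rightarrow> mint" is "\<lambda>(x, y). (y, x)"
  by (clarsimp simp: algebra_simps)

lift_definition minus_mint :: "mint \<Rightarrow> mint \<Rightarrow> mint" is "\<lambda>(x, y) (u, v). (x + v, y + u)"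
  by (clarsimp simp: algebra_simps) (metis add.assoc add.commute)

lift_definition times_mint :: "mint \<Rightarrow> mint \<Rightarrow> mint"
  is "\<lambda>(x, y) (u, v). (x * u + y * v, x * v + y * u)"
proof clarsimp
  fix s t u v w x y z :: mnat
  assume 1: "s + v = u + t" and 2: "w + z = y + x"
  \<comment> \<open>Without negatives in \<open>mnat\<close>, both sides are padded by
    \<open>v * w + u * x\<close> so that the two hypotheses apply; the padding cancels at the
    end.\<close>
  have "(s * w + t * x + (u * z + v * y)) + (v * w + u * x) = (s + v) * w + (t + u) * x + u * z + v * y"
    by (simp add: algebra_simps)
  also have "\<dots> = (u + t) * w + (s + v) * x + u * z + v * y" using 1 by (simp add: algebra_simps)
  also have "\<dots> = u * (w + z) + t * w + s * x + v * (x + y)" by (simp add: algebra_simps)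
  also have "\<dots> = u * (y + x) + t * w + s * x + v * (w + z)" using 2 by (simp add: algebra_simps)
  also have "\<dots> = (u * y + v * z + (s * x + t * w)) + (v * w + u * x)" by (simp add: algebra_simps)
  finally show "s * w + t * x + (u * z + v * y) = u * y + v * z + (s * x + t * w)" by simp
qed

instance
  by standard (transfer; clarsimp simp: algebra_simps)+

end

instantiation mint :: linorder
begin

lift_definition less_eq_mint :: "mint \<Rightarrow> mint \<Rightarrow> bool" is "\<lambda>(x, y) (u, v). x + v \<le> u + y"
proof -
  have "u1 + v2 \<le> u2 + v1" if "x1 + v1 = u1 + y1" "x2 + v2 = u2 + y2" "x1 + y2 \<le> x2 + y1"
    for x1 y1 u1 v1 x2 y2 u2 v2 :: mnat
  proof -
    have "(u1 + v2) + (y1 + y2) = (x1 + y2) + (v1 + v2)" using that(1)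
      by (metis add.assoc add.commute)
    also have "\<dots> \<le> (x2 + y1) + (v1 + v2)" using that(3) by simp
    also have "\<dots> = (u2 + v1) + (y1 + y2)" using that(2) by (metis add.assoc add.commute)
    finally show ?thesis by simp
  qed
  then show "\<And>p1 p2 p3 p4. mintrel p1 p2 \<Longrightarrow> mintrel p3 p4 \<Longrightarrow>
      (case p1 of (x, y) \<Rightarrow> \<lambda>(u, v). x + v \<le> u + y) p3 = (case p2 of (x, y) \<Rightarrow> \<lambda>(u, v). x + v \<le> u + y) p4"
    by (clarsimp, metis)
qed

definition less_mint :: "mint \<Rightarrow> mint \<Rightarrow> bool" where
  "less_mint x y \<longleftrightarrow> x \<le> y \<and> \<not> y \<le> x"

instance
proof
  fix x y z :: mint
  show "x < y \<longleftrightarrow> x \<le> y \<and> \<not> y \<le> x" by (rule less_mint_def)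
  show "x \<le> x" by transfer auto
  show "x \<le> y \<Longrightarrow> y \<le> x \<Longrightarrow> x = y" by transfer auto
  show "x \<le> y \<or> y \<le> x" by transfer auto
  have "x1 + w \<le> z1 + y1" if "x1 + v \<le> u + y1" "u + w \<le> z1 + v" for x1 y1 u v z1 w :: mnat
  proof -
    have "(x1 + w) + (u + v) \<le> (z1 + y1) + (u + v)"
      using add_mono[OF that] by (simp add: ac_simps)
    then show ?thesis by simp
  qed
  then show "x \<le> y \<Longrightarrow> y \<le> z \<Longrightarrow> x \<le> z" by transfer auto
qed

end

lift_definition toz :: "mnat \<Rightarrow> mint" is "\<lambda>x. (x, 0)" .

lemma toz_simps [simp]:
  "toz 0 = 0" "toz 1 = 1" "toz (x + y) = toz x + toz y" "toz (x * y) = toz x * toz y"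
  by (transfer; simp)+

lemma toz_le [simp]: "toz x \<le> toz y \<longleftrightarrow> x \<le> y" by transfer simp

lemma toz_eq [simp]: "toz x = toz y \<longleftrightarrow> x = y" by transfer simp

lemma toz_less [simp]: "toz x < toz y \<longleftrightarrow> x < y" unfolding less_le by simp

lemma toz_nonneg: "0 \<le> toz x" using toz_le[of 0 x] by simp

lemma toz_diff: "\<exists>a b. z = toz a - toz b"
  by transfer auto

instantiation mint :: linordered_idom
begin

definition "\<bar>z :: mint\<bar> = (if z < 0 then - z else z)"
definition "sgn (z :: mint) = (if z = 0 then 0 else if 0 < z then 1 else - 1)"

instance
proof
  fix x y z :: mint
  show add: "x \<le> y \<Longrightarrow> z + x \<le> z + y" for x y z :: mint
    by transfer (auto simp: algebra_simps)
  show "x < y \<Longrightarrow> 0 < z \<Longrightarrow> z * x < z * y"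
  proof -
    assume xy: "x < y" and z: "0 < z"
    obtain a b c d e f where eq: "x = toz a - toz b" "y = toz c - toz d" "z = toz e - toz f"
      using toz_diff by metis
    have shift: "u < v \<Longrightarrow> w + u < w + v" for u v w :: mint
      using add[of u v w] add[of "w + v" "w + u" "- w"] by (auto simp: less_mint_def)
    have "toz f < toz e" using shift[OF z, of "toz f"] eq(3) by simp
    then obtain k where k: "e = f + k" "0 < k"
      by (metis toz_less le_iff_add less_imp_le add_0_right neq_iff not_less_zero)
    have "toz a + toz d < toz c + toz b"
      using shift[OF xy, of "toz b + toz d"] eq(1,2) by (simp add: algebra_simps)
    then have "a + d < c + b" using toz_less[of "a + d" "c + b"] by simp
    then have "k * (a + d) < k * (c + b)" using k(2) by (simp add: mult_strict_left_mono)
    then have "toz k * (toz a + toz d) < toz k * (toz c + toz b)"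
      using toz_less[of "k * (a + d)" "k * (c + b)"] by simp
    from shift[OF this, of "- (toz k * (toz b + toz d))"]
    show ?thesis unfolding eq k(1) by (simp add: algebra_simps)
  qed
  show "\<bar>x\<bar> = (if x < 0 then - x else x)" by (rule abs_mint_def)
  show "sgn x = (if x = 0 then 0 else if 0 < x then 1 else - 1)" by (rule sgn_mint_def)
qed

end

text \<open>Passes on the discreteness of the order, of which an ordered ring alone knows
  nothing.\<close>

lemma mnat_less_toz: "x < y \<longleftrightarrow> toz x + 1 \<le> toz y"
  using toz_le[of "x + 1" y] by (simp add: mnat_less_iff)

lemmas to_mint = mnat_less_toz toz_le[symmetric] toz_eq[symmetric]


section \<open>Closure under $\Delta^0_1$ definability\<close>

definition mpair :: "mnat \<Rightarrow> mnat \<Rightarrow> mnat" where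
  "mpair a b = (a + b) * (a + b) + a"

lemma mnat_le_square: "x \<le> x * (x :: mnat)"
proof (cases x rule: mnat_cases)
  case (2 m)
  then show ?thesis by (simp add: distrib_left)
qed simp

lemma le_mpair: "a \<le> mpair a b" "b \<le> mpair a b"
proof -
  show "a \<le> mpair a b" by (simp add: mpair_def)
  have "b \<le> a + b" by simp
  also have "\<dots> \<le> mpair a b"
    unfolding mpair_def using mnat_le_square[of "a + b"] by (rule order_trans) simp
  finally show "b \<le> mpair a b" .
qed

text \<open>For s = a + b the code lies between s^2 and (s + 1)^2. Codes are thus ordered by the sum
  first, which is how recursions on codes find earlier pairs below later ones.\<close>

lemma mpair_less: "a + b < c + d \<Longrightarrow> mpair a b < mpair c d"
proof -
  assume "a + b < c + d"
  then have le: "a + b + 1 \<le> c + d" by (simp add: mnat_less_iff)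
  have "mpair a b < (a + b + 1) * (a + b + 1)"
    using toz_nonneg[of a] toz_nonneg[of b] by (simp add: mpair_def to_mint algebra_simps)
  also have "\<dots> \<le> (c + d) * (c + d)" using le by (rule mult_mono') (use le in auto)
  also have "\<dots> \<le> mpair c d" by (simp add: mpair_def)
  finally show ?thesis .
qed

lemma mpair_eq [simp]: "mpair a b = mpair c d \<longleftrightarrow> a = c \<and> b = d"
proof
  assume eq: "mpair a b = mpair c d"
  then have "a + b = c + d" using mpair_less[of a b c d] mpair_less[of c d a b]
    by (metis less_irrefl neq_iff)
  moreover from this have "a = c" using eq unfolding mpair_def by simp
  ultimately show "a = c \<and> b = d" by simp
qed simp

lemma sig_weaken:
  assumes "sig (Suc k) (\<lambda>e. Q (e 0) (\<lambda>n. e (Suc n)))"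
  shows "sig (Suc (Suc k)) (\<lambda>e. Q (e 0) (\<lambda>n. e (Suc (Suc n))))"
  using sig_reindex[OF assms, of "\<lambda>i e. case i of 0 \<Rightarrow> e 0 | Suc n \<Rightarrow> e (Suc (Suc n))" "Suc (Suc k)"
      "\<lambda>i. case i of 0 \<Rightarrow> Var 0 | Suc n \<Rightarrow> Var (Suc (Suc n))"]
  by (simp add: conc_def split: nat.split)

lemma trm_bex:
  assumes "trm k t" "sig (Suc k) (\<lambda>e. Q (e 0) (\<lambda>n. e (Suc n)))"
  shows "sig k (\<lambda>e. \<exists>x<t e. Q x e)"
proof -
  have "sig k (\<lambda>e. \<forall>x<t e. \<not> Q x e)" using assms(1) sig_not[OF assms(2)] by (rule trm_ball)
  from sig_not[OF this] show ?thesis by simp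
qed

text \<open>Trades two arguments for one code. Position 0 is kept for the witness of a Delta^0_1
  definition, so the code sits at position 1.\<close>

lemma sig_unpair:
  assumes "sig (Suc (Suc (Suc k))) (\<lambda>e. Q (e 0) (\<lambda>n. e (Suc n)))"
  shows "sig (Suc (Suc k)) (\<lambda>e. \<exists>a<e 1 + 1. \<exists>b<e 1 + 1.
    e 1 = mpair a b \<and> Q (e 0) (case_nat a (case_nat b (\<lambda>n. e (Suc (Suc n))))))"
proof -
  have eq: "(\<lambda>n. case Suc n of 0 \<Rightarrow> e (Suc (Suc 0)) | Suc 0 \<Rightarrow> e (Suc 0) | Suc (Suc 0) \<Rightarrow> e 0
      | Suc (Suc (Suc m)) \<Rightarrow> e (Suc (Suc (Suc (Suc m))))) =
    case_nat (e (Suc 0)) (case_nat (e 0) (\<lambda>n. e (Suc (Suc (Suc (Suc n))))))" for e :: "nat \<Rightarrow> mnat"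
    by (rule ext) (simp split: nat.split)
  have "sig (Suc (Suc (Suc (Suc k)))) (\<lambda>e. Q (e (Suc (Suc 0)))
      (case_nat (e (Suc 0)) (case_nat (e 0) (\<lambda>n. e (Suc (Suc (Suc (Suc n))))))))"
    using sig_reindex[OF assms, of "\<lambda>i e. case i of 0 \<Rightarrow> e (Suc (Suc 0)) | Suc 0 \<Rightarrow> e (Suc 0)
        | Suc (Suc 0) \<Rightarrow> e 0 | Suc (Suc (Suc m)) \<Rightarrow> e (Suc (Suc (Suc (Suc m))))"
        "Suc (Suc (Suc (Suc k)))" "\<lambda>i. case i of 0 \<Rightarrow> Var (Suc (Suc 0)) | Suc 0 \<Rightarrow> Var (Suc 0)
        | Suc (Suc 0) \<Rightarrow> Var 0 | Suc (Suc (Suc m)) \<Rightarrow> Var (Suc (Suc (Suc (Suc m))))"]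
    unfolding eq by (simp add: conc_def split: nat.split)
  then show ?thesis
    unfolding mpair_def
    by (intro trm_bex sig_conj trm_eq trm_add trm_mult trm_var trm_const) simp_all
qed

lemma sig_pair:
  assumes "sig (Suc k) P"
  shows "sig (Suc (Suc k)) (\<lambda>e. P (case_nat (mpair (e 0) (e 1)) (\<lambda>n. e (Suc (Suc n)))))"
proof -
  have "sig (Suc (Suc k)) (\<lambda>e. P (\<lambda>i. case i of 0 \<Rightarrow> mpair (e 0) (e 1) | Suc n \<Rightarrow> e (Suc (Suc n))))"
    by (rule sig_reindex[OF assms, of "\<lambda>i e. case i of 0 \<Rightarrow> mpair (e 0) (e 1) | Suc n \<Rightarrow> e (Suc (Suc n))" _
        "\<lambda>i. case i of 0 \<Rightarrow> pair (Var 0) (Var 1) | Suc n \<Rightarrow> Var (Suc (Suc n))"])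
      (simp add: conc_def pair_def mpair_def split: nat.split)
  then show ?thesis .
qed

lemma bounded_unpair:
  "(\<exists>a<mpair x y + 1. \<exists>b<mpair x y + 1. mpair x y = mpair a b \<and> P a b) \<longleftrightarrow> P x y"
  using le_mpair(1)[of x y] le_mpair(2)[of y x] by (auto simp: mnat_less_succ)

lemma case_nat_env: "case_nat (e 0) (case_nat (e (Suc 0)) (\<lambda>n. e (Suc (Suc n)))) = e"
  by (rule ext) (simp split: nat.split)

text \<open>Comprehension makes a set out of the predicate, and membership in a set is Sigma^0_0
  again. As sets are unary, the induction on \<open>k\<close> packs the first two arguments into a
  pair until one argument is left.\<close>

lemma sig_Delta:
  assumes "sig (Suc k) (\<lambda>e. Q (e 0) (\<lambda>n. e (Suc n)))" "sig (Suc k) (\<lambda>e. R (e 0) (\<lambda>n. e (Suc n)))"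
    "\<And>e. P e \<longleftrightarrow> (\<exists>x. Q x e)" "\<And>e. \<not> P e \<longleftrightarrow> (\<exists>x. R x e)"
  shows "sig k P"
  using assms
proof (induction k arbitrary: P Q R)
  case 0
  have "Q x e \<longleftrightarrow> Q x e'" for x e e'
    using sig_cong_env[OF 0(1), of "case_nat x e" "case_nat x e'"] by simp
  then have "P = (\<lambda>e. P undefined)" unfolding 0(3) by (intro ext) blast
  then show ?case using sig_0[of "P undefined"] by simp
next
  case (Suc k)
  note prems = Suc.prems
  show ?case
  proof (cases k)
    case 0
    have ext: "S x e \<longleftrightarrow> S x (\<lambda>_. e 0)" if S: "sig (Suc (Suc k)) (\<lambda>e. S (e 0) (\<lambda>n. e (Suc n)))"
      for S :: "mnat \<Rightarrow> (nat \<Rightarrow> mnat) \<Rightarrow> bool" and x e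
    proof -
      have "case_nat x e n = case_nat x (\<lambda>_. e 0) n" if "n < Suc (Suc k)" for n
        using that 0 by (auto simp: less_Suc_eq)
      then show ?thesis
        using sig_cong_env[OF S, of "case_nat x e" "case_nat x (\<lambda>_. e 0)"] by simp
    qed
    have two: "sig 2 (\<lambda>e. S (e 0) (\<lambda>_. e 1))" if "sig (Suc (Suc k)) (\<lambda>e. S (e 0) (\<lambda>n. e (Suc n)))"
      for S :: "mnat \<Rightarrow> (nat \<Rightarrow> mnat) \<Rightarrow> bool"
      using that ext[OF that] 0 by (subst (asm) ext[OF that]) (simp add: numeral_2_eq_2)
    have "{n. \<exists>x. Q x (\<lambda>_. n)} \<in> coll"
    proof (rule sig_comprehension[of "\<lambda>n x. Q x (\<lambda>_. n)" "\<lambda>n x. \<not> R x (\<lambda>_. n)"])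
      show "sig 2 (\<lambda>e. Q (e 0) (\<lambda>_. e 1))" "sig 2 (\<lambda>e. \<not> R (e 0) (\<lambda>_. e 1))"
        by (intro sig_not two[OF prems(1)] two[OF prems(2)])+
      show "(\<exists>x. Q x (\<lambda>_. n)) \<longleftrightarrow> (\<forall>x. \<not> R x (\<lambda>_. n))" for n
        using prems(3,4)[of "\<lambda>_. n"] by blast
    qed
    then have "sig 1 (\<lambda>e. e 0 \<in> {n. \<exists>x. Q x (\<lambda>_. n)})" by (intro trm_mem trm_var) simp_all
    moreover have "P e \<longleftrightarrow> e 0 \<in> {n. \<exists>x. Q x (\<lambda>_. n)}" for e
      using prems(3)[of e] ext[OF prems(1), of _ e] by simp
    ultimately show ?thesis using 0 by simp
  next
    case (Suc l)
    let ?code = "\<lambda>S e. \<exists>a<e 0 + 1. \<exists>b<e 0 + 1. e 0 = mpair a b \<and> S (case_nat a (case_nat b (\<lambda>n. e (Suc n))))"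
    note Q = sig_unpair[OF prems(1)[unfolded Suc]] and R = sig_unpair[OF prems(2)[unfolded Suc]]
    have T: "sig (Suc (Suc l)) (\<lambda>e. \<not> (\<exists>a<e 1 + 1. \<exists>b<e 1 + 1. e 1 = mpair a b))"
      unfolding mpair_def
      by (intro trm_bex sig_not sig_conj trm_eq trm_add trm_mult trm_var trm_const) simp_all
    have "sig k (?code P)"
    \<comment> \<open>Numbers that code no pair fall outside \<open>?code P\<close>, so the formula
      for the negation has to accept them.\<close>
    proof (rule Suc.IH[of "\<lambda>x. ?code (Q x)" "\<lambda>x e. ?code (R x) e \<or>
          \<not> (\<exists>a<e 0 + 1. \<exists>b<e 0 + 1. e 0 = mpair a b)"])
      show "sig (Suc k) (\<lambda>e. ?code (Q (e 0)) (\<lambda>n. e (Suc n)))" using Q Suc by simp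
      show "sig (Suc k) (\<lambda>e. ?code (R (e 0)) (\<lambda>n. e (Suc n)) \<or>
          \<not> (\<exists>a<e (Suc 0) + 1. \<exists>b<e (Suc 0) + 1. e (Suc 0) = mpair a b))"
        using sig_disj[OF R T] Suc by simp
      show "?code P e \<longleftrightarrow> (\<exists>x. ?code (Q x) e)" for e unfolding prems(3) by blast
      show "\<not> ?code P e \<longleftrightarrow> (\<exists>x. ?code (R x) e \<or>
          \<not> (\<exists>a<e 0 + 1. \<exists>b<e 0 + 1. e 0 = mpair a b))" for e
      proof (cases "\<exists>a b. e 0 = mpair a b")
        case True
        then obtain a b where ab: "e 0 = mpair a b" by blast
        have "?code S e \<longleftrightarrow> S (case_nat a (case_nat b (\<lambda>n. e (Suc n))))" for S
          unfolding ab by (rule bounded_unpair)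
        moreover have "\<exists>a<e 0 + 1. \<exists>b<e 0 + 1. e 0 = mpair a b"
          unfolding ab using bounded_unpair[of a b "\<lambda>_ _. True"] by simp
        ultimately show ?thesis using prems(4) by simp
      next
        case False
        then show ?thesis by blast
      qed
    qed
    from sig_pair[OF this[unfolded Suc]] show ?thesis
      using Suc by (simp add: bounded_unpair[where P = "\<lambda>a b. P (case_nat a (case_nat b _))"] case_nat_env
          mnat_less_succ le_mpair)
  qed
qed


section \<open>Definable functions and syntax-directed rules for definability\<close>

definition dfun :: "nat \<Rightarrow> ((nat \<Rightarrow> mnat) \<Rightarrow> mnat) \<Rightarrow> bool" where
  "dfun k t \<longleftrightarrow> sig (Suc k) (\<lambda>e. e 0 = t (\<lambda>n. e (Suc n)))"

definition rel1 :: "(mnat \<Rightarrow> bool) \<Rightarrow> bool" where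
  "rel1 P \<longleftrightarrow> sig 1 (\<lambda>e. P (e 0))"

definition rel2 :: "(mnat \<Rightarrow> mnat \<Rightarrow> bool) \<Rightarrow> bool" where
  "rel2 P \<longleftrightarrow> sig 2 (\<lambda>e. P (e 0) (e 1))"

definition rel3 :: "(mnat \<Rightarrow> mnat \<Rightarrow> mnat \<Rightarrow> bool) \<Rightarrow> bool" where
  "rel3 P \<longleftrightarrow> sig 3 (\<lambda>e. P (e 0) (e 1) (e 2))"

text \<open>Both \<open>P (t e) e\<close> and its negation say that some \<open>x\<close> equal to
  \<open>t e\<close> has a definable property, so they are Delta^0_1. Hence a function known only by
  its definable graph may be used like a term.\<close>

lemma sig_subst:
  assumes "dfun k t" "sig (Suc k) (\<lambda>e. P (e 0) (\<lambda>n. e (Suc n)))"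
  shows "sig k (\<lambda>e. P (t e) e)"
  by (rule sig_Delta[of k "\<lambda>x e. x = t e \<and> P x e" "\<lambda>x e. x = t e \<and> \<not> P x e"])
    (use assms in \<open>auto intro: sig_conj sig_not simp: dfun_def\<close>)

lemma dfun_trm:
  assumes "trm k t" shows "dfun k t"
proof -
  obtain u p where u: "\<And>e. t e = val (conc k e p) u" using assms unfolding trm_def by blast
  have "(\<lambda>n. conc (Suc k) e p (Suc n)) = conc k (\<lambda>n. e (Suc n)) p" for e
    by (rule ext) (simp add: conc_def)
  then have "t (\<lambda>n. e (Suc n)) = val (conc (Suc k) e p) (up 1 u)" for e
    by (simp add: u)
  then have "trm (Suc k) (\<lambda>e. t (\<lambda>n. e (Suc n)))" unfolding trm_def by blast
  then show ?thesis unfolding dfun_def by (intro trm_eq trm_var) simp_all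
qed

lemma dfun_weaken: "dfun k t \<Longrightarrow> dfun (Suc k) (\<lambda>e. t (\<lambda>n. e (Suc n)))"
  unfolding dfun_def by (rule sig_weaken[where Q = "\<lambda>x e. x = t e"])

lemma sig_rel1:
  assumes "rel1 P" "dfun k t" shows "sig k (\<lambda>e. P (t e))"
proof (rule sig_subst[OF assms(2), where P = "\<lambda>x e. P x"])
  show "sig (Suc k) (\<lambda>e. P (e 0))"
    using sig_reindex[OF assms(1)[unfolded rel1_def], of "\<lambda>i e. e 0" "Suc k" "\<lambda>i. Var 0"]
    by (simp add: conc_def)
qed

lemma sig_rel2:
  assumes "rel2 P" "dfun k t" "dfun k u" shows "sig k (\<lambda>e. P (t e) (u e))"
proof (rule sig_subst[OF assms(2), where P = "\<lambda>x e. P x (u e)"])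
  show "sig (Suc k) (\<lambda>e. P (e 0) (u (\<lambda>n. e (Suc n))))"
  proof (rule sig_subst[OF dfun_weaken[OF assms(3)], where P = "\<lambda>y e. P (e 0) y"])
    show "sig (Suc (Suc k)) (\<lambda>e. P (e (Suc 0)) (e 0))"
      using sig_reindex[OF assms(1)[unfolded rel2_def], of "\<lambda>i e. if i = 0 then e (Suc 0) else e 0"
          "Suc (Suc k)" "\<lambda>i. if i = 0 then Var (Suc 0) else Var 0"]
      by (simp add: conc_def)
  qed
qed

lemma sig_rel3:
  assumes "rel3 P" "dfun k t" "dfun k u" "dfun k v" shows "sig k (\<lambda>e. P (t e) (u e) (v e))"
proof (rule sig_subst[OF assms(2), where P = "\<lambda>x e. P x (u e) (v e)"])
  show "sig (Suc k) (\<lambda>e. P (e 0) (u (\<lambda>n. e (Suc n))) (v (\<lambda>n. e (Suc n))))"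
  proof (rule sig_subst[OF dfun_weaken[OF assms(3)], where P = "\<lambda>y e. P (e 0) y (v (\<lambda>n. e (Suc n)))"])
    show "sig (Suc (Suc k)) (\<lambda>e. P (e (Suc 0)) (e 0) (v (\<lambda>n. e (Suc (Suc n)))))"
    proof (rule sig_subst[OF dfun_weaken[OF dfun_weaken[OF assms(4)]], where P = "\<lambda>z e. P (e (Suc 0)) (e 0) z"])
      show "sig (Suc (Suc (Suc k))) (\<lambda>e. P (e (Suc (Suc 0))) (e (Suc 0)) (e 0))"
        using sig_reindex[OF assms(1)[unfolded rel3_def],
            of "\<lambda>i e. if i = 0 then e (Suc (Suc 0)) else if i = 1 then e (Suc 0) else e 0"
            "Suc (Suc (Suc k))" "\<lambda>i. if i = 0 then Var (Suc (Suc 0)) else if i = 1 then Var (Suc 0) else Var 0"]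
        by (simp add: conc_def)
    qed
  qed
qed

lemma dfun_compose1:
  assumes "rel2 (\<lambda>y x. y = f x)" "dfun k t" shows "dfun k (\<lambda>e. f (t e))"
  unfolding dfun_def
  by (rule sig_rel2[OF assms(1)], rule dfun_trm, rule trm_var, simp, rule dfun_weaken[OF assms(2)])

lemma dfun_compose2:
  assumes "rel3 (\<lambda>z x y. z = f x y)" "dfun k t" "dfun k u" shows "dfun k (\<lambda>e. f (t e) (u e))"
  unfolding dfun_def
  by (rule sig_rel3[OF assms(1)], rule dfun_trm, rule trm_var, simp, rule dfun_weaken[OF assms(2)],
      rule dfun_weaken[OF assms(3)])

named_theorems sigs

lemma dfun_const [sigs]: "dfun k (\<lambda>e. c)"
  by (intro dfun_trm trm_const)

lemma dfun_var [sigs]: "n < k \<Longrightarrow> dfun k (\<lambda>e. e n)"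
  by (intro dfun_trm trm_var)

lemma dfun_add [sigs]: "dfun k t \<Longrightarrow> dfun k u \<Longrightarrow> dfun k (\<lambda>e. t e + u e)"
  by (rule dfun_compose2[of "(+)"]) (unfold rel3_def, intro trm_eq trm_add trm_var, simp_all)

lemma dfun_mult [sigs]: "dfun k t \<Longrightarrow> dfun k u \<Longrightarrow> dfun k (\<lambda>e. t e * u e)"
  by (rule dfun_compose2[of "(*)"]) (unfold rel3_def, intro trm_eq trm_mult trm_var, simp_all)

lemma dfun_mpair [sigs]: "dfun k t \<Longrightarrow> dfun k u \<Longrightarrow> dfun k (\<lambda>e. mpair (t e) (u e))"
  unfolding mpair_def by (intro dfun_add dfun_mult)

lemma sig_eq [sigs]: "dfun k t \<Longrightarrow> dfun k u \<Longrightarrow> sig k (\<lambda>e. t e = u e)"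
  by (rule sig_rel2[of "(=)"]) (unfold rel2_def, intro trm_eq trm_var, simp_all)

lemma sig_less [sigs]: "dfun k t \<Longrightarrow> dfun k u \<Longrightarrow> sig k (\<lambda>e. t e < u e)"
  by (rule sig_rel2[of "(<)"]) (unfold rel2_def, intro trm_less trm_var, simp_all)

lemma sig_le [sigs]: "dfun k t \<Longrightarrow> dfun k u \<Longrightarrow> sig k (\<lambda>e. t e \<le> u e)"
  unfolding less_eq_mnat_def by (intro sig_disj sig_less sig_eq)

lemma sig_mem [sigs]: "X \<in> coll \<Longrightarrow> dfun k t \<Longrightarrow> sig k (\<lambda>e. t e \<in> X)"
  by (rule sig_rel1[of "\<lambda>x. x \<in> X"]) (unfold rel1_def, intro trm_mem trm_var, simp_all)

lemma sig_const [sigs]: "sig k (\<lambda>e. B)"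
  using sig_True sig_False by (cases B) auto

lemmas [sigs] = sig_imp sig_not sig_disj sig_conj sig_iff sig_True sig_False

lemma sig_ball_less [sigs]:
  assumes "dfun k t" "sig (Suc k) (\<lambda>e. Q (e 0) (\<lambda>n. e (Suc n)))"
  shows "sig k (\<lambda>e. \<forall>x<t e. Q x e)"
proof (rule sig_subst[OF assms(1), where P = "\<lambda>y e. \<forall>x<y. Q x e"])
  show "sig (Suc k) (\<lambda>e. \<forall>x<e 0. Q x (\<lambda>n. e (Suc n)))"
    using sig_weaken[OF assms(2)] by (intro trm_ball trm_var) simp_all
qed

lemma sig_bex_less [sigs]:
  assumes "dfun k t" "sig (Suc k) (\<lambda>e. Q (e 0) (\<lambda>n. e (Suc n)))"
  shows "sig k (\<lambda>e. \<exists>x<t e. Q x e)"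
proof -
  have "sig k (\<lambda>e. \<forall>x<t e. \<not> Q x e)" using assms(1) sig_not[OF assms(2)] by (rule sig_ball_less)
  from sig_not[OF this] show ?thesis by simp
qed

lemma sig_ball_le [sigs]:
  assumes "dfun k t" "sig (Suc k) (\<lambda>e. Q (e 0) (\<lambda>n. e (Suc n)))"
  shows "sig k (\<lambda>e. \<forall>x\<le>t e. Q x e)"
  using sig_ball_less[OF dfun_add[OF assms(1) dfun_const[of _ 1]] assms(2)]
  by (simp add: mnat_less_succ)

lemma sig_bex_le [sigs]:
  assumes "dfun k t" "sig (Suc k) (\<lambda>e. Q (e 0) (\<lambda>n. e (Suc n)))"
  shows "sig k (\<lambda>e. \<exists>x\<le>t e. Q x e)"
  using sig_bex_less[OF dfun_add[OF assms(1) dfun_const[of _ 1]] assms(2)]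
  by (simp add: mnat_less_succ)

lemma rel1_Delta:
  assumes "rel2 (\<lambda>x n. Q n x)" "rel2 (\<lambda>x n. R n x)"
    "\<And>n. P n \<longleftrightarrow> (\<exists>x. Q n x)" "\<And>n. \<not> P n \<longleftrightarrow> (\<exists>x. R n x)"
  shows "rel1 P"
  unfolding rel1_def
  by (rule sig_Delta[of _ "\<lambda>x e. Q (e 0) x" "\<lambda>x e. R (e 0) x"])
    (use assms in \<open>auto simp: rel2_def numeral_2_eq_2\<close>)

lemma rel1_iff_coll: "rel1 P \<longleftrightarrow> {n. P n} \<in> coll"
proof
  assume "rel1 P"
  then have "rel2 (\<lambda>x n. P n)" unfolding rel2_def by (rule sig_rel1) (intro sigs, simp)
  then have "sig 2 (\<lambda>e. P (e 1))" by (simp add: rel2_def)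
  then have "{n. \<exists>x::mnat. P n} \<in> coll"
    by (intro sig_comprehension[of "\<lambda>n x. P n" "\<lambda>n x. P n"]) simp_all
  then show "{n. P n} \<in> coll" by simp
next
  assume "{n. P n} \<in> coll"
  from sig_mem[OF this, of 1 "\<lambda>e. e 0"] show "rel1 P" unfolding rel1_def by (simp add: dfun_var)
qed

lemma rel1_induct:
  assumes "rel1 P" "P 0" "\<And>n. P n \<Longrightarrow> P (n + 1)" shows "P n"
  using sig_induct0[of P] assms by (simp add: rel1_def)

lemma rel1_less_induct:
  assumes "rel1 P" "\<And>n. (\<And>m. m < n \<Longrightarrow> P m) \<Longrightarrow> P n" shows "P n"
proof -
  have "\<forall>m<n. P m" for n
    by (rule rel1_induct[of "\<lambda>n. \<forall>m<n. P m"])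
      (use assms in \<open>auto simp: rel1_def basic_arithmetic(8) intro!: sig_ball_less sig_rel1[OF assms(1)] sigs\<close>)
  then show ?thesis using assms(2) by blast
qed

lemma rel1_least:
  assumes "rel1 P" "P n" obtains m where "P m" "\<And>l. l < m \<Longrightarrow> \<not> P l"
proof -
  have "rel1 (\<lambda>n. \<not> P n)" using assms(1) unfolding rel1_def by (rule sig_not)
  then show ?thesis using rel1_less_induct[of "\<lambda>n. \<not> P n" n] assms(2) that by blast
qed

lemma Sigma_induct:
  assumes "rel2 Q" "\<exists>x. Q 0 x" "\<And>n x. Q n x \<Longrightarrow> \<exists>y. Q (n + 1) y" shows "\<exists>x. Q n x"
proof (rule sig_induct_Sigma01[OF _ assms(2,3)])
  show "sig 2 (\<lambda>e. Q (e 1) (e 0))" by (rule sig_rel2[OF assms(1)]) (intro sigs, simp)+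
qed


section \<open>Finite sets and recursion\<close>

text \<open>A bounded quotient makes divisibility definable.\<close>

lemma mdvd_bounded: "d dvd a \<longleftrightarrow> (\<exists>k\<le>a. a = d * (k :: mnat))"
proof
  assume "d dvd a"
  then obtain k where k: "a = d * k" by blast
  show "\<exists>k\<le>a. a = d * k"
  proof (cases "d = 0")
    case False
    then have "1 * k \<le> d * k" by (intro mult_right_mono) (auto simp: mnat_less_iff[of 0, simplified, symmetric] mnat_zero_less)
    then show ?thesis using k by auto
  qed (use k in auto)
qed auto

lemma sig_dvd [sigs]: "dfun k t \<Longrightarrow> dfun k u \<Longrightarrow> sig k (\<lambda>e. t e dvd u e)"
  by (rule sig_rel2[of "(dvd)"]) (unfold rel2_def mdvd_bounded, (intro sigs; simp))

text \<open>Lets Bezout identities with negative coefficients settle divisibility in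
  \<open>mnat\<close>.\<close>

lemma toz_dvd: "toz x dvd toz y \<longleftrightarrow> x dvd y"
proof
  assume "toz x dvd toz y"
  then obtain z where z: "toz y = toz x * z" by blast
  show "x dvd y"
  proof (cases "y = 0")
    case False
    then have "0 < toz y" using toz_less[of 0 y] by (simp add: mnat_zero_less)
    then have "0 \<le> z" using z toz_nonneg[of x] by (metis less_le mult_nonneg_nonpos not_le linear)
    obtain a b where ab: "z = toz a - toz b" using toz_diff by blast
    then have "b \<le> a" using \<open>0 \<le> z\<close> toz_le[of b a] by simp
    then obtain c where "a = b + c" by (metis le_iff_add)
    then have "z = toz c" using ab by simp
    then have "toz y = toz (x * c)" using z by simp
    then have "y = x * c" by (simp only: toz_eq)
    then show ?thesis by simp
  qed simp
qed auto

text \<open>Goedel's moduli are pairwise coprime; the proof only needs the explicit Bezout coefficients.\<close>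

lemma coprime_moduli:
  fixes a b x y :: mnat
  assumes div: "\<And>d. 0 < d \<Longrightarrow> d \<le> n \<Longrightarrow> d dvd b" and xy: "x \<noteq> y" "x < n" "y < n"
    and dvd: "1 + (x + 1) * b dvd a * (1 + (y + 1) * b)"
  shows "1 + (x + 1) * b dvd a"
proof -
  define A B X Y where "A = toz a" and "B = toz b" and "X = toz x + 1" and "Y = toz y + 1"
  \<comment> \<open>Up to sign, the difference is a positive number at most \<open>n\<close>, hence
    one of the divisors of \<open>b\<close>.\<close>
  have "(X - Y) dvd B"
  proof (cases x y rule: mnat_diff_cases)
    case (1 d)
    have "d \<le> x" using 1 by simp
    then have "d \<le> n" using xy(2) by order
    then have "d dvd b" using xy 1 by (intro div) (auto simp: mnat_zero_less)
    then have "toz d dvd B" by (simp add: toz_dvd B_def)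
    moreover have "X - Y = toz d" by (simp add: X_def Y_def 1)
    ultimately show ?thesis by simp
  next
    case (2 d)
    have "d \<le> y" using 2 by simp
    then have "d \<le> n" using xy(3) by order
    then have "d dvd b" using xy 2 by (intro div) (auto simp: mnat_zero_less)
    then have "toz d dvd B" by (simp add: toz_dvd B_def)
    moreover have "X - Y = - toz d" by (simp add: X_def Y_def 2)
    ultimately show ?thesis by simp
  qed
  then obtain C where C: "B = (X - Y) * C" by blast
  have "toz (1 + (x + 1) * b) dvd toz (a * (1 + (y + 1) * b))" using dvd by (simp only: toz_dvd)
  then have 1: "1 + X * B dvd A * (1 + Y * B)" by (simp add: X_def Y_def A_def B_def)
  \<comment> \<open>Uses X(1 + YB) - Y(1 + XB) = X - Y and (X - Y)C = B; every term on the right is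
    a multiple of 1 + XB.\<close>
  have eq: "A = A * (1 + X * B) - X * C * (X * (A * (1 + Y * B)) - Y * (A * (1 + X * B)))"
  proof -
    have "X * C * (X * (A * (1 + Y * B)) - Y * (A * (1 + X * B))) = A * X * ((X - Y) * C)"
      by (simp add: algebra_simps)
    then show ?thesis unfolding C[symmetric] by (simp add: algebra_simps)
  qed
  have "1 + X * B dvd A"
    by (subst eq) (intro dvd_diff dvd_mult dvd_triv_right 1)
  then have "toz (1 + (x + 1) * b) dvd toz a" by (simp add: X_def A_def B_def)
  then show ?thesis by (simp only: toz_dvd)
qed

text \<open>Goedel's coding: \<open>n\<close> bounds the finite set, and \<open>x\<close> belongs to
  it if its modulus divides \<open>a\<close>. Exponentiation is still to be constructed by means of
  it, so binary codes are not at hand.\<close>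

definition cmem :: "mnat \<Rightarrow> mnat \<Rightarrow> bool" where
  "cmem x w \<longleftrightarrow> (\<exists>n\<le>w. \<exists>a\<le>w. \<exists>b\<le>w. w = mpair (mpair n a) b \<and> x < n \<and> 1 + (x + 1) * b dvd a)"

lemma sig_cmem [sigs]: "dfun k t \<Longrightarrow> dfun k u \<Longrightarrow> sig k (\<lambda>e. cmem (t e) (u e))"
  by (rule sig_rel2[of cmem]) (unfold rel2_def cmem_def, (intro sigs; simp))

lemma cmem_mpair: "cmem x (mpair (mpair n a) b) \<longleftrightarrow> x < n \<and> 1 + (x + 1) * b dvd a"
proof -
  have "n \<le> mpair (mpair n a) b" "a \<le> mpair (mpair n a) b" "b \<le> mpair (mpair n a) b"
    using le_mpair order_trans by metis+
  then show ?thesis unfolding cmem_def by auto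
qed

text \<open>\<open>b\<close> is a common multiple of 1, ..., \<open>n\<close>, so that the moduli
  are pairwise coprime, and \<open>a\<close> is the product of the moduli of the members. Both arise
  as witnesses in Sigma^0_1 inductions.\<close>

lemma finite_code_exists:
  assumes P: "rel1 P"
  shows "\<exists>w. \<forall>x. cmem x w \<longleftrightarrow> x < n \<and> P x"
proof -
  have "\<exists>b. 0 < b \<and> (\<forall>d\<le>n. 0 < d \<longrightarrow> d dvd b)"
  proof (rule Sigma_induct[where Q = "\<lambda>n b. 0 < b \<and> (\<forall>d\<le>n. 0 < d \<longrightarrow> d dvd b)"])
    show "rel2 (\<lambda>n b. 0 < b \<and> (\<forall>d\<le>n. 0 < d \<longrightarrow> d dvd b))"
      unfolding rel2_def by (intro sigs; simp)
    show "\<exists>b::mnat. 0 < b \<and> (\<forall>d\<le>0. 0 < d \<longrightarrow> d dvd b)" by (intro exI[of _ 1]) auto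
    fix n b :: mnat assume b: "0 < b \<and> (\<forall>d\<le>n. 0 < d \<longrightarrow> d dvd b)"
    have "d dvd b * (n + 1)" if "d \<le> n + 1" "0 < d" for d
    proof (cases "d = n + 1")
      case False
      then have "d \<le> n" using that by (metis mnat_less_succ order.not_eq_order_implies_strict)
      then show ?thesis using b that by simp
    qed simp
    then show "\<exists>c. 0 < c \<and> (\<forall>d\<le>n + 1. 0 < d \<longrightarrow> d dvd c)"
      using b by (intro exI[of _ "b * (n + 1)"]) (auto simp: mnat_zero_less)
  qed
  then obtain b where b: "0 < b" "\<And>d. 0 < d \<Longrightarrow> d \<le> n \<Longrightarrow> d dvd b" by blast
  have "\<exists>a. \<forall>x<n. 1 + (x + 1) * b dvd a \<longleftrightarrow> x < k \<and> P x" for k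
  proof (rule Sigma_induct[where Q = "\<lambda>k a. \<forall>x<n. 1 + (x + 1) * b dvd a \<longleftrightarrow> x < k \<and> P x"])
    show "rel2 (\<lambda>k a. \<forall>x<n. 1 + (x + 1) * b dvd a \<longleftrightarrow> x < k \<and> P x)"
      unfolding rel2_def by (intro sigs sig_rel1[OF P]; simp)
    \<comment> \<open>The empty product 1 codes the empty set because the moduli exceed 1 for
      positive \<open>b\<close>.\<close>
    have "\<not> 1 + (x + 1) * b dvd 1" for x
    proof
      assume "1 + (x + 1) * b dvd 1"
      then obtain k where k: "1 = (1 + (x + 1) * b) * k" by blast
      then have "k \<noteq> 0" by auto
      then obtain k' where "k = k' + 1" using mnat_cases by metis
      then have "1 = 1 + ((x + 1) * b + (1 + (x + 1) * b) * k')" using k by (simp add: algebra_simps)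
      then show False using b(1) by (simp add: mnat_zero_less)
    qed
    then show "\<exists>a. \<forall>x<n. 1 + (x + 1) * b dvd a \<longleftrightarrow> x < 0 \<and> P x" by (intro exI[of _ 1]) simp
    fix k a assume a: "\<forall>x<n. 1 + (x + 1) * b dvd a \<longleftrightarrow> x < k \<and> P x"
    show "\<exists>a. \<forall>x<n. 1 + (x + 1) * b dvd a \<longleftrightarrow> x < k + 1 \<and> P x"
    proof (cases "k < n \<and> P k")
      case True
      have "1 + (x + 1) * b dvd a * (1 + (k + 1) * b) \<longleftrightarrow> x < k + 1 \<and> P x" if "x < n" for x
      proof (cases "x = k")
        case False
        then have "1 + (x + 1) * b dvd a * (1 + (k + 1) * b) \<longleftrightarrow> 1 + (x + 1) * b dvd a"
          using coprime_moduli[of n b x k a] b(2) that True by auto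
        then show ?thesis using a that False by (auto simp: basic_arithmetic(8))
      qed (use True in \<open>auto simp: basic_arithmetic(8)\<close>)
      then show ?thesis by blast
    next
      case False
      then show ?thesis using a by (intro exI[of _ a]) (auto simp: basic_arithmetic(8))
    qed
  qed
  then obtain a where a: "\<And>x. x < n \<Longrightarrow> 1 + (x + 1) * b dvd a \<longleftrightarrow> x < n \<and> P x" by blast
  show ?thesis by (rule exI[of _ "mpair (mpair n a) b"]) (use a in \<open>auto simp: cmem_mpair\<close>)
qed

text \<open>Course-of-values recursion. Codes of initial segments that obey the recursion exist by
  Sigma^0_1 induction and agree on their common part, so \<open>Q\<close> can be read off any of
  them, which makes it Delta^0_1.\<close>

theorem set_recursion:
  assumes def: "rel2 (\<lambda>n w. \<Phi> n (\<lambda>x. cmem x w))"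
    and local: "\<And>n P P'. (\<And>x. x < n \<Longrightarrow> P x \<longleftrightarrow> P' x) \<Longrightarrow> \<Phi> n P \<longleftrightarrow> \<Phi> n P'"
  shows "\<exists>Q. rel1 Q \<and> (\<forall>n. Q n \<longleftrightarrow> \<Phi> n Q)"
proof -
  define good where "good n w \<longleftrightarrow> (\<forall>m<n. cmem m w \<longleftrightarrow> \<Phi> m (\<lambda>x. cmem x w))" for n w
  have good: "rel2 good" unfolding good_def rel2_def by (intro sigs sig_rel2[OF def]; simp)
  have ex: "\<exists>w. good n w" for n
  proof (rule Sigma_induct[OF good])
    show "\<exists>w. good 0 w" by (simp add: good_def)
    fix n w assume w: "good n w"
    have "rel1 (\<lambda>x. cmem x w \<and> x < n \<or> x = n \<and> \<Phi> n (\<lambda>x. cmem x w))"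
      unfolding rel1_def by (intro sigs; simp)
    from finite_code_exists[OF this, of "n + 1"] obtain v
      where v: "\<And>x. cmem x v \<longleftrightarrow> x < n + 1 \<and> (cmem x w \<and> x < n \<or> x = n \<and> \<Phi> n (\<lambda>x. cmem x w))"
      by blast
    have vw: "cmem x v \<longleftrightarrow> cmem x w" if "x < n" for x using that v[of x] by (auto simp: basic_arithmetic(8))
    have "cmem m v \<longleftrightarrow> \<Phi> m (\<lambda>x. cmem x v)" if "m < n + 1" for m
    proof -
      have "\<Phi> m (\<lambda>x. cmem x v) \<longleftrightarrow> \<Phi> m (\<lambda>x. cmem x w)"
        using that by (intro local vw) (auto simp: basic_arithmetic(8))
      then show ?thesis using w that vw[of m] v[of m] unfolding good_def
        by (auto simp: basic_arithmetic(8))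
    qed
    then show "\<exists>v. good (n + 1) v" unfolding good_def by blast
  qed
  have unique: "cmem m w \<longleftrightarrow> cmem m v" if "good n w" "good l v" "m < n" "m < l" for m n l w v
  proof -
    have "m < n \<longrightarrow> m < l \<longrightarrow> (cmem m w \<longleftrightarrow> cmem m v)"
    proof (rule rel1_less_induct[where P = "\<lambda>m. m < n \<longrightarrow> m < l \<longrightarrow> (cmem m w \<longleftrightarrow> cmem m v)"])
      show "rel1 (\<lambda>m. m < n \<longrightarrow> m < l \<longrightarrow> (cmem m w \<longleftrightarrow> cmem m v))"
        unfolding rel1_def by (intro sigs; simp)
      fix m assume IH: "\<And>i. i < m \<Longrightarrow> i < n \<longrightarrow> i < l \<longrightarrow> (cmem i w \<longleftrightarrow> cmem i v)"
      show "m < n \<longrightarrow> m < l \<longrightarrow> (cmem m w \<longleftrightarrow> cmem m v)"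
      proof (intro impI)
        assume "m < n" "m < l"
        then have "\<Phi> m (\<lambda>x. cmem x w) \<longleftrightarrow> \<Phi> m (\<lambda>x. cmem x v)"
          by (intro local) (use IH in force)
        then show "cmem m w \<longleftrightarrow> cmem m v"
          using that(1,2) \<open>m < n\<close> \<open>m < l\<close> unfolding good_def by blast
      qed
    qed
    then show ?thesis using that by simp
  qed
  define Q where "Q n \<longleftrightarrow> (\<exists>w. good (n + 1) w \<and> cmem n w)" for n
  have Q: "Q n \<longleftrightarrow> cmem n w" if "good m w" "n < m" for n m w
    using unique[OF that(1), of "n + 1" _ n] that(2) ex[of "n + 1"] unfolding Q_def
    by (metis basic_arithmetic(8))
  have "rel1 Q"
  proof (rule rel1_Delta)
    show "rel2 (\<lambda>w n. good (n + 1) w \<and> cmem n w)" "rel2 (\<lambda>w n. good (n + 1) w \<and> \<not> cmem n w)"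
      unfolding rel2_def by (intro sigs sig_rel2[OF good]; simp)+
    show "Q n \<longleftrightarrow> (\<exists>w. good (n + 1) w \<and> cmem n w)" for n by (rule Q_def)
    show "\<not> Q n \<longleftrightarrow> (\<exists>w. good (n + 1) w \<and> \<not> cmem n w)" for n
      using Q[of "n + 1"] ex[of "n + 1"] by (metis basic_arithmetic(8))
  qed
  moreover have "Q n \<longleftrightarrow> \<Phi> n Q" for n
  proof -
    obtain w where w: "good (n + 1) w" using ex by blast
    have "n < n + 1" by (simp add: basic_arithmetic(8))
    then have "Q n \<longleftrightarrow> \<Phi> n (\<lambda>x. cmem x w)" using w Q[OF w] unfolding good_def by blast
    also have "\<dots> \<longleftrightarrow> \<Phi> n Q" by (rule local) (simp add: Q[OF w] basic_arithmetic(8))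
    finally show ?thesis .
  qed
  ultimately show ?thesis by blast
qed


lemma mnat_Suc_leI: "m < n \<Longrightarrow> m + 1 \<le> (n :: mnat)"
  by (rule mnat_less_iff[THEN iffD1])

lemma mnat_less_SucI: "m \<le> n \<Longrightarrow> m < n + (1 :: mnat)"
  by (rule mnat_less_succ[THEN iffD2])

text \<open>The graph is a set of pair codes obtained by recursion on the code. Since
  \<open>h\<close> does not decrease its argument, (i, x) has a smaller code than (i + 1, h
  x).\<close>

theorem monotone_recursion:
  assumes h: "rel2 (\<lambda>y x. y = h x)" and mono: "\<And>x. x \<le> h x"
  shows "\<exists>f. rel2 (\<lambda>y n. y = f n) \<and> f 0 = a \<and> (\<forall>n. f (n + 1) = h (f n))"
proof -
  let ?\<Phi> = "\<lambda>n P. n = mpair 0 a \<or> (\<exists>i\<le>n. \<exists>x\<le>n. n = mpair (i + 1) (h x) \<and> P (mpair i x))"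
  have less: "mpair i x < mpair (i + 1) (h x)" for i x
  proof (rule mpair_less)
    have "i + x \<le> i + h x" using mono by simp
    then have "i + x < i + h x + 1" by (rule mnat_less_SucI)
    then show "i + x < i + 1 + h x" by (simp add: ac_simps)
  qed
  have "\<exists>E. rel1 E \<and> (\<forall>n. E n \<longleftrightarrow> ?\<Phi> n E)"
  proof (rule set_recursion)
    show "rel2 (\<lambda>n w. ?\<Phi> n (\<lambda>x. cmem x w))"
      unfolding rel2_def by (intro sigs dfun_compose1[OF h]; simp)
    show "?\<Phi> n P \<longleftrightarrow> ?\<Phi> n P'" if "\<And>x. x < n \<Longrightarrow> P x \<longleftrightarrow> P' x" for n P P'
      using that less by blast
  qed
  then obtain E where E: "rel1 E" and E_iff: "\<And>n. E n \<longleftrightarrow> ?\<Phi> n E" by blast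
  have E0: "E (mpair 0 v) \<longleftrightarrow> v = a" for v
    using basic_arithmetic(1) by (subst E_iff) (auto dest: sym)
  have E1: "E (mpair (i + 1) v) \<longleftrightarrow> (\<exists>x\<le>v. v = h x \<and> E (mpair i x))" for i v
  proof -
    have "i \<le> i + 1" by simp
    then have "i \<le> mpair (i + 1) v" using le_mpair(1)[of "i + 1" v] by order
    moreover have "x \<le> mpair (i + 1) (h x)" for x using le_mpair(2) mono order_trans by blast
    moreover have "mpair (i + 1) v \<noteq> mpair 0 a" by (simp add: basic_arithmetic(1))
    ultimately show ?thesis using mono by (subst E_iff) auto
  qed
  have ex: "\<exists>v. E (mpair i v)" for i
  proof (rule Sigma_induct[where Q = "\<lambda>i v. E (mpair i v)"])
    show "rel2 (\<lambda>i v. E (mpair i v))" unfolding rel2_def by (intro sig_rel1[OF E] sigs; simp)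
  qed (use E0 E1 mono in auto)
  have uniq: "v = v'" if "E (mpair i v)" "E (mpair i v')" for i v v'
  proof -
    let ?B = "v + v'"
    \<comment> \<open>A fixed bound for both values keeps the induction predicate Sigma^0_0;
      predecessors stay below it since \<open>x \<le> h x\<close>.\<close>
    have "\<forall>v\<le>?B. \<forall>v'\<le>?B. E (mpair i v) \<longrightarrow> E (mpair i v') \<longrightarrow> v = v'"
    proof (rule rel1_induct[where P = "\<lambda>i. \<forall>v\<le>?B. \<forall>v'\<le>?B. E (mpair i v) \<longrightarrow> E (mpair i v') \<longrightarrow> v = v'"])
      show "rel1 (\<lambda>i. \<forall>v\<le>?B. \<forall>v'\<le>?B. E (mpair i v) \<longrightarrow> E (mpair i v') \<longrightarrow> v = v')"
        unfolding rel1_def by (intro sig_rel1[OF E] sigs; simp)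
      fix n assume IH: "\<forall>v\<le>?B. \<forall>v'\<le>?B. E (mpair n v) \<longrightarrow> E (mpair n v') \<longrightarrow> v = v'"
      show "\<forall>v\<le>?B. \<forall>v'\<le>?B. E (mpair (n + 1) v) \<longrightarrow> E (mpair (n + 1) v') \<longrightarrow> v = v'"
      proof (intro allI impI)
        fix w w' assume le: "w \<le> ?B" "w' \<le> ?B" and "E (mpair (n + 1) w)" "E (mpair (n + 1) w')"
        then obtain x x' where x: "x \<le> w" "w = h x" "E (mpair n x)" "x' \<le> w'" "w' = h x'" "E (mpair n x')"
          unfolding E1 by blast
        have "x \<le> ?B" "x' \<le> ?B" using x le by order+
        then show "w = w'" using IH x by blast
      qed
    qed (simp add: E0)
    then show ?thesis using that by auto
  qed
  define f where "f i = (THE v. E (mpair i v))" for i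
  have f: "y = f i \<longleftrightarrow> E (mpair i y)" for i y
  proof -
    obtain v where v: "E (mpair i v)" using ex by blast
    then have "f i = v" unfolding f_def by (rule the_equality) (use uniq v in blast)
    then show ?thesis using v uniq by blast
  qed
  have "rel2 (\<lambda>y n. y = f n)" unfolding f rel2_def by (intro sig_rel1[OF E] sigs; simp)
  moreover have "f 0 = a" using f[of a 0] E0 by simp
  moreover have "f (n + 1) = h (f n)" for n
    using f[of "h (f n)" "n + 1"] f[of "f n" n] E1 mono by auto
  ultimately show ?thesis by blast
qed


section \<open>Binary expansions\<close>

lemma toz_two [simp]: "toz 2 = 2"
  using toz_simps(3)[of 1 1] by simp

definition pw :: "mnat \<Rightarrow> mnat" where
  "pw = (SOME f. rel2 (\<lambda>y n. y = f n) \<and> f 0 = 1 \<and> (\<forall>n. f (n + 1) = 2 * f n))"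

lemma pw: "rel2 (\<lambda>y n. y = pw n) \<and> pw 0 = 1 \<and> (\<forall>n. pw (n + 1) = 2 * pw n)"
proof -
  have "\<exists>f. rel2 (\<lambda>y n. y = f n) \<and> f 0 = 1 \<and> (\<forall>n. f (n + 1) = 2 * f n)"
  proof (rule monotone_recursion)
    show "rel2 (\<lambda>y x. y = 2 * x)" unfolding rel2_def by (intro sigs; simp)
    show "x \<le> 2 * x" for x :: mnat by (simp add: mult_2)
  qed
  from someI_ex[OF this] show ?thesis unfolding pw_def .
qed

lemma dfun_pw [sigs]: "dfun k t \<Longrightarrow> dfun k (\<lambda>e. pw (t e))"
  using pw by (intro dfun_compose1[of pw]) simp_all

lemma pw_0 [simp]: "pw 0 = 1" and pw_Suc [simp]: "pw (n + 1) = 2 * pw n"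
  using pw by simp_all

text \<open>Ties the exponentiation described inside the language to \<open>pw\<close>; definability
  of \<open>f\<close> is what admits the induction.\<close>

lemma pw_unique:
  assumes "rel2 (\<lambda>y n. y = f n)" "f 0 = 1" "\<And>n. f (n + 1) = 2 * f n"
  shows "f = pw"
proof
  fix n show "f n = pw n"
  proof (rule rel1_induct[where P = "\<lambda>n. f n = pw n"])
    show "rel1 (\<lambda>n. f n = pw n)" unfolding rel1_def by (intro sigs dfun_compose1[OF assms(1)]; simp)
  qed (use assms in auto)
qed

lemma pw_pos [simp]: "0 < pw n"
proof (rule rel1_induct[where P = "\<lambda>n. 0 < pw n"])
  show "rel1 (\<lambda>n. 0 < pw n)" unfolding rel1_def by (intro sigs; simp)
qed auto

lemma pw_nonzero [simp]: "pw n \<noteq> 0"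
  by (metis pw_pos less_irrefl)

lemma less_pw: "n < pw n"
proof (rule rel1_induct[where P = "\<lambda>n. n < pw n"])
  show "rel1 (\<lambda>n. n < pw n)" unfolding rel1_def by (intro sigs; simp)
  show "n + 1 < pw (n + 1)" if "n < pw n" for n
    using that toz_nonneg[of n] by (simp add: to_mint)
qed simp

lemma pw_add: "pw (m + n) = pw m * pw n"
proof (rule rel1_induct[where P = "\<lambda>n. pw (m + n) = pw m * pw n"])
  show "rel1 (\<lambda>n. pw (m + n) = pw m * pw n)" unfolding rel1_def by (intro sigs; simp)
  show "pw (m + (n + 1)) = pw m * pw (n + 1)" if "pw (m + n) = pw m * pw n" for n
    using that pw_Suc[of "m + n"] by (simp add: add.assoc mult.left_commute)
qed simp

lemma one_le_pw: "1 \<le> pw n"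
  using pw_pos[of n] mnat_less_iff[of 0] by simp

lemma pw_mono: "m \<le> n \<Longrightarrow> pw m \<le> pw n"
proof -
  assume "m \<le> n"
  then obtain d where "n = m + d" by (metis le_iff_add)
  then show ?thesis using mult_left_mono[OF one_le_pw[of d], of "pw m"] by (simp add: pw_add)
qed

lemma pw_less_double: "m < n \<Longrightarrow> \<exists>s. pw n = 2 * pw m * s"
proof -
  assume "m < n"
  then obtain d where "n = (m + 1) + d" using mnat_Suc_leI le_iff_add by blast
  then show ?thesis using pw_add[of "m + 1" d] by auto
qed

lemma pw_less_iff [simp]: "pw m < pw n \<longleftrightarrow> m < n"
proof -
  have *: "pw m < pw n" if "m < n" for m n
  proof -
    have "pw m < pw (m + 1)" by (simp add: mult_2)
    also have "\<dots> \<le> pw n" using that by (intro pw_mono mnat_Suc_leI)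
    finally show ?thesis .
  qed
  then show ?thesis by (metis less_asym neq_iff)
qed

lemma pw_inj [simp]: "pw m = pw n \<longleftrightarrow> m = n"
  by (metis less_irrefl neq_iff pw_less_iff)

lemma division: "0 < d \<Longrightarrow> \<exists>q r. m = q * d + r \<and> r < (d :: mnat)"
proof -
  assume d: "0 < d"
  have "\<exists>q. \<exists>r<d. m = q * d + r"
  proof (rule Sigma_induct[where Q = "\<lambda>m q. \<exists>r<d. m = q * d + r"])
    show "rel2 (\<lambda>m q. \<exists>r<d. m = q * d + r)" unfolding rel2_def by (intro sigs; simp)
    show "\<exists>q. \<exists>r<d. 0 = q * d + r" using d by (intro exI[of _ 0]) auto
    fix m q assume "\<exists>r<d. m = q * d + r"
    then obtain r where r: "r < d" "m = q * d + r" by blast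
    show "\<exists>q. \<exists>r<d. m + 1 = q * d + r"
    proof (cases "r + 1 < d")
      case True
      then show ?thesis using r by (intro exI[of _ q] exI[of _ "r + 1"]) (simp add: add.assoc)
    next
      case False
      then have "d = r + 1" using r(1) mnat_Suc_leI[OF r(1)] by order
      then have "m + 1 = (q + 1) * d + 0" using r by (simp add: algebra_simps)
      then show ?thesis using d by blast
    qed
  qed
  then show ?thesis by blast
qed

lemma division_unique:
  fixes q q' d r r' :: mnat
  assumes "q * d + r = q' * d + r'" "r < d" "r' < d"
  shows "q = q' \<and> r = r'"
proof -
  have *: "q \<le> q'" if "q * d + r = q' * d + r'" "r' < d" for q q' r r' :: mnat
  proof (rule ccontr)
    assume "\<not> q \<le> q'"
    then have "q' + 1 \<le> q" by (intro mnat_Suc_leI) simp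
    then have "(q' + 1) * d \<le> q * d" by (rule mult_right_mono) simp
    then have "q' * d + d \<le> q * d" by (simp add: distrib_right)
    also have "\<dots> \<le> q' * d + r'" unfolding that(1)[symmetric] by simp
    finally show False using that(2) by simp
  qed
  have "q = q'" using *[of q r q' r'] *[of q' r' q r] assms by simp
  then show ?thesis using assms(1) by simp
qed

section \<open>Binary digits as parities of quotients\<close>

definition modd :: "mnat \<Rightarrow> bool" where
  "modd c \<longleftrightarrow> (\<exists>q. c = 2 * q + 1)"

lemma double_not_odd: "2 * a \<noteq> 2 * b + (1 :: mnat)"
proof
  assume eq: "2 * a = 2 * b + 1"
  show False
  proof (cases "a \<le> b")
    case True
    then show False using eq by (simp add: to_mint del: toz_le toz_eq)
  next
    case False
    then have "b < a" by simp
    then show False using eq by (simp add: to_mint del: toz_le toz_eq)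
  qed
qed

lemma mnat_less_two: "r < 2 \<longleftrightarrow> r = 0 \<or> r = (1 :: mnat)"
  using basic_arithmetic(8)[of r 1] basic_arithmetic(8)[of r 0] by simp

lemma even_or_modd: "(\<exists>q. c = 2 * q) \<or> modd c"
proof -
  obtain q r where "c = q * 2 + r" "r < 2" using division[of 2 c] by auto
  then show ?thesis unfolding mnat_less_two modd_def by (auto simp: mult.commute)
qed

lemma not_modd_double [simp]: "\<not> modd (2 * a)"
  using double_not_odd by (auto simp: modd_def)

lemma modd_add_double: "modd (2 * a + c) \<longleftrightarrow> modd c"
proof (cases "modd c")
  case True
  then obtain q where "c = 2 * q + 1" unfolding modd_def by blast
  then have "2 * a + c = 2 * (a + q) + 1" by (simp add: algebra_simps)
  then show ?thesis using True unfolding modd_def by blast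
next
  case False
  then obtain q where "c = 2 * q" using even_or_modd by blast
  then have "2 * a + c = 2 * (a + q)" by (simp add: algebra_simps)
  then show ?thesis using False not_modd_double[of "a + q"] by metis
qed

text \<open>The condition of \<open>is_exponent\<close> with a bound on the quotient, so that it is
  definable; \<open>Bit_unbounded\<close> restores the original form.\<close>

definition Bit :: "mnat \<Rightarrow> mnat \<Rightarrow> bool" where
  "Bit e m \<longleftrightarrow> (\<exists>q\<le>m. \<exists>r<pw e. m = (2 * q + 1) * pw e + r)"

lemma sig_Bit [sigs]: "dfun k t \<Longrightarrow> dfun k u \<Longrightarrow> sig k (\<lambda>e. Bit (t e) (u e))"
  by (rule sig_rel2[of Bit]) (unfold rel2_def Bit_def, (intro sigs; simp))

lemma Bit_unbounded: "Bit e m \<longleftrightarrow> (\<exists>q r. r < pw e \<and> m = (2 * q + 1) * pw e + r)"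
proof -
  have "q \<le> (2 * q + 1) * pw e + r" for q r
  proof -
    have "q \<le> 2 * q + 1" by (simp add: mult_2 add.assoc)
    also have "\<dots> \<le> (2 * q + 1) * pw e" using mult_left_mono[OF one_le_pw[of e], of "2 * q + 1"] by simp
    also have "\<dots> \<le> (2 * q + 1) * pw e + r" by simp
    finally show ?thesis .
  qed
  then show ?thesis unfolding Bit_def by blast
qed

lemma Bit_iff: "r < pw e \<Longrightarrow> Bit e (c * pw e + r) \<longleftrightarrow> modd c"
proof -
  assume r: "r < pw e"
  have "c = 2 * q + 1" if "r' < pw e" "c * pw e + r = (2 * q + 1) * pw e + r'" for q r'
    using division_unique[OF that(2) r that(1)] by simp
  then show ?thesis unfolding Bit_unbounded modd_def using r by blast
qed

lemma Bit_imp_le: "Bit e m \<Longrightarrow> pw e \<le> m"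
proof -
  assume "Bit e m"
  then obtain q r where "m = pw e + (2 * q * pw e + r)"
    unfolding Bit_unbounded by (auto simp: algebra_simps)
  then show ?thesis by simp
qed

lemma not_Bit_if_less: "m < pw k \<Longrightarrow> k \<le> e \<Longrightarrow> \<not> Bit e m"
proof
  assume "m < pw k" "k \<le> e" "Bit e m"
  then have "pw k \<le> pw e" "pw e \<le> m" by (auto intro: pw_mono Bit_imp_le)
  then show False using \<open>m < pw k\<close> by order
qed

lemma Bit_less: "Bit e m \<Longrightarrow> e < m"
  using Bit_imp_le[of e m] less_pw[of e] by auto

lemma not_Bit_zero [simp]: "\<not> Bit e 0"
  using Bit_less[of e 0] by auto

text \<open>A multiple of \<open>pw k\<close> is an even multiple of \<open>pw e\<close> and leaves
  the parity of the quotient alone.\<close>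

lemma Bit_low: "e < k \<Longrightarrow> Bit e (q * pw k + r) \<longleftrightarrow> Bit e r"
proof -
  assume "e < k"
  then obtain s where s: "pw k = 2 * pw e * s" using pw_less_double by blast
  obtain c r' where r: "r = c * pw e + r'" "r' < pw e" using division[of "pw e" r] by auto
  have "q * pw k + r = (2 * (q * s) + c) * pw e + r'" unfolding r s by (simp add: algebra_simps)
  then show ?thesis using Bit_iff[OF r(2)] by (simp add: r(1) modd_add_double)
qed

text \<open>Division of the whole number by \<open>pw (k + i)\<close> and of \<open>q\<close> by
  \<open>pw i\<close> give the same quotient.\<close>

lemma Bit_high: "r < pw k \<Longrightarrow> Bit (k + i) (q * pw k + r) \<longleftrightarrow> Bit i q"
proof -
  assume r: "r < pw k"
  obtain c r' where q: "q = c * pw i + r'" "r' < pw i" using division[of "pw i" q] by auto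
  have "r' * pw k + r < r' * pw k + pw k" using r by simp
  also have "\<dots> = (r' + 1) * pw k" by (simp add: algebra_simps)
  also have "\<dots> \<le> pw i * pw k" using q(2) by (intro mult_right_mono) (auto simp: mnat_less_iff)
  finally have less: "r' * pw k + r < pw (k + i)" by (simp add: pw_add mult.commute)
  have "q * pw k + r = c * pw (k + i) + (r' * pw k + r)" unfolding q by (simp add: algebra_simps pw_add)
  then show ?thesis using Bit_iff[OF less] Bit_iff[OF q(2)] by (simp add: q(1))
qed

lemma top_bit: "m \<noteq> 0 \<Longrightarrow> \<exists>u r. m = pw u + r \<and> r < pw u"
proof -
  assume "m \<noteq> 0"
  have "rel1 (\<lambda>u. m < pw u)" unfolding rel1_def by (intro sigs; simp)
  then obtain v where v: "m < pw v" "\<And>l. l < v \<Longrightarrow> \<not> m < pw l"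
    using rel1_least[of "\<lambda>u. m < pw u" m] less_pw by blast
  have "v \<noteq> 0" using v(1) \<open>m \<noteq> 0\<close> basic_arithmetic(8)[of m 0] by auto
  then obtain u where u: "v = u + 1" using mnat_cases by metis
  then have "pw u \<le> m" using v(2)[of u] by (simp add: mnat_less_succ)
  then obtain r where r: "m = pw u + r" by (metis le_iff_add)
  then have "r < pw u" using v(1) u by (simp add: mult_2)
  then show ?thesis using r by blast
qed

lemma Bit_top: "r < pw u \<Longrightarrow> Bit u (pw u + r)"
  using Bit_iff[of r u 1] by (simp add: modd_def exI[of _ 0])

lemma Bits_less_imp: "(\<And>i. Bit i x \<Longrightarrow> i < k) \<Longrightarrow> x < pw k"
proof (cases "x = 0")
  case False
  assume bits: "\<And>i. Bit i x \<Longrightarrow> i < k"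
  obtain u r where u: "x = pw u + r" "r < pw u" using top_bit[OF False] by blast
  then have "u < k" using Bit_top bits by blast
  have "x < pw (u + 1)" using u by (simp add: mult_2)
  also have "\<dots> \<le> pw k" using \<open>u < k\<close> by (intro pw_mono mnat_Suc_leI)
  finally show ?thesis .
qed simp

lemma Bits_ge_imp: "(\<And>i. Bit i y \<Longrightarrow> k \<le> i) \<Longrightarrow> \<exists>q. y = q * pw k"
proof -
  assume bits: "\<And>i. Bit i y \<Longrightarrow> k \<le> i"
  obtain q r where y: "y = q * pw k + r" "r < pw k" using division[of "pw k" y] by auto
  have "r = 0"
  proof (rule ccontr)
    assume "r \<noteq> 0"
    then obtain u r' where u: "r = pw u + r'" "r' < pw u" using top_bit by blast
    have "pw u \<le> r" using u by simp
    then have "pw u < pw k" using y(2) by order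
    then have "u < k" by simp
    then have "Bit u y" using Bit_low[of u k q r] Bit_top[OF u(2)] y u by simp
    then show False using bits \<open>u < k\<close> by fastforce
  qed
  then show ?thesis using y by auto
qed

text \<open>No carries occur: for the least exponent \<open>l\<close> of \<open>y\<close>,
  \<open>x\<close> is below \<open>pw l\<close> and \<open>y\<close> is a multiple of it.\<close>

lemma Bit_add_apart:
  assumes "\<And>i j. Bit i x \<Longrightarrow> Bit j y \<Longrightarrow> i < j"
  shows "Bit e (x + y) \<longleftrightarrow> Bit e x \<or> Bit e y"
proof (cases "y = 0")
  case False
  then obtain u where u: "Bit u y" using top_bit Bit_top by blast
  have "rel1 (\<lambda>l. Bit l y)" unfolding rel1_def by (intro sigs; simp)
  then obtain l where l: "Bit l y" "\<And>i. i < l \<Longrightarrow> \<not> Bit i y"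
    using rel1_least[of "\<lambda>l. Bit l y" u] u by blast
  have x: "x < pw l" by (rule Bits_less_imp) (use assms l in blast)
  have "l \<le> i" if "Bit i y" for i using l(2)[of i] that by (cases "i < l") auto
  from Bits_ge_imp[OF this] obtain q where q: "y = q * pw l" by blast
  show ?thesis
  proof (cases "e < l")
    case True
    then show ?thesis using Bit_low[of e l q x] l(2) by (simp add: q add.commute)
  next
    case False
    then have "l \<le> e" by (simp add: not_less)
    then obtain i where i: "e = l + i" unfolding le_iff_add by blast
    have "\<not> Bit e x" using x False by (intro not_Bit_if_less) (simp_all add: not_less)
    then show ?thesis using Bit_high[OF x, of i q] Bit_high[of 0 l i q] by (simp add: q i add.commute)
  qed
qed simp

lemma Bit_add_top: "r < pw u \<Longrightarrow> Bit e (pw u + r) \<longleftrightarrow> e = u \<or> Bit e r"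
proof -
  assume r: "r < pw u"
  show ?thesis
  proof (cases "e < u")
    case True
    then show ?thesis using Bit_low[of e u 1 r] by auto
  next
    case False
    have nr: "\<not> Bit e r" using r False by (intro not_Bit_if_less) (simp_all add: not_less)
    show ?thesis
    proof (cases "e = u")
      case False
      then have "u < e" using \<open>\<not> e < u\<close> by simp
      moreover have "pw u + r < pw (u + 1)" using r by (simp add: mult_2)
      ultimately have "\<not> Bit e (pw u + r)" using not_Bit_if_less mnat_Suc_leI by blast
      then show ?thesis using nr False by blast
    qed (use Bit_top[OF r] in simp)
  qed
qed

lemma Bit_pw [simp]: "Bit e (pw u) \<longleftrightarrow> e = u"
  using Bit_add_top[of 0 u e] by simp

text \<open>Strip the common top exponent and compare the rest. All quantifiers are bounded by the
  fixed \<open>x + y\<close> to keep the induction predicate definable.\<close>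

lemma Bit_ext:
  assumes "\<And>e. Bit e x \<longleftrightarrow> Bit e y"
  shows "x = y"
proof -
  let ?B = "x + y"
  have "\<forall>x\<le>N. \<forall>y\<le>?B. (\<forall>e\<le>?B. Bit e x \<longleftrightarrow> Bit e y) \<longrightarrow> N \<le> ?B \<longrightarrow> x = y" for N
  proof (rule rel1_induct[where P = "\<lambda>N. \<forall>x\<le>N. \<forall>y\<le>?B. (\<forall>e\<le>?B. Bit e x \<longleftrightarrow> Bit e y) \<longrightarrow> N \<le> ?B \<longrightarrow> x = y"])
    show "rel1 (\<lambda>N. \<forall>x\<le>N. \<forall>y\<le>?B. (\<forall>e\<le>?B. Bit e x \<longleftrightarrow> Bit e y) \<longrightarrow> N \<le> ?B \<longrightarrow> x = y)"
      unfolding rel1_def by (intro sigs; simp)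
    have zero: "y = 0" if "\<forall>e\<le>?B. \<not> Bit e y" "y \<le> ?B" for y
    proof (rule ccontr)
      assume "y \<noteq> 0"
      then obtain u where "Bit u y" using top_bit Bit_top by blast
      moreover from this have "u \<le> ?B" using Bit_less that(2) by fastforce
      ultimately show False using that(1) by blast
    qed
    show "\<forall>x\<le>0. \<forall>y\<le>?B. (\<forall>e\<le>?B. Bit e x \<longleftrightarrow> Bit e y) \<longrightarrow> 0 \<le> ?B \<longrightarrow> x = y"
      using zero by auto
    fix N assume IH: "\<forall>x\<le>N. \<forall>y\<le>?B. (\<forall>e\<le>?B. Bit e x \<longleftrightarrow> Bit e y) \<longrightarrow> N \<le> ?B \<longrightarrow> x = y"
    show "\<forall>x\<le>N + 1. \<forall>y\<le>?B. (\<forall>e\<le>?B. Bit e x \<longleftrightarrow> Bit e y) \<longrightarrow> N + 1 \<le> ?B \<longrightarrow> x = y"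
    proof (intro allI impI)
      fix x' y' assume x': "x' \<le> N + 1" and y': "y' \<le> ?B" and N: "N + 1 \<le> ?B"
        and eq: "\<forall>e\<le>?B. Bit e x' \<longleftrightarrow> Bit e y'"
      have "x' \<le> ?B" using x' N by order
      show "x' = y'"
      proof (cases "x' = 0")
        case True
        then show ?thesis using zero[of y'] y' eq by simp
      next
        case False
        obtain u r where u: "x' = pw u + r" "r < pw u" using top_bit[OF False] by blast
        have "u \<le> ?B" using Bit_less[of u x'] Bit_top[OF u(2)] u(1) \<open>x' \<le> ?B\<close> by fastforce
        then have Bu: "Bit u y'" using eq Bit_top[OF u(2)] u(1) by blast
        then have "y' \<noteq> 0" by auto
        then obtain v s where v: "y' = pw v + s" "s < pw v" using top_bit by blast
        have "v \<le> ?B" using Bit_less[of v y'] Bit_top[OF v(2)] v(1) y' by fastforce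
        then have Bv: "Bit v x'" using eq Bit_top[OF v(2)] v(1) by blast
        have "v \<le> u"
          using Bv Bit_add_top[OF u(2), of v] u(1) not_Bit_if_less[OF u(2), of v] by fastforce
        moreover have "u \<le> v"
          using Bu Bit_add_top[OF v(2), of u] v(1) not_Bit_if_less[OF v(2), of u] by fastforce
        ultimately have uv: "u = v" by simp
        have "\<forall>e\<le>?B. Bit e r \<longleftrightarrow> Bit e s"
        proof (intro allI impI)
          fix e assume "e \<le> ?B"
          have "\<not> Bit u r" "\<not> Bit u s" using not_Bit_if_less[OF u(2)] not_Bit_if_less[OF v(2)] uv by auto
          then show "Bit e r \<longleftrightarrow> Bit e s"
            using eq \<open>e \<le> ?B\<close> Bit_add_top[OF u(2), of e] Bit_add_top[OF v(2), of e] u(1) v(1) uv by metis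
        qed
        moreover have "r < x'" "s \<le> y'" using u v by simp_all
        then have "r < N + 1" "s \<le> ?B" using x' y' by order+
        then have "r \<le> N" "s \<le> ?B" by (simp_all only: mnat_less_succ)
        moreover have "N \<le> N + 1" by simp
        then have "N \<le> ?B" using N by order
        ultimately have "r = s" using IH by blast
        then show ?thesis using u v uv by simp
      qed
    qed
  qed
  from this[of x] show ?thesis using assms le_iff_add[of x "x + y"] by (simp add: add.commute)
qed

definition is_top :: "mnat \<Rightarrow> mnat \<Rightarrow> bool" where
  "is_top u m \<longleftrightarrow> Bit u m \<and> (\<forall>i\<le>m. Bit i m \<longrightarrow> i \<le> u)"

definition is_bottom :: "mnat \<Rightarrow> mnat \<Rightarrow> bool" where
  "is_bottom l m \<longleftrightarrow> Bit l m \<and> (\<forall>i\<le>m. Bit i m \<longrightarrow> l \<le> i)"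

lemma sig_is_top [sigs]: "dfun k t \<Longrightarrow> dfun k u \<Longrightarrow> sig k (\<lambda>e. is_top (t e) (u e))"
  by (rule sig_rel2[of is_top]) (unfold rel2_def is_top_def, (intro sigs; simp))

lemma sig_is_bottom [sigs]: "dfun k t \<Longrightarrow> dfun k u \<Longrightarrow> sig k (\<lambda>e. is_bottom (t e) (u e))"
  by (rule sig_rel2[of is_bottom]) (unfold rel2_def is_bottom_def, (intro sigs; simp))

lemma is_top_iff: "is_top u m \<longleftrightarrow> Bit u m \<and> (\<forall>i. Bit i m \<longrightarrow> i \<le> u)"
  unfolding is_top_def using Bit_less less_imp_le by blast

lemma is_bottom_iff: "is_bottom l m \<longleftrightarrow> Bit l m \<and> (\<forall>i. Bit i m \<longrightarrow> l \<le> i)"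
  unfolding is_bottom_def using Bit_less less_imp_le by blast

lemma is_top_exists: "m \<noteq> 0 \<Longrightarrow> \<exists>u. is_top u m"
proof -
  assume "m \<noteq> 0"
  then obtain u r where u: "m = pw u + r" "r < pw u" using top_bit by blast
  have "i \<le> u" if "Bit i r" for i
    using that not_Bit_if_less[OF u(2), of i] by fastforce
  then have "is_top u m" unfolding is_top_iff using u Bit_add_top[OF u(2)] by auto
  then show ?thesis ..
qed

lemma is_bottom_exists: "m \<noteq> 0 \<Longrightarrow> \<exists>l. is_bottom l m"
proof -
  assume "m \<noteq> 0"
  then obtain u where u: "Bit u m" using top_bit Bit_top by blast
  have "rel1 (\<lambda>l. Bit l m)" unfolding rel1_def by (intro sigs; simp)
  then obtain l where "Bit l m" "\<And>i. i < l \<Longrightarrow> \<not> Bit i m"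
    using rel1_least[of "\<lambda>l. Bit l m" u] u by blast
  then show ?thesis unfolding is_bottom_iff using not_less by blast
qed

lemma is_top_unique: "is_top u m \<Longrightarrow> is_top v m \<Longrightarrow> u = v"
  unfolding is_top_iff by (simp add: order_antisym)

lemma is_bottom_unique: "is_bottom u m \<Longrightarrow> is_bottom v m \<Longrightarrow> u = v"
  unfolding is_bottom_iff by (simp add: order_antisym)

lemma is_top_less: "is_top u m \<Longrightarrow> m < pw (u + 1)"
  unfolding is_top_iff by (intro Bits_less_imp) (auto simp: mnat_less_succ)


section \<open>Meaning of the three principles in the model\<close>

lemma val_pair [simp]: "val e (pair a b) = mpair (val e a) (val e b)"
  by (simp add: pair_def mpair_def)

lemma not_Ball: "\<not> (\<forall>x\<in>A. P x) \<longleftrightarrow> (\<exists>x\<in>A. \<not> P x)"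
  by blast

text \<open>With the rules for negated quantifiers, undoes the coding of the other connectives by
  implication and falsity.\<close>

lemma not_conj_not: "\<not> (A \<and> \<not> B) \<longleftrightarrow> (A \<longrightarrow> B)"
  by blast

lemmas semantics = simp_thms not_all not_imp not_ex not_Ball not_conj_not holds_simps val_simps val_up val_pair nat.case One_nat_def
  numeral_2_eq_2 numeral_3_eq_3 add_Suc_right add_0_right

definition fun_on :: "(mnat \<Rightarrow> bool) \<Rightarrow> (mnat \<Rightarrow> bool) \<Rightarrow> mnat set \<Rightarrow> bool" where
  "fun_on D R X \<longleftrightarrow> (\<forall>n\<in>X. \<exists>x y. n = mpair x y \<and> D x \<and> R y) \<and>
     (\<forall>x. D x \<longrightarrow> (\<exists>y. mpair x y \<in> X \<and> (\<forall>z. mpair x z \<in> X \<longrightarrow> z = y)))"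

lemma holds_is_function:
  assumes "\<And>e t. holds e s (D t) \<longleftrightarrow> D' (val e t)" "\<And>e t. holds e s (R t) \<longleftrightarrow> R' (val e t)"
  shows "holds e s (is_function D R F) \<longleftrightarrow> fun_on D' R' (s F)"
  unfolding is_function_def fun_on_def by (simp only: semantics assms; blast)

lemma holds_basic_domains:
  "holds e s (any_number t) \<longleftrightarrow> True"
  "holds e s (positive t) \<longleftrightarrow> 0 < val e t"
  "holds e s (colour t) \<longleftrightarrow> val e t < 2"
  by (simp_all add: any_number_def Defs.positive_def colour_def)

lemma fun_onE:
  assumes "fun_on (\<lambda>_. True) R X" "X \<in> coll"
  obtains f where "rel2 (\<lambda>y x. y = f x)" "\<And>x y. mpair x y \<in> X \<longleftrightarrow> y = f x" "\<And>x. R (f x)"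
proof -
  define f where "f x = (THE y. mpair x y \<in> X)" for x
  have f: "mpair x y \<in> X \<longleftrightarrow> y = f x" for x y
  proof -
    obtain v where v: "mpair x v \<in> X" "\<And>z. mpair x z \<in> X \<Longrightarrow> z = v"
      using assms(1) unfolding fun_on_def by blast
    have "f x = v" unfolding f_def by (rule the_equality) (fact v)+
    then show ?thesis using v(1) v(2)[of y] by metis
  qed
  have "rel2 (\<lambda>y x. y = f x)"
    unfolding f[symmetric] rel2_def by (intro sigs assms; simp)
  moreover have "R (f x)" for x
  proof -
    have "mpair x (f x) \<in> X" using f by blast
    then obtain a b where "mpair x (f x) = mpair a b" "R b" using assms(1) unfolding fun_on_def by blast
    then show ?thesis by auto
  qed
  ultimately show ?thesis using that f by metis
qed

lemma graph_in_coll: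
  assumes "rel2 (\<lambda>y x. y = f x)"
  shows "{n. \<exists>x. n = mpair x (f x)} \<in> coll"
proof -
  have "rel1 (\<lambda>n. \<exists>x\<le>n. n = mpair x (f x))"
    unfolding rel1_def by (intro sigs dfun_compose1[OF assms]; simp)
  moreover have "(\<exists>x\<le>n. n = mpair x (f x)) \<longleftrightarrow> (\<exists>x. n = mpair x (f x))" for n
    using le_mpair(1) by auto
  ultimately show ?thesis by (simp add: rel1_iff_coll)
qed

lemma fun_on_graph: "(\<And>x. R (f x)) \<Longrightarrow> fun_on (\<lambda>_. True) R {n. \<exists>x. n = mpair x (f x)}"
  by (auto simp: fun_on_def)

text \<open>A set that satisfies the recursion equations is the graph of \<open>pw\<close> by
  uniqueness, and the graph of \<open>pw\<close> does exist in the model.\<close>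

lemma holds_pow2 [simp]: "holds e s (pow2 a b) \<longleftrightarrow> val e b = pw (val e a)"
proof -
  have sem: "holds e s (pow2 a b) \<longleftrightarrow> (\<exists>X\<in>coll. fun_on (\<lambda>_. True) (\<lambda>_. True) X \<and> mpair 0 1 \<in> X \<and>
      (\<forall>x y. mpair x y \<in> X \<longrightarrow> mpair (x + 1) (2 * y) \<in> X) \<and> mpair (val e a) (val e b) \<in> X)"
    unfolding pow2_def
    by (simp only: semantics holds_is_function[OF holds_basic_domains(1,1)] one_add_one; blast)
  show ?thesis
  proof
    assume "holds e s (pow2 a b)"
    then obtain X where X: "X \<in> coll" "fun_on (\<lambda>_. True) (\<lambda>_. True) X" "mpair 0 1 \<in> X"
      "\<forall>x y. mpair x y \<in> X \<longrightarrow> mpair (x + 1) (2 * y) \<in> X" "mpair (val e a) (val e b) \<in> X"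
      unfolding sem by blast
    obtain f where f: "rel2 (\<lambda>y x. y = f x)" "\<And>x y. mpair x y \<in> X \<longleftrightarrow> y = f x"
      using fun_onE[OF X(2,1)] by metis
    have "f = pw" by (rule pw_unique) (use X(3,4) f in auto)
    then show "val e b = pw (val e a)" using X(5) f(2) by simp
  next
    assume "val e b = pw (val e a)"
    then show "holds e s (pow2 a b)" unfolding sem
      by (intro bexI[of _ "{n. \<exists>x. n = mpair x (pw x)}"])
        (use pw in \<open>auto intro!: graph_in_coll fun_on_graph\<close>)
  qed
qed

lemma holds_is_exponent [simp]: "holds e s (is_exponent a b) \<longleftrightarrow> Bit (val e a) (val e b)"
proof -
  have "holds e s (is_exponent a b) \<longleftrightarrow>
      (\<exists>p q r. p = pw (val e a) \<and> r < p \<and> val e b = (2 * q + 1) * p + r)"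
    unfolding is_exponent_def Let_def by (simp only: semantics holds_pow2 one_add_one; blast)
  then show ?thesis unfolding Bit_unbounded by blast
qed

lemma holds_is_lambda [simp]: "holds e s (is_lambda m l) \<longleftrightarrow> is_bottom (val e l) (val e m)"
  unfolding is_lambda_def is_bottom_iff Le_def less_eq_mnat_def
  by (simp only: semantics holds_is_exponent; blast)

lemma holds_is_mu [simp]: "holds e s (is_mu m u) \<longleftrightarrow> is_top (val e u) (val e m)"
  unfolding is_mu_def is_top_iff Le_def less_eq_mnat_def
  by (simp only: semantics holds_is_exponent; blast)

text \<open>Vacuously true if \<open>m\<close> or \<open>n\<close> is 0, which has no
  exponents.\<close>

definition before :: "mnat \<Rightarrow> mnat \<Rightarrow> bool" where
  "before m n \<longleftrightarrow> (\<forall>u l. is_top u m \<longrightarrow> is_bottom l n \<longrightarrow> u < l)"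

lemma holds_mu_less_lambda [simp]:
  "holds e s (mu_less_lambda m n) \<longleftrightarrow> before (val e m) (val e n)"
  unfolding mu_less_lambda_def before_def by (simp only: semantics holds_is_mu holds_is_lambda; blast)

definition unbounded :: "mnat set \<Rightarrow> bool" where
  "unbounded X \<longleftrightarrow> (\<forall>n. \<exists>x. n < x \<and> x \<in> X)"

lemma holds_infinite_set [simp]: "holds e s (infinite_set X) \<longleftrightarrow> unbounded (s X)"
  unfolding infinite_set_def unbounded_def by (simp only: semantics; blast)

lemma holds_positive_set [simp]: "holds e s (positive_set X) \<longleftrightarrow> (\<forall>x \<in> s X. 0 < x)"
  unfolding positive_set_def by (simp only: semantics holds_basic_domains; blast)

definition apart_set :: "mnat set \<Rightarrow> bool" where
  "apart_set X \<longleftrightarrow> (\<forall>x\<in>X. \<forall>y\<in>X. x < y \<longrightarrow> before x y)"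

lemma holds_apart [simp]: "holds e s (apart X) \<longleftrightarrow> apart_set (s X)"
  unfolding apart_def apart_set_def by (simp only: semantics holds_mu_less_lambda; blast)

lemma holds_distinct3 [simp]:
  "holds e s (distinct3 x y z) \<longleftrightarrow> val e x \<noteq> val e y \<and> val e x \<noteq> val e z \<and> val e y \<noteq> val e z"
  by (auto simp: distinct3_def)

definition increasing_triple :: "mnat \<Rightarrow> bool" where
  "increasing_triple t \<longleftrightarrow> (\<exists>x y z. 0 < x \<and> x < y \<and> y < z \<and> t = mpair (mpair x y) z)"

lemma holds_positive_3subset: "holds e s (positive_3subset t) \<longleftrightarrow> increasing_triple (val e t)"
  unfolding positive_3subset_def Let_def increasing_triple_def triple_def Defs.positive_def
  by (simp only: semantics; blast)

definition block_code :: "mnat \<Rightarrow> bool" where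
  "block_code s \<longleftrightarrow> (\<exists>e. Bit e s) \<and> (\<forall>e. Bit e s \<longrightarrow> 0 < e)"

lemma holds_nonempty_positive_code:
  "holds e s (nonempty_positive_code t) \<longleftrightarrow> block_code (val e t)"
  unfolding nonempty_positive_code_def block_code_def Defs.positive_def
  by (simp only: semantics holds_is_exponent; blast)

lemma holds_is_union3 [simp]:
  "holds e s (is_union3 u r t v) \<longleftrightarrow>
    (\<forall>i. Bit i (val e u) \<longleftrightarrow> Bit i (val e r) \<or> Bit i (val e t) \<or> Bit i (val e v))"
  unfolding is_union3_def by (simp only: semantics holds_is_exponent; blast)

lemma holds_RT32:
  "holds e s RT32 \<longleftrightarrow> (\<forall>F\<in>coll. fun_on increasing_triple (\<lambda>c. c < 2) F \<longrightarrow>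
     (\<exists>H\<in>coll. (\<forall>x\<in>H. 0 < x) \<and> unbounded H \<and> (\<exists>c<2. \<forall>x y z.
        x \<in> H \<and> y \<in> H \<and> z \<in> H \<and> x < y \<and> y < z \<longrightarrow> mpair (mpair (mpair x y) z) c \<in> F)))"
  unfolding RT32_def Let_def triple_def
  by (simp only: semantics holds_is_function[OF holds_positive_3subset holds_basic_domains(3)]
      holds_basic_domains(3) holds_positive_set holds_infinite_set)

lemma holds_HT32_apart:
  "holds e s HT32_apart \<longleftrightarrow> (\<forall>F\<in>coll. fun_on (\<lambda>m. 0 < m) (\<lambda>c. c < 2) F \<longrightarrow>
     (\<exists>H\<in>coll. (\<forall>x\<in>H. 0 < x) \<and> unbounded H \<and> apart_set H \<and> (\<exists>c<2. \<forall>x y z.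
        x \<in> H \<and> y \<in> H \<and> z \<in> H \<and> x \<noteq> y \<and> x \<noteq> z \<and> y \<noteq> z \<longrightarrow>
        mpair (x + y + z) c \<in> F)))"
  unfolding HT32_apart_def Let_def
  by (simp only: semantics holds_is_function[OF holds_basic_domains(2,3)] holds_distinct3
      holds_basic_domains(3) holds_positive_set holds_infinite_set holds_apart)

lemma holds_block_sequence:
  "holds e s (block_sequence S) \<longleftrightarrow> fun_on (\<lambda>_. True) block_code (s S) \<and>
    (\<forall>i j m n. mpair i m \<in> s S \<and> mpair j n \<in> s S \<and> i < j \<longrightarrow> before m n)"
  unfolding block_sequence_def Let_def
  by (simp only: semantics holds_is_function[OF holds_basic_domains(1) holds_nonempty_positive_code]
      holds_mu_less_lambda)

lemma holds_FUT32:
  "holds e s FUT32 \<longleftrightarrow> (\<forall>F\<in>coll. fun_on (\<lambda>_. True) (\<lambda>c. c < 2) F \<longrightarrow>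
     (\<exists>S\<in>coll. (fun_on (\<lambda>_. True) block_code S \<and>
      (\<forall>i j m n. mpair i m \<in> S \<and> mpair j n \<in> S \<and> i < j \<longrightarrow> before m n)) \<and>
      (\<exists>c<2. \<forall>i j k r t v u. (i \<noteq> j \<and> i \<noteq> k \<and> j \<noteq> k) \<and>
        mpair i r \<in> S \<and> mpair j t \<in> S \<and> mpair k v \<in> S \<and>
        (\<forall>e. Bit e u \<longleftrightarrow> Bit e r \<or> Bit e t \<or> Bit e v) \<longrightarrow> mpair u c \<in> F)))"
  unfolding FUT32_def Let_def
  by (simp only: semantics holds_is_function[OF holds_basic_domains(1,3)] holds_block_sequence
      holds_basic_domains(3) holds_distinct3 holds_is_union3 eval_nat_numeral BitM.simps)

section \<open>The three principles for Boolean colourings\<close>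

definition bool_code :: "bool \<Rightarrow> mnat" where
  "bool_code b = (if b then 1 else 0)"

lemma bool_code_less [simp]: "bool_code b < 2"
  by (simp add: bool_code_def mnat_less_two)

lemma bool_code_eq [simp]: "bool_code b = bool_code b' \<longleftrightarrow> b = b'"
  by (auto simp: bool_code_def)

lemma ex_colour: "(\<exists>c<2. P c) \<longleftrightarrow> (\<exists>b. P (bool_code b))"
proof -
  have "(\<exists>c<2. P c) \<longleftrightarrow> P 0 \<or> P 1" by (auto simp: mnat_less_two)
  also have "\<dots> \<longleftrightarrow> (\<exists>b. P (bool_code b))" unfolding bool_code_def by (metis (full_types))
  finally show ?thesis .
qed

definition colouring_set :: "(mnat \<Rightarrow> bool) \<Rightarrow> (mnat \<Rightarrow> bool) \<Rightarrow> mnat set" where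
  "colouring_set D f = {n. \<exists>x. n = mpair x (bool_code (f x)) \<and> D x}"

lemma colouring_set:
  assumes "rel1 D" "rel1 f"
  shows "colouring_set D f \<in> coll" "fun_on D (\<lambda>c. c < 2) (colouring_set D f)"
    "mpair x (bool_code b) \<in> colouring_set D f \<longleftrightarrow> D x \<and> f x = b"
proof -
  have "rel1 (\<lambda>n. \<exists>x\<le>n. (f x \<and> n = mpair x 1 \<or> \<not> f x \<and> n = mpair x 0) \<and> D x)"
    unfolding rel1_def by (intro sigs sig_rel1[OF assms(1)] sig_rel1[OF assms(2)]; simp)
  moreover have "(\<exists>x\<le>n. (f x \<and> n = mpair x 1 \<or> \<not> f x \<and> n = mpair x 0) \<and> D x) \<longleftrightarrow>
      (\<exists>x. n = mpair x (bool_code (f x)) \<and> D x)" for n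
    unfolding bool_code_def using le_mpair(1) by auto
  ultimately show "colouring_set D f \<in> coll" by (simp add: rel1_iff_coll colouring_set_def)
qed (auto simp: fun_on_def colouring_set_def)

lemma colouring_of_set:
  assumes "fun_on D (\<lambda>c. c < 2) F" "D x"
  shows "mpair x (bool_code b) \<in> F \<longleftrightarrow> (mpair x 1 \<in> F) = b"
proof -
  obtain y where y: "mpair x y \<in> F" "\<And>z. mpair x z \<in> F \<Longrightarrow> z = y"
    using assms unfolding fun_on_def by blast
  have "y = 0 \<or> y = 1" using assms(1) y(1) unfolding fun_on_def by (auto simp: mnat_less_two)
  then show ?thesis using y unfolding bool_code_def by (metis zero_neq_one)
qed

text \<open>The colours are truth values and a colouring is definable on all arguments; graphs and
  their domains are dealt with once, in the translations below.\<close>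

definition RT :: bool where
  "RT \<longleftrightarrow> (\<forall>f. rel3 f \<longrightarrow> (\<exists>H\<in>coll. (\<forall>x\<in>H. 0 < x) \<and> unbounded H \<and>
     (\<exists>b. \<forall>x\<in>H. \<forall>y\<in>H. \<forall>z\<in>H. x < y \<longrightarrow> y < z \<longrightarrow> f x y z = b)))"

definition HT :: bool where
  "HT \<longleftrightarrow> (\<forall>f. rel1 f \<longrightarrow> (\<exists>H\<in>coll. (\<forall>x\<in>H. 0 < x) \<and> unbounded H \<and> apart_set H \<and>
     (\<exists>b. \<forall>x\<in>H. \<forall>y\<in>H. \<forall>z\<in>H. x \<noteq> y \<longrightarrow> x \<noteq> z \<longrightarrow> y \<noteq> z \<longrightarrow> f (x + y + z) = b)))"

definition FUT :: bool where
  "FUT \<longleftrightarrow> (\<forall>f. rel1 f \<longrightarrow> (\<exists>g. rel2 (\<lambda>y i. y = g i) \<and> (\<forall>i. block_code (g i)) \<and>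
     (\<forall>i j. i < j \<longrightarrow> before (g i) (g j)) \<and>
     (\<exists>b. \<forall>i j k u. i \<noteq> j \<longrightarrow> i \<noteq> k \<longrightarrow> j \<noteq> k \<longrightarrow>
        (\<forall>e. Bit e u \<longleftrightarrow> Bit e (g i) \<or> Bit e (g j) \<or> Bit e (g k)) \<longrightarrow> f u = b)))"

lemma holds_HT32_apart_iff: "holds e s HT32_apart \<longleftrightarrow> HT"
proof
  assume L: "holds e s HT32_apart"
  show HT unfolding HT_def
  proof (intro allI impI)
    fix f assume f: "rel1 f"
    have pos: "rel1 (\<lambda>m. 0 < m)" unfolding rel1_def by (intro sigs; simp)
    note F = colouring_set[OF pos f]
    from L[unfolded holds_HT32_apart ex_colour, rule_format, OF F(1,2)]
    obtain H b where H: "H \<in> coll" "\<forall>x\<in>H. 0 < x" "unbounded H" "apart_set H"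
      "\<forall>x y z. x \<in> H \<and> y \<in> H \<and> z \<in> H \<and> x \<noteq> y \<and> x \<noteq> z \<and> y \<noteq> z \<longrightarrow>
        mpair (x + y + z) (bool_code b) \<in> colouring_set (\<lambda>m. 0 < m) f"
      by (elim bexE conjE exE) (rule that, assumption+)
    then show "\<exists>H\<in>coll. (\<forall>x\<in>H. 0 < x) \<and> unbounded H \<and> apart_set H \<and>
      (\<exists>b. \<forall>x\<in>H. \<forall>y\<in>H. \<forall>z\<in>H. x \<noteq> y \<longrightarrow> x \<noteq> z \<longrightarrow> y \<noteq> z \<longrightarrow> f (x + y + z) = b)"
      unfolding F(3) by (intro bexI[of _ H] conjI exI[of _ b]) simp_all
  qed
next
  assume HT
  show "holds e s HT32_apart" unfolding holds_HT32_apart ex_colour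
  proof (intro ballI impI)
    fix F assume F: "F \<in> coll" and fn: "fun_on (\<lambda>m. 0 < m) (\<lambda>c. c < 2) F"
    have "rel1 (\<lambda>m. mpair m 1 \<in> F)" unfolding rel1_def by (intro sigs F; simp)
    from \<open>HT\<close>[unfolded HT_def, rule_format, OF this]
    obtain H b where H: "H \<in> coll" "\<forall>x\<in>H. 0 < x" "unbounded H" "apart_set H"
      "\<forall>x\<in>H. \<forall>y\<in>H. \<forall>z\<in>H. x \<noteq> y \<longrightarrow> x \<noteq> z \<longrightarrow> y \<noteq> z \<longrightarrow> (mpair (x + y + z) 1 \<in> F) = b"
      by (elim bexE conjE exE) (rule that, assumption+)
    have "mpair (x + y + z) (bool_code b) \<in> F" if "x \<in> H" "y \<in> H" "z \<in> H" "x \<noteq> y" "x \<noteq> z" "y \<noteq> z" for x y z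
      using colouring_of_set[OF fn, of "x + y + z" b] H that by (simp add: add_pos_pos)
    then show "\<exists>H\<in>coll. (\<forall>x\<in>H. 0 < x) \<and> unbounded H \<and> apart_set H \<and>
      (\<exists>b. \<forall>x y z. x \<in> H \<and> y \<in> H \<and> z \<in> H \<and> x \<noteq> y \<and> x \<noteq> z \<and> y \<noteq> z \<longrightarrow>
        mpair (x + y + z) (bool_code b) \<in> F)"
      using H by (intro bexI[of _ H] conjI exI[of _ b]) simp_all
  qed
qed

lemma holds_RT32_iff: "holds e s RT32 \<longleftrightarrow> RT"
proof
  assume L: "holds e s RT32"
  show RT unfolding RT_def
  proof (intro allI impI)
    fix f assume f: "rel3 f"
    have bounded: "increasing_triple t \<longleftrightarrow>
        (\<exists>x\<le>t. \<exists>y\<le>t. \<exists>z\<le>t. 0 < x \<and> x < y \<and> y < z \<and> t = mpair (mpair x y) z)" for t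
    proof -
      have "x \<le> mpair (mpair x y) z \<and> y \<le> mpair (mpair x y) z \<and> z \<le> mpair (mpair x y) z" for x y z
        by (meson le_mpair order_trans)
      then show ?thesis unfolding increasing_triple_def by blast
    qed
    have D: "rel1 increasing_triple" unfolding rel1_def bounded by (intro sigs; simp)
    \<comment> \<open>Carries the colouring over to codes of triples; bounded decoding keeps it
      definable.\<close>
    let ?g = "\<lambda>t. \<exists>x\<le>t. \<exists>y\<le>t. \<exists>z\<le>t. t = mpair (mpair x y) z \<and> f x y z"
    have g: "rel1 ?g" unfolding rel1_def by (intro sigs sig_rel3[OF f]; simp)
    have g_iff: "?g (mpair (mpair x y) z) \<longleftrightarrow> f x y z" for x y z
    proof -
      have "x \<le> mpair (mpair x y) z \<and> y \<le> mpair (mpair x y) z \<and> z \<le> mpair (mpair x y) z"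
        by (meson le_mpair order_trans)
      then show ?thesis by auto
    qed
    note F = colouring_set[OF D g]
    from L[unfolded holds_RT32 ex_colour, rule_format, OF F(1,2)]
    obtain H b where H: "H \<in> coll" "\<forall>x\<in>H. 0 < x" "unbounded H"
      "\<forall>x y z. x \<in> H \<and> y \<in> H \<and> z \<in> H \<and> x < y \<and> y < z \<longrightarrow>
        mpair (mpair (mpair x y) z) (bool_code b) \<in> colouring_set increasing_triple ?g"
      by (elim bexE conjE exE) (rule that, assumption+)
    have "f x y z = b" if "x \<in> H" "y \<in> H" "z \<in> H" "x < y" "y < z" for x y z
    proof -
      have "mpair (mpair (mpair x y) z) (bool_code b) \<in> colouring_set increasing_triple ?g"
        using H(4) that by blast
      then show ?thesis unfolding F(3) g_iff by simp
    qed
    then show "\<exists>H\<in>coll. (\<forall>x\<in>H. 0 < x) \<and> unbounded H \<and>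
     (\<exists>b. \<forall>x\<in>H. \<forall>y\<in>H. \<forall>z\<in>H. x < y \<longrightarrow> y < z \<longrightarrow> f x y z = b)"
      using H(1-3) by (intro bexI[of _ H] conjI exI[of _ b]) simp_all
  qed
next
  assume RT
  show "holds e s RT32" unfolding holds_RT32 ex_colour
  proof (intro ballI impI)
    fix F assume F: "F \<in> coll" and fn: "fun_on increasing_triple (\<lambda>c. c < 2) F"
    have "rel3 (\<lambda>x y z. mpair (mpair (mpair x y) z) 1 \<in> F)" unfolding rel3_def by (intro sigs F; simp)
    from \<open>RT\<close>[unfolded RT_def, rule_format, OF this]
    obtain H b where H: "H \<in> coll" "\<forall>x\<in>H. 0 < x" "unbounded H"
      "\<forall>x\<in>H. \<forall>y\<in>H. \<forall>z\<in>H. x < y \<longrightarrow> y < z \<longrightarrow> (mpair (mpair (mpair x y) z) 1 \<in> F) = b"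
      by (elim bexE conjE exE) (rule that, assumption+)
    have "mpair (mpair (mpair x y) z) (bool_code b) \<in> F" if "x \<in> H" "y \<in> H" "z \<in> H" "x < y" "y < z" for x y z
    proof -
      have "increasing_triple (mpair (mpair x y) z)"
        unfolding increasing_triple_def using that H(2) by blast
      then show ?thesis using colouring_of_set[OF fn, of "mpair (mpair x y) z" b] H(4) that by simp
    qed
    then show "\<exists>H\<in>coll. (\<forall>x\<in>H. 0 < x) \<and> unbounded H \<and> (\<exists>b. \<forall>x y z.
        x \<in> H \<and> y \<in> H \<and> z \<in> H \<and> x < y \<and> y < z \<longrightarrow> mpair (mpair (mpair x y) z) (bool_code b) \<in> F)"
      using H(1-3) by (intro bexI[of _ H] conjI exI[of _ b]) simp_all
  qed
qed

lemma holds_FUT32_iff: "holds e s FUT32 \<longleftrightarrow> FUT"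
proof
  assume L: "holds e s FUT32"
  show FUT unfolding FUT_def
  proof (intro allI impI)
    fix f assume f: "rel1 f"
    have univ: "rel1 (\<lambda>_. True)" unfolding rel1_def by (rule sig_True)
    note F = colouring_set[OF univ f]
    from L[unfolded holds_FUT32 ex_colour, rule_format, OF F(1,2)]
    obtain S b where S: "S \<in> coll" "fun_on (\<lambda>_. True) block_code S"
      "\<forall>i j m n. mpair i m \<in> S \<and> mpair j n \<in> S \<and> i < j \<longrightarrow> before m n"
      "\<forall>i j k r t v u. (i \<noteq> j \<and> i \<noteq> k \<and> j \<noteq> k) \<and>
        mpair i r \<in> S \<and> mpair j t \<in> S \<and> mpair k v \<in> S \<and>
        (\<forall>e. Bit e u \<longleftrightarrow> Bit e r \<or> Bit e t \<or> Bit e v) \<longrightarrow>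
        mpair u (bool_code b) \<in> colouring_set (\<lambda>_. True) f"
      by (elim bexE conjE exE) (rule that, assumption+)
    obtain g where g: "rel2 (\<lambda>y i. y = g i)" "\<And>x y. mpair x y \<in> S \<longleftrightarrow> y = g x" "\<And>x. block_code (g x)"
      by (rule fun_onE[OF S(2,1)]) (rule that, assumption+)
    show "\<exists>g. rel2 (\<lambda>y i. y = g i) \<and> (\<forall>i. block_code (g i)) \<and>
     (\<forall>i j. i < j \<longrightarrow> before (g i) (g j)) \<and>
     (\<exists>b. \<forall>i j k u. i \<noteq> j \<longrightarrow> i \<noteq> k \<longrightarrow> j \<noteq> k \<longrightarrow>
        (\<forall>e. Bit e u \<longleftrightarrow> Bit e (g i) \<or> Bit e (g j) \<or> Bit e (g k)) \<longrightarrow> f u = b)"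
    proof (intro exI[of _ g] conjI allI impI exI[of _ b])
      fix i j :: mnat assume "i < j" then show "before (g i) (g j)" using S(3) g(2) by simp
    next
      fix i j k u assume "i \<noteq> j" "i \<noteq> k" "j \<noteq> k"
        and "\<forall>e. Bit e u \<longleftrightarrow> Bit e (g i) \<or> Bit e (g j) \<or> Bit e (g k)"
      then have "mpair u (bool_code b) \<in> colouring_set (\<lambda>_. True) f"
        using S(4)[rule_format, of i j k "g i" "g j" "g k" u] g(2) by simp
      then show "f u = b" unfolding F(3) by simp
    qed (use g in simp_all)
  qed
next
  assume FUT
  show "holds e s FUT32" unfolding holds_FUT32 ex_colour
  proof (intro ballI impI)
    fix F assume F: "F \<in> coll" and fn: "fun_on (\<lambda>_. True) (\<lambda>c. c < 2) F"
    have "rel1 (\<lambda>m. mpair m 1 \<in> F)" unfolding rel1_def by (intro sigs F; simp)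
    from \<open>FUT\<close>[unfolded FUT_def, rule_format, OF this]
    obtain g b where g: "rel2 (\<lambda>y i. y = g i)" "\<forall>i. block_code (g i)"
      "\<forall>i j. i < j \<longrightarrow> before (g i) (g j)"
      "\<forall>i j k u. i \<noteq> j \<longrightarrow> i \<noteq> k \<longrightarrow> j \<noteq> k \<longrightarrow>
        (\<forall>e. Bit e u \<longleftrightarrow> Bit e (g i) \<or> Bit e (g j) \<or> Bit e (g k)) \<longrightarrow> (mpair u 1 \<in> F) = b"
      by (elim conjE exE) (rule that, assumption+)
    let ?S = "{n. \<exists>x. n = mpair x (g x)}"
    have "?S \<in> coll" by (rule graph_in_coll[OF g(1)])
    moreover have "fun_on (\<lambda>_. True) block_code ?S" by (rule fun_on_graph) (use g(2) in blast)
    ultimately show "\<exists>S\<in>coll. (fun_on (\<lambda>_. True) block_code S \<and>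
      (\<forall>i j m n. mpair i m \<in> S \<and> mpair j n \<in> S \<and> i < j \<longrightarrow> before m n)) \<and>
      (\<exists>b. \<forall>i j k r t v u. (i \<noteq> j \<and> i \<noteq> k \<and> j \<noteq> k) \<and>
        mpair i r \<in> S \<and> mpair j t \<in> S \<and> mpair k v \<in> S \<and>
        (\<forall>e. Bit e u \<longleftrightarrow> Bit e r \<or> Bit e t \<or> Bit e v) \<longrightarrow> mpair u (bool_code b) \<in> F)"
    proof (intro bexI[of _ ?S] conjI allI impI exI[of _ b])
      fix i j m n assume "mpair i m \<in> ?S \<and> mpair j n \<in> ?S \<and> i < j"
      then show "before m n" using g(3) by simp
    next
      fix i j k r t v u assume "(i \<noteq> j \<and> i \<noteq> k \<and> j \<noteq> k) \<and>
        mpair i r \<in> ?S \<and> mpair j t \<in> ?S \<and> mpair k v \<in> ?S \<and>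
        (\<forall>e. Bit e u \<longleftrightarrow> Bit e r \<or> Bit e t \<or> Bit e v)"
      then have "(mpair u 1 \<in> F) = b" using g(4)[rule_format, of i j k u] by simp
      then show "mpair u (bool_code b) \<in> F" using colouring_of_set[OF fn, of u b] by simp
    qed
  qed
qed

lemma provable_by_model:
  assumes "HT \<longleftrightarrow> RT" "HT \<longleftrightarrow> FUT"
  shows "(RCA0 \<turnstile> HT32_apart \<^bold>\<longleftrightarrow> RT32) \<and> (RCA0 \<turnstile> HT32_apart \<^bold>\<longleftrightarrow> FUT32)"
proof (rule provable_by_generic_interp)
  have "holds e s (HT32_apart \<^bold>\<longleftrightarrow> RT32)" "holds e s (HT32_apart \<^bold>\<longleftrightarrow> FUT32)" for e s
    using assms by (simp_all add: holds_HT32_apart_iff holds_RT32_iff holds_FUT32_iff)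
  then show "\<not> refutes_equivalence generic_interp"
    unfolding refutes_equivalence_def valid_in_def holds_def by blast
qed


section \<open>Hindman's theorem, finite unions and Ramsey's theorem\<close>

lemma before_iff: "before x y \<longleftrightarrow> (\<forall>i j. Bit i x \<longrightarrow> Bit j y \<longrightarrow> i < j)"
proof
  assume L: "before x y"
  show "\<forall>i j. Bit i x \<longrightarrow> Bit j y \<longrightarrow> i < j"
  proof (intro allI impI)
    fix i j assume ij: "Bit i x" "Bit j y"
    then have "x \<noteq> 0" "y \<noteq> 0" by auto
    then obtain u l where u: "is_top u x" "is_bottom l y" using is_top_exists is_bottom_exists by blast
    then have "i \<le> u" "l \<le> j" "u < l"
      using ij L unfolding is_top_iff is_bottom_iff before_def by blast+
    then show "i < j" by order
  qed
qed (auto simp: before_def is_top_iff is_bottom_iff)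

lemma before_less: "before x y \<Longrightarrow> y \<noteq> 0 \<Longrightarrow> x < y"
proof -
  assume "before x y" "y \<noteq> 0"
  then obtain l where l: "Bit l y" using top_bit Bit_top by blast
  have "x < pw l" by (rule Bits_less_imp) (use \<open>before x y\<close> l before_iff in blast)
  also have "\<dots> \<le> y" using l by (rule Bit_imp_le)
  finally show ?thesis .
qed

text \<open>Ramsey's theorem speaks of sorted triples and Hindman's of distinct elements in any
  order; the two adjacent transpositions bridge the difference.\<close>

lemma symmetric_triple:
  fixes x y z :: "'a :: linorder"
  assumes sorted: "\<And>x y z. x \<in> H \<Longrightarrow> y \<in> H \<Longrightarrow> z \<in> H \<Longrightarrow> x < y \<Longrightarrow> y < z \<Longrightarrow> P x y z"
    and swap: "\<And>x y z. P x y z \<Longrightarrow> P y x z" "\<And>x y z. P x y z \<Longrightarrow> P x z y"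
    and mem: "x \<in> H" "y \<in> H" "z \<in> H" and neq: "x \<noteq> y" "x \<noteq> z" "y \<noteq> z"
  shows "P x y z"
proof -
  consider "x < y" "y < z" | "x < z" "z < y" | "y < x" "x < z" | "y < z" "z < x" | "z < x" "x < y" | "z < y" "y < x"
    using neq by (metis neq_iff)
  then show ?thesis
  proof cases
    case 1
    then show ?thesis using sorted mem by blast
  next
    case 2
    then show ?thesis using sorted[of x z y] mem swap by blast
  next
    case 3
    then show ?thesis using sorted[of y x z] mem swap by blast
  next
    case 4
    then have "P y z x" using sorted mem by blast
    then show ?thesis using swap by blast
  next
    case 5
    then have "P z x y" using sorted mem by blast
    then show ?thesis using swap by blast
  next
    case 6
    then have "P z y x" using sorted mem by blast
    then show ?thesis using swap by blast
  qed
qed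

lemma Bit_add3:
  assumes H: "apart_set H" and mem: "x \<in> H" "y \<in> H" "z \<in> H" "x \<noteq> y" "x \<noteq> z" "y \<noteq> z"
  shows "Bit e (x + y + z) \<longleftrightarrow> Bit e x \<or> Bit e y \<or> Bit e z"
proof (rule symmetric_triple[where P = "\<lambda>x y z. Bit e (x + y + z) \<longleftrightarrow> Bit e x \<or> Bit e y \<or> Bit e z", OF _ _ _ mem])
  fix x y z assume xyz: "x \<in> H" "y \<in> H" "z \<in> H" "x < y" "y < z"
  then have "x < z" by order
  then have b: "before x y" "before y z" "before x z" using H xyz unfolding apart_set_def by blast+
  have 1: "Bit i (x + y) \<longleftrightarrow> Bit i x \<or> Bit i y" for i
    by (rule Bit_add_apart) (use b(1) before_iff in blast)
  have "Bit e (x + y + z) \<longleftrightarrow> Bit e (x + y) \<or> Bit e z"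
    by (rule Bit_add_apart) (use 1 b(2,3) before_iff in blast)
  then show "Bit e (x + y + z) \<longleftrightarrow> Bit e x \<or> Bit e y \<or> Bit e z" using 1 by blast
next
  fix x y z show "Bit e (x + y + z) \<longleftrightarrow> Bit e x \<or> Bit e y \<or> Bit e z \<Longrightarrow>
    Bit e (y + x + z) \<longleftrightarrow> Bit e y \<or> Bit e x \<or> Bit e z" by (simp add: ac_simps; blast)
next
  fix x y z show "Bit e (x + y + z) \<longleftrightarrow> Bit e x \<or> Bit e y \<or> Bit e z \<Longrightarrow>
    Bit e (x + z + y) \<longleftrightarrow> Bit e x \<or> Bit e z \<or> Bit e y" by (simp add: ac_simps; blast)
qed

theorem RT_imp_HT: "RT \<Longrightarrow> HT"
  unfolding HT_def
proof (intro allI impI)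
  fix f assume RT and f: "rel1 f"
  have "rel3 (\<lambda>x y z. f (pw x + pw y + pw z))"
    unfolding rel3_def by (intro sig_rel1[OF f] sigs; simp)
  from \<open>RT\<close>[unfolded RT_def, rule_format, OF this]
  obtain H b where H: "H \<in> coll" "\<forall>x\<in>H. 0 < x" "unbounded H"
    "\<forall>x\<in>H. \<forall>y\<in>H. \<forall>z\<in>H. x < y \<longrightarrow> y < z \<longrightarrow> f (pw x + pw y + pw z) = b"
    by (elim bexE conjE exE) (rule that, assumption+)
  let ?K = "{p. \<exists>x\<le>p. p = pw x \<and> x \<in> H}"
  have K: "p \<in> ?K \<longleftrightarrow> (\<exists>x\<in>H. p = pw x)" for p
    using less_imp_le[OF less_pw] by auto
  have "rel1 (\<lambda>p. \<exists>x\<le>p. p = pw x \<and> x \<in> H)" unfolding rel1_def by (intro sigs H(1); simp)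
  then have "?K \<in> coll" by (simp only: rel1_iff_coll)
  moreover have "\<forall>p\<in>?K. 0 < p" unfolding K by auto
  moreover have "unbounded ?K" unfolding unbounded_def
  proof
    fix n obtain x where "n < x" "x \<in> H" using H(3) unfolding unbounded_def by blast
    then have "n < pw x" "pw x \<in> ?K" using less_pw[of x] unfolding K by auto
    then show "\<exists>x. n < x \<and> x \<in> ?K" by blast
  qed
  moreover have "apart_set ?K" unfolding apart_set_def before_iff
  proof (intro ballI impI allI)
    fix p q i j assume "p \<in> ?K" "q \<in> ?K" "p < q" "Bit i p" "Bit j q"
    then show "i < j" unfolding K by auto
  qed
  moreover have "\<forall>p\<in>?K. \<forall>q\<in>?K. \<forall>r\<in>?K. p \<noteq> q \<longrightarrow> p \<noteq> r \<longrightarrow> q \<noteq> r \<longrightarrow> f (p + q + r) = b"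
  proof (intro ballI impI)
    fix p q r assume that: "p \<in> ?K" "q \<in> ?K" "r \<in> ?K" "p \<noteq> q" "p \<noteq> r" "q \<noteq> r"
    show "f (p + q + r) = b"
    proof (rule symmetric_triple[where P = "\<lambda>p q r. f (p + q + r) = b", OF _ _ _ that])
    fix p q r assume "p \<in> ?K" "q \<in> ?K" "r \<in> ?K" "p < q" "q < r"
    then obtain x y z where "x \<in> H" "y \<in> H" "z \<in> H" "p = pw x" "q = pw y" "r = pw z" unfolding K by blast
    then show "f (p + q + r) = b" using H(4) \<open>p < q\<close> \<open>q < r\<close> by simp
    qed (simp_all add: ac_simps)
  qed
  ultimately show "\<exists>H\<in>coll. (\<forall>x\<in>H. 0 < x) \<and> unbounded H \<and> apart_set H \<and>
     (\<exists>b. \<forall>x\<in>H. \<forall>y\<in>H. \<forall>z\<in>H. x \<noteq> y \<longrightarrow> x \<noteq> z \<longrightarrow> y \<noteq> z \<longrightarrow> f (x + y + z) = b)"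
    by (intro bexI[of _ ?K] conjI exI[of _ b])
qed

text \<open>Iterates the next-element function \<open>h\<close>, which exists by the least number
  principle and increases its argument, as \<open>monotone_recursion\<close> wants.\<close>

lemma enumeration:
  assumes H: "H \<in> coll" "unbounded H"
  shows "\<exists>g. rel2 (\<lambda>y i. y = g i) \<and> (\<forall>i. g i \<in> H) \<and> (\<forall>i j. i < j \<longrightarrow> g i < g j)"
proof -
  define h where "h u = (THE y. y \<in> H \<and> u < y \<and> (\<forall>z<y. u < z \<longrightarrow> z \<notin> H))" for u
  have h: "y = h u \<longleftrightarrow> y \<in> H \<and> u < y \<and> (\<forall>z<y. u < z \<longrightarrow> z \<notin> H)" for y u
  proof -
    have "rel1 (\<lambda>y. y \<in> H \<and> u < y)" unfolding rel1_def by (intro sigs H(1); simp)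
    moreover obtain n where "n \<in> H \<and> u < n" using H(2) unfolding unbounded_def by blast
    ultimately obtain v where v: "v \<in> H \<and> u < v" "\<And>z. z < v \<Longrightarrow> \<not> (z \<in> H \<and> u < z)"
      using rel1_least[of "\<lambda>y. y \<in> H \<and> u < y" n] by metis
    have uniq: "y = v" if "y \<in> H \<and> u < y \<and> (\<forall>z<y. u < z \<longrightarrow> z \<notin> H)" for y
      using that v by (metis neq_iff)
    have "v \<in> H \<and> u < v \<and> (\<forall>z<v. u < z \<longrightarrow> z \<notin> H)" using v by blast
    then have "h u = v" unfolding h_def using uniq by (rule the_equality)
    then show ?thesis using uniq \<open>v \<in> H \<and> u < v \<and> (\<forall>z<v. u < z \<longrightarrow> z \<notin> H)\<close> by blast
  qed
  have hH: "h u \<in> H" and hless: "u < h u" for u using h by blast+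
  have "rel2 (\<lambda>y u. y = h u)" unfolding h rel2_def by (intro sigs H(1); simp)
  then obtain g where g: "rel2 (\<lambda>y i. y = g i)" "g 0 = h 0" "\<And>n. g (n + 1) = h (g n)"
    using monotone_recursion[of h "h 0"] hless less_imp_le by metis
  have gH: "g i \<in> H" for i
  proof (cases i rule: mnat_cases)
    case 1
    then show ?thesis using g(2) hH by simp
  next
    case (2 m)
    then show ?thesis using g(3) hH by simp
  qed
  have "\<forall>i<j. g i < g j" for j
  proof (rule rel1_induct[where P = "\<lambda>j. \<forall>i<j. g i < g j"])
    show "rel1 (\<lambda>j. \<forall>i<j. g i < g j)" unfolding rel1_def by (intro sigs dfun_compose1[OF g(1)]; simp)
    show "\<forall>i<j + 1. g i < g (j + 1)" if IH: "\<forall>i<j. g i < g j" for j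
    proof (intro allI impI)
      fix i assume "i < j + 1"
      then have "g i \<le> g j" using IH by (auto simp: basic_arithmetic(8))
      also have "g j < g (j + 1)" using g(3) hless by simp
      finally show "g i < g (j + 1)" .
    qed
  qed simp
  then show ?thesis using g(1) gH by blast
qed

theorem HT_imp_FUT: "HT \<Longrightarrow> FUT"
  unfolding FUT_def
proof (intro allI impI)
  fix f assume HT and f: "rel1 f"
  from \<open>HT\<close>[unfolded HT_def, rule_format, OF f]
  obtain H b where H: "H \<in> coll" "\<forall>x\<in>H. 0 < x" "unbounded H" "apart_set H"
    "\<forall>x\<in>H. \<forall>y\<in>H. \<forall>z\<in>H. x \<noteq> y \<longrightarrow> x \<noteq> z \<longrightarrow> y \<noteq> z \<longrightarrow> f (x + y + z) = b"
    by (elim bexE conjE exE) (rule that, assumption+)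
  \<comment> \<open>Only elements above \<open>a\<close> are used: by apartness their exponents
    exceed an exponent of \<open>a\<close> and so are positive, as a block of positive numbers
    requires.\<close>
  obtain a where a: "a \<in> H" using H(3) unfolding unbounded_def by blast
  have "rel1 (\<lambda>x. x \<in> H \<and> a < x)" unfolding rel1_def by (intro sigs H(1); simp)
  then have "{x. x \<in> H \<and> a < x} \<in> coll" by (simp only: rel1_iff_coll)
  moreover have "unbounded {x. x \<in> H \<and> a < x}" unfolding unbounded_def
  proof
    fix n obtain x where x: "a + n < x" "x \<in> H" using H(3) unfolding unbounded_def by blast
    have "n \<le> a + n" "a \<le> a + n" by simp_all
    then have "n < x" "a < x" using x(1) by order+
    then show "\<exists>x. n < x \<and> x \<in> {x. x \<in> H \<and> a < x}" using x(2) by blast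
  qed
  ultimately have "\<exists>g. rel2 (\<lambda>y i. y = g i) \<and> (\<forall>i. g i \<in> {x. x \<in> H \<and> a < x}) \<and>
      (\<forall>i j. i < j \<longrightarrow> g i < g j)"
    by (rule enumeration)
  then obtain g where g: "rel2 (\<lambda>y i. y = g i)" "\<forall>i. g i \<in> {x. x \<in> H \<and> a < x}"
    "\<forall>i j. i < j \<longrightarrow> g i < g j"
    by (elim conjE exE) (rule that, assumption+)
  have gH: "g i \<in> H" "a < g i" for i using g(2) by simp_all
  have inc: "g i < g j" if "i < j" for i j using g(3) that by simp
  have neq: "g i \<noteq> g j" if "i \<noteq> j" for i j using that inc[of i j] inc[of j i] by (cases i j rule: linorder_cases) auto
  show "\<exists>g. rel2 (\<lambda>y i. y = g i) \<and> (\<forall>i. block_code (g i)) \<and>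
     (\<forall>i j. i < j \<longrightarrow> before (g i) (g j)) \<and>
     (\<exists>b. \<forall>i j k u. i \<noteq> j \<longrightarrow> i \<noteq> k \<longrightarrow> j \<noteq> k \<longrightarrow>
        (\<forall>e. Bit e u \<longleftrightarrow> Bit e (g i) \<or> Bit e (g j) \<or> Bit e (g k)) \<longrightarrow> f u = b)"
  proof (intro exI[of _ g] conjI allI impI exI[of _ b])
    fix i
    have "0 < a" "0 < g i" using H(2) a gH by simp_all
    then have "a \<noteq> 0" "g i \<noteq> 0" by (simp_all add: mnat_zero_less)
    then obtain c d where c: "Bit c a" "Bit d (g i)"
      using is_top_exists[of a] is_top_exists[of "g i"] unfolding is_top_iff by blast
    have "before a (g i)" using H(4) a gH[of i] unfolding apart_set_def by simp
    then have "0 < e" if "Bit e (g i)" for e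
      using le_less_trans[OF zero_le, of c e] that c(1) unfolding before_iff by blast
    then show "block_code (g i)" unfolding block_code_def using c(2) by blast
  next
    fix i j :: mnat assume "i < j"
    then show "before (g i) (g j)" using H(4) gH inc unfolding apart_set_def by simp
  next
    fix i j k u assume ijk: "i \<noteq> j" "i \<noteq> k" "j \<noteq> k"
      and u: "\<forall>e. Bit e u \<longleftrightarrow> Bit e (g i) \<or> Bit e (g j) \<or> Bit e (g k)"
    \<comment> \<open>Without carries the sum is the code of the union, and a code is determined by
      its exponents.\<close>
    have "u = g i + g j + g k"
    proof (rule Bit_ext)
      fix e show "Bit e u \<longleftrightarrow> Bit e (g i + g j + g k)"
        using u Bit_add3[OF H(4), of "g i" "g j" "g k" e] gH(1) neq ijk by simp
    qed
    then show "f u = b" using H(5) gH(1) neq ijk by simp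
  qed (rule g(1))
qed

theorem FUT_imp_HT: "FUT \<Longrightarrow> HT"
  unfolding HT_def
proof (intro allI impI)
  fix f assume FUT and f: "rel1 f"
  from \<open>FUT\<close>[unfolded FUT_def, rule_format, OF f]
  obtain g b where g: "rel2 (\<lambda>y i. y = g i)" "\<forall>i. block_code (g i)"
      "\<forall>i j. i < j \<longrightarrow> before (g i) (g j)"
      "\<forall>i j k u. i \<noteq> j \<longrightarrow> i \<noteq> k \<longrightarrow> j \<noteq> k \<longrightarrow>
        (\<forall>e. Bit e u \<longleftrightarrow> Bit e (g i) \<or> Bit e (g j) \<or> Bit e (g k)) \<longrightarrow> f u = b"
    by (elim conjE exE) (rule that, assumption+)
  have nz: "g i \<noteq> 0" for i using g(2) unfolding block_code_def by (metis not_Bit_zero)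
  have inc: "g i < g j" if "i < j" for i j using before_less[OF _ nz] g(3) that by blast
  have inc_iff: "i < j" if "g i < g j" for i j using that inc by (metis less_asym neq_iff)
  \<comment> \<open>Bounds the index of an element in the range of \<open>g\<close>, so that the
    range is a set of the model.\<close>
  have le: "i \<le> g i" for i
  proof (rule rel1_induct[where P = "\<lambda>i. i \<le> g i"])
    show "rel1 (\<lambda>i. i \<le> g i)" unfolding rel1_def by (intro sigs dfun_compose1[OF g(1)]; simp)
    show "i + 1 \<le> g (i + 1)" if "i \<le> g i" for i
    proof (rule mnat_Suc_leI)
      have "g i < g (i + 1)" by (rule inc) (simp add: basic_arithmetic(8))
      then show "i < g (i + 1)" using that by order
    qed
  qed simp
  let ?H = "{s. \<exists>i\<le>s. s = g i}"
  have H: "s \<in> ?H \<longleftrightarrow> (\<exists>i. s = g i)" for s using le by auto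
  have "rel1 (\<lambda>s. \<exists>i\<le>s. s = g i)" unfolding rel1_def by (intro sigs dfun_compose1[OF g(1)]; simp)
  then have "?H \<in> coll" by (simp only: rel1_iff_coll)
  moreover have "\<forall>x\<in>?H. 0 < x" unfolding H using nz by (auto simp: mnat_zero_less)
  moreover have "unbounded ?H" unfolding unbounded_def
  proof
    fix n :: mnat
    have "n < n + 1" by (simp add: basic_arithmetic(8))
    also have "\<dots> \<le> g (n + 1)" by (rule le)
    finally show "\<exists>x. n < x \<and> x \<in> ?H" unfolding H by blast
  qed
  moreover have ap: "apart_set ?H" unfolding apart_set_def
  proof (intro ballI impI)
    fix x y assume "x \<in> ?H" "y \<in> ?H" "x < y"
    then obtain i j where "x = g i" "y = g j" unfolding H by blast
    then show "before x y" using inc_iff g(3) \<open>x < y\<close> by blast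
  qed
  moreover have "\<forall>x\<in>?H. \<forall>y\<in>?H. \<forall>z\<in>?H. x \<noteq> y \<longrightarrow> x \<noteq> z \<longrightarrow> y \<noteq> z \<longrightarrow> f (x + y + z) = b"
  proof (intro ballI impI)
    fix x y z assume xyz: "x \<in> ?H" "y \<in> ?H" "z \<in> ?H" "x \<noteq> y" "x \<noteq> z" "y \<noteq> z"
    obtain i j k where ijk: "x = g i" "y = g j" "z = g k" using xyz(1-3) unfolding H by blast
    have "\<forall>e. Bit e (x + y + z) \<longleftrightarrow> Bit e (g i) \<or> Bit e (g j) \<or> Bit e (g k)"
      using Bit_add3[OF ap xyz] ijk by simp
    then show "f (x + y + z) = b" using g(4)[rule_format, of i j k "x + y + z"] ijk xyz(4-6) by blast
  qed
  ultimately show "\<exists>H\<in>coll. (\<forall>x\<in>H. 0 < x) \<and> unbounded H \<and> apart_set H \<and>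
     (\<exists>b. \<forall>x\<in>H. \<forall>y\<in>H. \<forall>z\<in>H. x \<noteq> y \<longrightarrow> x \<noteq> z \<longrightarrow> y \<noteq> z \<longrightarrow> f (x + y + z) = b)"
    by (intro bexI[of _ ?H] conjI exI[of _ b])
qed


section \<open>From Hindman's theorem to arithmetical comprehension\<close>

text \<open>Comprehension for one existential quantifier. As \<open>\<theta>\<close> may have set
  parameters, \<open>sig_ex\<close> can iterate it through the arithmetical hierarchy.\<close>

definition ACA :: bool where
  "ACA \<longleftrightarrow> (\<forall>\<theta>. rel2 \<theta> \<longrightarrow> rel1 (\<lambda>n. \<exists>s. \<theta> n s))"

text \<open>The quotient by \<open>pw n\<close> is even, so the addition stays within the remainder
  modulo \<open>pw (n + 1)\<close> and nothing is carried.\<close>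

lemma Bit_insert:
  assumes "\<not> Bit n m"
  shows "Bit e (m + pw n) \<longleftrightarrow> e = n \<or> Bit e m"
proof -
  obtain c r where m: "m = c * pw n + r" "r < pw n" using division[of "pw n" m] by auto
  have "\<not> modd c" using assms Bit_iff[OF m(2), of c] m(1) by simp
  then obtain d where d: "c = 2 * d" using even_or_modd by blast
  have m1: "m = d * pw (n + 1) + r" and m2: "m + pw n = d * pw (n + 1) + (pw n + r)"
    unfolding pw_Suc by (simp_all add: m d ac_simps)
  have less: "pw n + r < pw (n + 1)" using m(2) by (simp add: mult_2)
  have "r \<le> pw n + r" by simp
  then have less': "r < pw (n + 1)" using less by order
  show ?thesis
  proof (cases "e < n + 1")
    case True
    have "Bit e (m + pw n) \<longleftrightarrow> Bit e (pw n + r)" unfolding m2 by (rule Bit_low[OF True])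
    also have "\<dots> \<longleftrightarrow> e = n \<or> Bit e r" by (rule Bit_add_top[OF m(2)])
    also have "Bit e r \<longleftrightarrow> Bit e m" unfolding m1 by (rule Bit_low[OF True, symmetric])
    finally show ?thesis .
  next
    case False
    then have "n + 1 \<le> e" by order
    then obtain i where i: "e = (n + 1) + i" unfolding le_iff_add by blast
    have "e \<noteq> n" using False by (auto simp: basic_arithmetic(8))
    moreover have "Bit e (m + pw n) \<longleftrightarrow> Bit i d" unfolding m2 i by (rule Bit_high[OF less])
    moreover have "Bit e m \<longleftrightarrow> Bit i d" unfolding m1 i by (rule Bit_high[OF less'])
    ultimately show ?thesis by simp
  qed
qed

text \<open>The bound is read off a maximal binary code of a subset of $\{0,\dots,N\}$ all of whose
  elements have witnesses.\<close>

lemma strong_bounding: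
  assumes \<theta>: "rel2 \<theta>"
  shows "\<exists>T. \<forall>n\<le>N. (\<exists>s. \<theta> n s) \<longrightarrow> (\<exists>s<T. \<theta> n s)"
proof -
  \<comment> \<open>\<open>m\<close> codes a set of numbers up to \<open>N\<close> that all have a
    witness below \<open>T\<close>. This is definable, although the set of all \<open>n\<close> with
    a witness need not exist.\<close>
  define Q where "Q m T \<longleftrightarrow> (\<forall>n\<le>m. Bit n m \<longrightarrow> n \<le> N \<and> (\<exists>s<T. \<theta> n s))" for m T
  have relQ: "rel2 Q" unfolding Q_def rel2_def by (intro sigs sig_rel2[OF \<theta>]; simp)
  have Q: "Q m T \<longleftrightarrow> (\<forall>n. Bit n m \<longrightarrow> n \<le> N \<and> (\<exists>s<T. \<theta> n s))" for m T
    unfolding Q_def using Bit_less less_imp_le by blast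
  have "\<exists>m T. Q m T \<and> (\<forall>m' T'. m < m' \<longrightarrow> \<not> Q m' T')"
  proof (rule ccontr)
    assume "\<not> ?thesis"
    then have next_m: "\<exists>m' T'. m < m' \<and> Q m' T'" if "Q m T" for m T using that by blast
    \<comment> \<open>Without a maximal code, Sigma^0_1 induction would produce codes of any size,
      yet all of them are below \<open>pw (N + 1)\<close>. One \<open>p\<close> bounds the code and
      its stage, as there is room for one witness.\<close>
    have "\<exists>p. \<exists>m\<le>p. \<exists>T\<le>p. k \<le> m \<and> Q m T" for k
    proof (rule Sigma_induct[where Q = "\<lambda>k p. \<exists>m\<le>p. \<exists>T\<le>p. k \<le> m \<and> Q m T"])
      show "rel2 (\<lambda>k p. \<exists>m\<le>p. \<exists>T\<le>p. k \<le> m \<and> Q m T)"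
        unfolding rel2_def by (intro sigs sig_rel2[OF relQ]; simp)
      have "Q 0 0" by (simp add: Q)
      then show "\<exists>p. \<exists>m\<le>p. \<exists>T\<le>p. 0 \<le> m \<and> Q m T" by auto
      fix k p assume "\<exists>m\<le>p. \<exists>T\<le>p. k \<le> m \<and> Q m T"
      then obtain m T where "k \<le> m" "Q m T" by blast
      then obtain m' T' where m': "m < m'" "Q m' T'" using next_m by blast
      have "k < m'" using \<open>k \<le> m\<close> m'(1) by order
      then have "k + 1 \<le> m'" by (rule mnat_Suc_leI)
      moreover have "m' \<le> m' + T'" "T' \<le> m' + T'" by simp_all
      ultimately show "\<exists>p. \<exists>m\<le>p. \<exists>T\<le>p. k + 1 \<le> m \<and> Q m T" using m'(2) by blast
    qed
    then obtain m T where m: "pw (N + 1) \<le> m" "Q m T" by blast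
    have "m < pw (N + 1)" by (rule Bits_less_imp) (use m(2) Q mnat_less_SucI in blast)
    then show False using m(1) by order
  qed
  then obtain m T where mT: "Q m T" and max: "\<And>m' T'. m < m' \<Longrightarrow> \<not> Q m' T'" by blast
  have "\<exists>s<T. \<theta> n s" if n: "n \<le> N" "\<theta> n s" for n s
  proof (rule ccontr)
    assume no: "\<not> (\<exists>s<T. \<theta> n s)"
    then have "\<not> Bit n m" using mT Q by blast
    note ins = Bit_insert[OF this]
    have "T \<le> T + s + 1" by (simp add: add.assoc)
    have "s \<le> T + s" by simp
    then have "s < T + s + 1" by (rule mnat_less_SucI)
    \<comment> \<open>Inserting the missing \<open>n\<close> gives a larger code, with the stage
      raised past the witness of \<open>n\<close>.\<close>
    have "Q (m + pw n) (T + s + 1)" unfolding Q ins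
    proof (intro allI impI)
      fix e assume "e = n \<or> Bit e m"
      then show "e \<le> N \<and> (\<exists>s'<T + s + 1. \<theta> e s')"
      proof
        assume "e = n"
        then show ?thesis using n \<open>s < T + s + 1\<close> by blast
      next
        assume "Bit e m"
        then obtain s' where "e \<le> N" "s' < T" "\<theta> e s'" using mT Q by blast
        moreover from this have "s' < T + s + 1" using \<open>T \<le> T + s + 1\<close> by order
        ultimately show ?thesis by blast
      qed
    qed
    moreover have "m < m + pw n" by simp
    ultimately show False using max by blast
  qed
  then show ?thesis by blast
qed

text \<open>An \<open>x\<close> above \<open>pw T\<close> has \<mu>(x) at least \<open>T\<close>,
  and apartness passes this on to \<lambda>(z) for every later \<open>z\<close>.\<close>

lemma far_element:
  assumes H: "\<forall>x\<in>H. 0 < x" "unbounded H" "apart_set H"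
  shows "\<exists>z\<in>H. w < z \<and> (\<forall>l. is_bottom l z \<longrightarrow> T \<le> l)"
proof -
  obtain x where x: "pw T < x" "x \<in> H" using H(2) unfolding unbounded_def by blast
  obtain z where z: "w + x < z" "z \<in> H" using H(2) unfolding unbounded_def by blast
  have "w \<le> w + x" "x \<le> w + x" by simp_all
  then have "w < z" "x < z" using z(1) by order+
  have "x \<noteq> 0" using x(1) by auto
  then obtain u where u: "is_top u x" using is_top_exists by blast
  have "pw T < pw (u + 1)" using x(1) is_top_less[OF u] by order
  then have "T < u + 1" by (simp only: pw_less_iff)
  then have "T \<le> u" by (simp only: mnat_less_succ)
  have "T \<le> l" if "is_bottom l z" for l
  proof -
    have "u < l" using H(3) x(2) z(2) \<open>x < z\<close> u that unfolding apart_set_def before_def by blast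
    then show ?thesis using \<open>T \<le> u\<close> by order
  qed
  then show ?thesis using z(2) \<open>w < z\<close> by blast
qed

text \<open>Counting parities of very short gaps, as Blass, Hirst and Simpson do for the full Hindman
  theorem. In the enumeration stage \<open>t\<close> the set consists of the \<open>n\<close> with a witness below \<open>t\<close>; the
  gap between consecutive exponents \<open>e < j\<close> is short at stage \<open>t\<close> if some \<open>n \<le> e\<close> is enumerated
  between the stages \<open>j\<close> and \<open>t\<close>.\<close>

theorem HT_imp_ACA: "HT \<Longrightarrow> ACA"
  unfolding ACA_def
proof (intro allI impI)
  fix \<theta> assume HT and \<theta>: "rel2 \<theta>"
  define A where "A t n \<longleftrightarrow> (\<exists>s<t. \<theta> n s)" for t n
  have relA: "rel2 A" unfolding A_def rel2_def by (intro sigs sig_rel2[OF \<theta>]; simp)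
  define short where "short t e j \<longleftrightarrow> (\<exists>n\<le>e. A t n \<and> \<not> A j n)" for t e j
  have rel_short: "rel3 short" unfolding short_def rel3_def by (intro sigs sig_rel2[OF relA]; simp)
  \<comment> \<open>A short gap is registered at its right end \<open>j\<close>, the left end being
    the previous exponent, so that gaps can be counted along \<open>j\<close>.\<close>
  define gap where "gap t m j \<longleftrightarrow> Bit j m \<and>
    (\<exists>e<j. Bit e m \<and> (\<forall>i<j. e < i \<longrightarrow> \<not> Bit i m) \<and> short t e j)" for t m j
  have rel_gap: "rel3 gap" unfolding gap_def rel3_def by (intro sigs sig_rel3[OF rel_short]; simp)

  \<comment> \<open>The code of (t, m, j) holds the parity of the number of gaps of \<open>m\<close>
    at stage \<open>t\<close> with right end below \<open>j\<close>; passing a gap flips it.\<close>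
  let ?\<Phi> = "\<lambda>n P. \<exists>t\<le>n. \<exists>m\<le>n. \<exists>j\<le>n. n = mpair (mpair t m) (j + 1) \<and> (P (mpair (mpair t m) j) = (\<not> gap t m j))"
  have step: "mpair a j < mpair a (j + 1)" for a j
    by (rule mpair_less) (simp add: add.assoc[symmetric] basic_arithmetic(8))
  have "\<exists>E. rel1 E \<and> (\<forall>n. E n \<longleftrightarrow> ?\<Phi> n E)"
  proof (rule set_recursion)
    show "rel2 (\<lambda>n w. ?\<Phi> n (\<lambda>x. cmem x w))"
      unfolding rel2_def by (intro sigs sig_rel3[OF rel_gap]; simp)
    show "?\<Phi> n P \<longleftrightarrow> ?\<Phi> n P'" if "\<And>x. x < n \<Longrightarrow> P x \<longleftrightarrow> P' x" for n P P'
    proof -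
      have eq: "n = mpair (mpair t m) (j + 1) \<and> (P (mpair (mpair t m) j) = (\<not> gap t m j)) \<longleftrightarrow>
          n = mpair (mpair t m) (j + 1) \<and> (P' (mpair (mpair t m) j) = (\<not> gap t m j))" for t m j
        using step[of "mpair t m" j] that[of "mpair (mpair t m) j"] by blast
      show ?thesis by (simp only: eq)
    qed
  qed
  then obtain E where E: "rel1 E" and E_rec: "\<forall>n. E n \<longleftrightarrow> ?\<Phi> n E" by (elim exE conjE) (rule that)
  note E_iff = E_rec[THEN spec]
  define par where "par t m j \<longleftrightarrow> E (mpair (mpair t m) j)" for t m j
  have rel_par: "rel3 par" unfolding par_def rel3_def by (intro sigs sig_rel1[OF E]; simp)
  have par_0: "\<not> par t m 0" for t m
  proof -
    have "(0::mnat) \<noteq> j + 1" for j using basic_arithmetic(1)[of j] by metis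
    then show ?thesis unfolding par_def by (subst E_iff) (simp only: mpair_eq, blast)
  qed
  have par_Suc: "par t m (j + 1) \<longleftrightarrow> (par t m j = (\<not> gap t m j))" for t m j
  proof -
    have "t \<le> mpair (mpair t m) (j + 1) \<and> m \<le> mpair (mpair t m) (j + 1)"
      by (meson le_mpair order_trans)
    moreover have "j \<le> mpair (mpair t m) (j + 1)"
      using le_mpair(2)[of "j + 1" "mpair t m"] by (meson less_imp_le mnat_less_iff)
    ultimately show ?thesis unfolding par_def by (subst E_iff) auto
  qed

  \<comment> \<open>The sum keeps the gaps of both summands and gains one pair of consecutive
    exponents, \<mu>(x) and \<lambda>(y). Inequality of truth values is exclusive or.\<close>
  have gap_add: "gap t (x + y) j \<longleftrightarrow> (gap t x j \<noteq> (gap t y j \<noteq> (j = l \<and> short t u l)))"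
    if b: "before x y" and u: "is_top u x" and l: "is_bottom l y" for t x y u l j
  proof -
    have xy: "Bit e (x + y) \<longleftrightarrow> Bit e x \<or> Bit e y" for e
      by (rule Bit_add_apart) (use b before_iff in blast)
    have ul: "u < l" using b u l unfolding before_def by blast
    have hi: "\<not> Bit e x" if "u < e" for e using u that unfolding is_top_iff by force
    have lo: "\<not> Bit e y" if "e < l" for e using l that unfolding is_bottom_iff by force
    have Bu: "Bit u x" and Bl: "Bit l y" using u l by (auto simp: is_top_iff is_bottom_iff)
    consider "j < l" | "j = l" | "l < j" by (rule linorder_cases)
    then show ?thesis
    proof cases
      case 1
      have same: "Bit e (x + y) \<longleftrightarrow> Bit e x" if "e \<le> j" for e
        using xy lo[of e] that 1 by fastforce
      have "gap t (x + y) j \<longleftrightarrow> gap t x j"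
        unfolding gap_def using same by (metis less_imp_le order_refl)
      moreover have "\<not> gap t y j" unfolding gap_def using lo[OF 1] by blast
      ultimately show ?thesis using 1 by blast
    next
      case 2
      have nx: "\<not> gap t x j" unfolding gap_def using hi[of j] ul 2 by blast
      have ny: "\<not> gap t y j" unfolding gap_def using lo 2 by blast
      have "gap t (x + y) l \<longleftrightarrow> short t u l"
      proof
        assume "gap t (x + y) l"
        then obtain e where e: "e < l" "Bit e (x + y)" "\<forall>i<l. e < i \<longrightarrow> \<not> Bit i (x + y)" "short t e l"
          unfolding gap_def by blast
        have "Bit e x" using e(1,2) lo xy by blast
        then have "e \<le> u" using u unfolding is_top_iff by blast
        moreover have "\<not> e < u" using e(3) ul Bu xy by blast
        ultimately have "e = u" by order
        then show "short t u l" using e(4) by simp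
      next
        assume "short t u l"
        moreover have "\<forall>i<l. u < i \<longrightarrow> \<not> Bit i (x + y)" using hi lo xy by blast
        ultimately show "gap t (x + y) l" unfolding gap_def using Bl Bu xy ul by blast
      qed
      then show ?thesis using nx ny 2 by blast
    next
      case 3
      then have "u < j" using ul by order
      then have nx: "\<not> gap t x j" unfolding gap_def using hi by blast
      have Bj: "Bit j (x + y) \<longleftrightarrow> Bit j y" using xy hi \<open>u < j\<close> by blast
      have "(\<exists>e<j. Bit e (x + y) \<and> (\<forall>i<j. e < i \<longrightarrow> \<not> Bit i (x + y)) \<and> short t e j) \<longleftrightarrow>
            (\<exists>e<j. Bit e y \<and> (\<forall>i<j. e < i \<longrightarrow> \<not> Bit i y) \<and> short t e j)"
      proof -
        have "Bit e (x + y) \<and> (\<forall>i<j. e < i \<longrightarrow> \<not> Bit i (x + y)) \<longleftrightarrow>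
              Bit e y \<and> (\<forall>i<j. e < i \<longrightarrow> \<not> Bit i y)" for e
        proof
          assume L: "Bit e (x + y) \<and> (\<forall>i<j. e < i \<longrightarrow> \<not> Bit i (x + y))"
          then have "\<not> e < l" using 3 Bl xy by blast
          then have "u < e" using ul by order
          then show "Bit e y \<and> (\<forall>i<j. e < i \<longrightarrow> \<not> Bit i y)" using L hi xy by blast
        next
          assume R: "Bit e y \<and> (\<forall>i<j. e < i \<longrightarrow> \<not> Bit i y)"
          then have "\<not> e < l" using lo by blast
          then have "u < e" using ul by order
          have "\<not> Bit i x" if "e < i" for i
          proof (rule hi)
            show "u < i" using \<open>u < e\<close> that by order
          qed
          then show "Bit e (x + y) \<and> (\<forall>i<j. e < i \<longrightarrow> \<not> Bit i (x + y))" using R xy by blast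
        qed
        then show ?thesis by blast
      qed
      then have "gap t (x + y) j \<longleftrightarrow> gap t y j" unfolding gap_def Bj by blast
      then show ?thesis using nx 3 by auto
    qed
  qed
  have par_add: "par t (x + y) j \<longleftrightarrow> (par t x j \<noteq> (par t y j \<noteq> (l < j \<and> short t u l)))"
    if "before x y" "is_top u x" "is_bottom l y" for t x y u l j
  proof (rule rel1_induct[where P = "\<lambda>j. par t (x + y) j \<longleftrightarrow> (par t x j \<noteq> (par t y j \<noteq> (l < j \<and> short t u l)))"])
    show "rel1 (\<lambda>j. par t (x + y) j \<longleftrightarrow> (par t x j \<noteq> (par t y j \<noteq> (l < j \<and> short t u l))))"
      unfolding rel1_def by (intro sigs sig_rel3[OF rel_par]; simp)
    show "par t (x + y) 0 \<longleftrightarrow> (par t x 0 \<noteq> (par t y 0 \<noteq> (l < 0 \<and> short t u l)))"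
      by (simp add: par_0)
    fix j assume IH: "par t (x + y) j \<longleftrightarrow> (par t x j \<noteq> (par t y j \<noteq> (l < j \<and> short t u l)))"
    have eq: "l < j + 1 \<longleftrightarrow> l < j \<or> j = l" using basic_arithmetic(8)[of l j] by blast
    have irr: "\<not> (l < j \<and> j = l)" by auto
    show "par t (x + y) (j + 1) \<longleftrightarrow> (par t x (j + 1) \<noteq> (par t y (j + 1) \<noteq> (l < j + 1 \<and> short t u l)))"
      unfolding par_Suc IH gap_add[OF that] eq using irr by argo
  qed
  \<comment> \<open>The exponents of \<open>m\<close> are below \<open>m\<close>, so counting
    further finds no new gaps. This lets summands be counted up to the size of their sum.\<close>
  have par_stable: "par t m (m + d) \<longleftrightarrow> par t m m" for t m d
  proof (rule rel1_induct[where P = "\<lambda>d. par t m (m + d) \<longleftrightarrow> par t m m"])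
    show "rel1 (\<lambda>d. par t m (m + d) \<longleftrightarrow> par t m m)"
      unfolding rel1_def by (intro sigs sig_rel3[OF rel_par]; simp)
    fix d assume IH: "par t m (m + d) \<longleftrightarrow> par t m m"
    have "m \<le> m + d" by simp
    then have "\<not> Bit (m + d) m" using Bit_less by fastforce
    then have "\<not> gap t m (m + d)" unfolding gap_def by blast
    then show "par t m (m + (d + 1)) \<longleftrightarrow> par t m m"
      using par_Suc[of t m "m + d"] IH by (simp add: add.assoc)
  qed simp
  \<comment> \<open>\<open>short t e j\<close> looks only at \<open>n \<le> e\<close>, so the stage
    matters only up to the top exponent.\<close>
  have par_cong: "par t m j \<longleftrightarrow> par t' m j" if u: "is_top u m" and eq: "\<And>n. n \<le> u \<Longrightarrow> A t n \<longleftrightarrow> A t' n"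
    for t t' m j u
  proof (rule rel1_induct[where P = "\<lambda>j. par t m j \<longleftrightarrow> par t' m j"])
    show "rel1 (\<lambda>j. par t m j \<longleftrightarrow> par t' m j)"
      unfolding rel1_def by (intro sigs sig_rel3[OF rel_par]; simp)
    show "par t m 0 \<longleftrightarrow> par t' m 0" by (simp add: par_0)
    fix j assume IH: "par t m j \<longleftrightarrow> par t' m j"
    have "short t e j \<longleftrightarrow> short t' e j" if "Bit e m" for e j
    proof -
      have "e \<le> u" using that u unfolding is_top_iff by blast
      then have "A t n \<longleftrightarrow> A t' n" if "n \<le> e" for n using eq[of n] order_trans[OF that] by blast
      then show ?thesis unfolding short_def by blast
    qed
    then have "gap t m j \<longleftrightarrow> gap t' m j" unfolding gap_def by blast
    then show "par t m (j + 1) \<longleftrightarrow> par t' m (j + 1)" unfolding par_Suc using IH by blast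
  qed
  define V where "V t m \<longleftrightarrow> par t m m" for t m
  have V_add: "V t (x + y) \<longleftrightarrow> (V t x \<noteq> (V t y \<noteq> short t u l))"
    if "before x y" "is_top u x" "is_bottom l y" for t x y u l
  proof -
    have "l < y" using that(3) Bit_less unfolding is_bottom_iff by blast
    moreover have "y \<le> x + y" by simp
    ultimately have "l < x + y" by order
    moreover have "par t x (x + y) \<longleftrightarrow> V t x" "par t y (x + y) \<longleftrightarrow> V t y"
      using par_stable[of t x y] par_stable[of t y x] by (simp_all add: V_def add.commute)
    ultimately show ?thesis using par_add[OF that, of t "x + y"] unfolding V_def by blast
  qed

  \<comment> \<open>The stage is \<mu>(m): this keeps the colouring definable, and a far last
    summand makes the stage as late as desired.\<close>
  define f where "f m \<longleftrightarrow> (\<exists>u\<le>m. is_top u m \<and> par u m m)" for m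
  have "rel1 f" unfolding f_def rel1_def by (intro sigs sig_rel3[OF rel_par]; simp)
  have f: "f m \<longleftrightarrow> V u m" if "is_top u m" for u m
  proof -
    have "u \<le> m" using that Bit_less less_imp_le unfolding is_top_iff by blast
    then show ?thesis unfolding f_def V_def using that is_top_unique by blast
  qed
  from \<open>HT\<close>[unfolded HT_def, rule_format, OF \<open>rel1 f\<close>]
  obtain H b where H: "H \<in> coll" "\<forall>x\<in>H. 0 < x" "unbounded H" "apart_set H"
    "\<forall>x\<in>H. \<forall>y\<in>H. \<forall>z\<in>H. x \<noteq> y \<longrightarrow> x \<noteq> z \<longrightarrow> y \<noteq> z \<longrightarrow> f (x + y + z) = b"
    by (elim bexE conjE exE) (rule that, assumption+)
  define tp bt where "tp x = (SOME u. is_top u x)" and "bt x = (SOME l. is_bottom l x)" for x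
  have nz: "x \<noteq> 0" if "x \<in> H" for x using H(2) that mnat_zero_less by blast
  have tp: "is_top (tp x) x" and bt: "is_bottom (bt x) x" if "x \<in> H" for x
    unfolding tp_def bt_def using is_top_exists[OF nz[OF that]] is_bottom_exists[OF nz[OF that]]
    by (auto intro: someI_ex)
  have before: "before x y" if "x \<in> H" "y \<in> H" "x < y" for x y
    using H(4) that unfolding apart_set_def by blast
  have far: "\<exists>z\<in>H. w < z \<and> T \<le> bt z" for w T
    using far_element[OF H(2-4), of w T] bt by blast

  \<comment> \<open>Strong bounding yields a stage at which the enumeration is complete up to
    \<mu>(x).\<close>
  have "\<exists>T. \<forall>t\<ge>T. \<forall>n\<le>tp x. A t n \<longleftrightarrow> (\<exists>s. \<theta> n s)" for x
  proof -
    obtain T where T: "\<And>n. n \<le> tp x \<Longrightarrow> (\<exists>s. \<theta> n s) \<Longrightarrow> (\<exists>s<T. \<theta> n s)"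
      using strong_bounding[OF \<theta>, of "tp x"] by blast
    have "A t n \<longleftrightarrow> (\<exists>s. \<theta> n s)" if "T \<le> t" "n \<le> tp x" for t n
      unfolding A_def using T[OF that(2)] that(1) by (meson order.strict_trans2)
    then show ?thesis by blast
  qed
  then obtain T where T: "\<And>x t n. T x \<le> t \<Longrightarrow> n \<le> tp x \<Longrightarrow> A t n \<longleftrightarrow> (\<exists>s. \<theta> n s)" by metis
  \<comment> \<open>The limit of \<open>V t x\<close> as the stage grows. No definability is
    claimed; it only occurs in Boolean identities.\<close>
  define S where "S x \<longleftrightarrow> V (T x) x" for x
  have V_S: "V t x \<longleftrightarrow> S x" if "x \<in> H" "T x \<le> t" for t x
    unfolding S_def V_def by (rule par_cong[OF tp[OF that(1)]]) (use T that(2) in auto)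
  \<comment> \<open>Shortness of the gap between \<open>x\<close> and \<open>y\<close> with respect
    to the enumerated set itself instead of a stage of it.\<close>
  define g where "g x y \<longleftrightarrow> (\<exists>n\<le>tp x. (\<exists>s. \<theta> n s) \<and> \<not> A (bt y) n)" for x y
  have short_g: "short t (tp x) (bt y) \<longleftrightarrow> g x y" if "T x \<le> t" for t x y
    unfolding short_def g_def using T[OF that] by blast
  have g_far: "\<not> g x y" if "T x \<le> bt y" for x y unfolding g_def using T[OF that] by blast

  \<comment> \<open>The stage given by \<open>z\<close> is final for \<open>x\<close> and
    \<open>y\<close>, and the gap from \<open>y\<close> to \<open>z\<close> is not short. What
    remains are the limit parities, the gap between \<open>x\<close> and \<open>y\<close>, and the
    parity of \<open>z\<close> alone.\<close>
  have colour: "b \<longleftrightarrow> ((S x \<noteq> (S y \<noteq> g x y)) \<noteq> V (tp z) z)"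
    if mem: "x \<in> H" "y \<in> H" "z \<in> H" and xyz: "x < y" "y < z" and big: "T x \<le> bt z" "T y \<le> bt z" for x y z
  proof -
    have "x < z" using xyz by order
    have b3: "before x y" "before y z" "before x z" using before mem xyz \<open>x < z\<close> by blast+
    have xy: "Bit e (x + y) \<longleftrightarrow> Bit e x \<or> Bit e y" for e
      by (rule Bit_add_apart) (use b3(1) before_iff in blast)
    have bxyz: "before (x + y) z" using b3(2,3) xy unfolding before_iff by blast
    have xyz_bits: "Bit e (x + y + z) \<longleftrightarrow> Bit e (x + y) \<or> Bit e z" for e
      by (rule Bit_add_apart) (use bxyz before_iff in blast)
    have top_xy: "is_top (tp y) (x + y)"
      using tp[OF mem(2)] b3(1) xy less_imp_le unfolding is_top_iff before_iff by blast
    have top_xyz: "is_top (tp z) (x + y + z)"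
      using tp[OF mem(3)] bxyz xyz_bits less_imp_le unfolding is_top_iff before_iff by blast
    have "bt z \<le> tp z" using tp[OF mem(3)] bt[OF mem(3)] unfolding is_top_iff is_bottom_iff by blast
    then have t: "T x \<le> tp z" "T y \<le> tp z" using big by order+
    have "b \<longleftrightarrow> f (x + y + z)" using H(5) mem xyz \<open>x < z\<close> by (metis less_irrefl)
    also have "\<dots> \<longleftrightarrow> V (tp z) (x + y + z)" by (rule f[OF top_xyz])
    also have "\<dots> \<longleftrightarrow> (V (tp z) (x + y) \<noteq> (V (tp z) z \<noteq> short (tp z) (tp y) (bt z)))"
      by (rule V_add[OF bxyz top_xy bt[OF mem(3)]])
    also have "short (tp z) (tp y) (bt z) \<longleftrightarrow> False" using short_g[OF t(2)] g_far[OF big(2)] by blast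
    also have "V (tp z) (x + y) \<longleftrightarrow> (S x \<noteq> (S y \<noteq> g x y))"
      using V_add[OF b3(1) tp[OF mem(1)] bt[OF mem(2)], of "tp z"] V_S[OF mem(1) t(1)]
        V_S[OF mem(2) t(2)] short_g[OF t(1)] by blast
    finally show ?thesis by simp
  qed
  \<comment> \<open>With \<open>v\<close> far from \<open>x\<close> and \<open>y\<close>, and
    \<open>z\<close> far from all three, the two colour equations differ only in \<open>S x\<close>
    and \<open>S y\<close>.\<close>
  have S_const: "S x \<longleftrightarrow> S y" if xy: "x \<in> H" "y \<in> H" for x y
  proof -
    obtain v where v: "v \<in> H" "x + y < v" "T x + T y \<le> bt v" using far by blast
    obtain z where z: "z \<in> H" "v < z" "T x + T y + T v \<le> bt z" using far by blast
    have "x \<le> x + y" "y \<le> x + y" "T x \<le> T x + T y" "T y \<le> T x + T y"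
      "T x + T y \<le> T x + T y + T v" "T v \<le> T x + T y + T v" by simp_all
    then have "x < v" "y < v" "T x \<le> bt v" "T y \<le> bt v" "T x \<le> bt z" "T y \<le> bt z" "T v \<le> bt z"
      using v z by order+
    then have "b \<longleftrightarrow> ((S x \<noteq> (S v \<noteq> g x v)) \<noteq> V (tp z) z)" "b \<longleftrightarrow> ((S y \<noteq> (S v \<noteq> g y v)) \<noteq> V (tp z) z)"
      "\<not> g x v" "\<not> g y v"
      using colour[of x v z] colour[of y v z] g_far xy v z by blast+
    then show ?thesis by argo
  qed
  \<comment> \<open>Compares \<open>x\<close>, \<open>y\<close>, \<open>z\<close> with
    \<open>x\<close>, \<open>v\<close>, \<open>z\<close> for \<open>v\<close> far from
    \<open>x\<close>: by the equality of limit parities the equations differ only in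
    \<open>g x y\<close>.\<close>
  have no_gap: "\<not> g x y" if xy: "x \<in> H" "y \<in> H" "x < y" for x y
  proof -
    obtain v where v: "v \<in> H" "y < v" "T x \<le> bt v" using far by blast
    obtain z where z: "z \<in> H" "v < z" "T x + T y + T v \<le> bt z" using far by blast
    have "T x \<le> T x + T y" "T y \<le> T x + T y" "T x + T y \<le> T x + T y + T v" "T v \<le> T x + T y + T v"
      by simp_all
    then have "x < v" "y < z" "T x \<le> bt z" "T y \<le> bt z" "T v \<le> bt z" using xy v z by order+
    then have "b \<longleftrightarrow> ((S x \<noteq> (S v \<noteq> g x v)) \<noteq> V (tp z) z)" "b \<longleftrightarrow> ((S x \<noteq> (S y \<noteq> g x y)) \<noteq> V (tp z) z)"
      "\<not> g x v"
      using colour[of x v z] colour[of x y z] g_far[OF v(3)] xy v z by blast+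
    moreover have "S x \<longleftrightarrow> S v" "S x \<longleftrightarrow> S y" using S_const xy v by blast+
    ultimately show ?thesis by argo
  qed

  \<comment> \<open>To decide \<open>n\<close>, find x < y in \<open>H\<close> with n \<le> \<mu>(x)
    and ask whether \<open>n\<close> has been enumerated by stage \<lambda>(y). Every such
    \<open>y\<close> gives the right answer, so membership is Delta^0_1.\<close>
  let ?W = "\<lambda>n y. y \<in> H \<and> (\<exists>x<y. x \<in> H \<and> (\<exists>u\<le>x. is_top u x \<and> n \<le> u))"
  let ?Q = "\<lambda>n y. ?W n y \<and> (\<exists>l\<le>y. is_bottom l y \<and> A l n)"
  let ?R = "\<lambda>n y. ?W n y \<and> (\<exists>l\<le>y. is_bottom l y \<and> \<not> A l n)"
  have W: "(\<exists>s. \<theta> n s) \<longleftrightarrow> A l n" if wit: "?W n y" and l: "is_bottom l y" for n y l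
  proof -
    obtain x u where x: "y \<in> H" "x < y" "x \<in> H" "is_top u x" "n \<le> u" using wit by blast
    have "u = tp x" "l = bt y" using x l tp bt is_top_unique is_bottom_unique by blast+
    then have "(\<exists>s. \<theta> n s) \<Longrightarrow> A l n" using no_gap[OF x(3,1,2)] x(5) unfolding g_def by blast
    then show ?thesis unfolding A_def by blast
  qed
  have W_ex: "\<exists>y. ?W n y" for n
  proof -
    obtain x where x: "x \<in> H" "n \<le> bt x" using far by blast
    obtain y where y: "y \<in> H" "x < y" using far by blast
    have "bt x \<le> tp x" using tp[OF x(1)] bt[OF x(1)] unfolding is_top_iff is_bottom_iff by blast
    then have "n \<le> tp x" using x(2) by order
    moreover have "tp x \<le> x" using tp[OF x(1)] Bit_less less_imp_le unfolding is_top_iff by blast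
    ultimately show ?thesis using x(1) y tp[OF x(1)] by blast
  qed
  have bot: "bt y \<le> y \<and> is_bottom (bt y) y" if "y \<in> H" for y
    using bt[OF that] Bit_less less_imp_le unfolding is_bottom_iff by blast
  show "rel1 (\<lambda>n. \<exists>s. \<theta> n s)"
  proof (rule rel1_Delta[of ?Q ?R])
    show "rel2 (\<lambda>y n. ?Q n y)" "rel2 (\<lambda>y n. ?R n y)"
      unfolding rel2_def by (intro sigs sig_rel2[OF relA] H(1); simp)+
    fix n
    from W_ex[of n] obtain y where y: "?W n y" by (rule exE)
    then have "y \<in> H" by (rule conjunct1)
    note y_iff = W[OF y bt[OF this]] and y_bot = bot[OF this]
    show "(\<exists>s. \<theta> n s) \<longleftrightarrow> (\<exists>y. ?Q n y)"
    proof
      assume "\<exists>s. \<theta> n s"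
      then have "A (bt y) n" by (rule y_iff[THEN iffD1])
      then have "\<exists>l\<le>y. is_bottom l y \<and> A l n" using y_bot by (intro exI[of _ "bt y"]) simp
      with y have "?Q n y" by (rule conjI)
      then show "\<exists>y. ?Q n y" by (rule exI[of _ y])
    next
      assume "\<exists>y. ?Q n y"
      then obtain y' l where y': "?W n y'" and l: "is_bottom l y'" and a: "A l n" by blast
      show "\<exists>s. \<theta> n s" using a by (rule W[OF y' l, THEN iffD2])
    qed
    show "\<not> (\<exists>s. \<theta> n s) \<longleftrightarrow> (\<exists>y. ?R n y)"
    proof
      assume "\<not> (\<exists>s. \<theta> n s)"
      then have "\<not> A (bt y) n" using y_iff[THEN iffD2] by (rule contrapos_nn)
      then have "\<exists>l\<le>y. is_bottom l y \<and> \<not> A l n" using y_bot by (intro exI[of _ "bt y"]) simp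
      with y have "?R n y" by (rule conjI)
      then show "\<exists>y. ?R n y" by (rule exI[of _ y])
    next
      assume "\<exists>y. ?R n y"
      then obtain y' l where y': "?W n y'" and l: "is_bottom l y'" and a: "\<not> A l n" by blast
      show "\<not> (\<exists>s. \<theta> n s)" using a W[OF y' l, THEN iffD1] by (rule contrapos_nn)
    qed
  qed
qed


section \<open>From arithmetical comprehension to Ramsey's theorem\<close>

text \<open>Lets \<open>sig\<close> absorb unbounded quantifiers, so that all arithmetical
  predicates count as definable. As in \<open>sig_Delta\<close>, arguments are packed into pairs
  until the unary case is reached.\<close>

lemma sig_ex:
  assumes ACA and "sig (Suc k) (\<lambda>e. Q (e 0) (\<lambda>n. e (Suc n)))"
  shows "sig k (\<lambda>e. \<exists>x. Q x e)"
  using assms(2)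
proof (induction k arbitrary: Q)
  case 0
  have "Q x e \<longleftrightarrow> Q x e'" for x e e'
    using sig_cong_env[OF 0, of "case_nat x e" "case_nat x e'"] by simp
  then have "(\<lambda>e. \<exists>x. Q x e) = (\<lambda>e. \<exists>x. Q x undefined)" by (intro ext) blast
  then show ?case using sig_0[of "\<exists>x. Q x undefined"] by simp
next
  case (Suc k)
  note prem = Suc.prems
  show ?case
  proof (cases k)
    case 0
    have ext: "Q x e \<longleftrightarrow> Q x (\<lambda>_. e 0)" for x e
    proof -
      have "case_nat x e n = case_nat x (\<lambda>_. e 0) n" if "n < Suc (Suc k)" for n
        using that 0 by (auto simp: less_Suc_eq)
      then show ?thesis
        using sig_cong_env[OF prem, of "case_nat x e" "case_nat x (\<lambda>_. e 0)"] by simp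
    qed
    have "rel2 (\<lambda>x n. Q x (\<lambda>_. n))"
      using prem 0 unfolding rel2_def by (subst (asm) ext) (simp add: numeral_2_eq_2)
    then have "rel2 (\<lambda>n x. Q x (\<lambda>_. n))"
      unfolding rel2_def[of "\<lambda>n x. Q x (\<lambda>_. n)"] by (rule sig_rel2) (intro sigs, simp)+
    then have "rel1 (\<lambda>n. \<exists>x. Q x (\<lambda>_. n))" using \<open>ACA\<close> unfolding ACA_def by blast
    moreover have "(\<lambda>e. \<exists>x. Q x e) = (\<lambda>e. \<exists>x. Q x (\<lambda>_. e 0))" using ext by blast
    ultimately show ?thesis using 0 unfolding rel1_def by simp
  next
    case (Suc l)
    let ?code = "\<lambda>S e. \<exists>a<e 0 + 1. \<exists>b<e 0 + 1. e 0 = mpair a b \<and> S (case_nat a (case_nat b (\<lambda>n. e (Suc n))))"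
    have "sig k (\<lambda>e. \<exists>x. ?code (Q x) e)"
      by (rule Suc.IH) (use sig_unpair[OF prem[unfolded Suc]] Suc in simp)
    also have "(\<lambda>e. \<exists>x. ?code (Q x) e) = ?code (\<lambda>e. \<exists>x. Q x e)" by blast
    finally have "sig k (?code (\<lambda>e. \<exists>x. Q x e))" .
    from sig_pair[OF this[unfolded Suc]] show ?thesis
      using Suc by (simp add: bounded_unpair[where P = "\<lambda>a b. \<exists>x. Q x (case_nat a (case_nat b _))"] case_nat_env
          mnat_less_succ le_mpair)
  qed
qed

lemma sig_all:
  assumes ACA and "sig (Suc k) (\<lambda>e. Q (e 0) (\<lambda>n. e (Suc n)))"
  shows "sig k (\<lambda>e. \<forall>x. Q x e)"
proof -
  have "sig k (\<lambda>e. \<exists>x. \<not> Q x e)" using assms(1) sig_not[OF assms(2)] by (rule sig_ex)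
  from sig_not[OF this] show ?thesis by simp
qed

text \<open>Greedily, $R_m$ is accepted whenever all intersections with the filter base \<open>X\<close> stay
  unbounded.\<close>

lemma decide_family:
  assumes ACA and X: "rel2 X" and R: "rel2 R"
    and decreasing: "\<And>k l x. k \<le> l \<Longrightarrow> X l x \<Longrightarrow> X k x"
    and unbd: "\<And>k N. \<exists>x>N. X k x"
  shows "\<exists>Q. rel1 Q \<and> (\<forall>n k N. \<exists>x>N. X k x \<and> (\<forall>m<n. R m x \<longleftrightarrow> Q m))"
proof -
  let ?\<Phi> = "\<lambda>n P. \<forall>k N. \<exists>x. N < x \<and> X k x \<and> (\<forall>m<n. R m x \<longleftrightarrow> P m) \<and> R n x"
  have "\<exists>Q. rel1 Q \<and> (\<forall>n. Q n \<longleftrightarrow> ?\<Phi> n Q)"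
  proof (rule set_recursion)
    show "rel2 (\<lambda>n w. ?\<Phi> n (\<lambda>x. cmem x w))" unfolding rel2_def
      by (intro sigs sig_all[OF \<open>ACA\<close>] sig_ex[OF \<open>ACA\<close>] sig_rel2[OF X] sig_rel2[OF R]; simp)
    show "?\<Phi> n P \<longleftrightarrow> ?\<Phi> n P'" if "\<And>x. x < n \<Longrightarrow> P x \<longleftrightarrow> P' x" for n P P'
    proof -
      have eq: "(\<forall>m<n. R m x \<longleftrightarrow> P m) \<longleftrightarrow> (\<forall>m<n. R m x \<longleftrightarrow> P' m)" for x using that by auto
      show ?thesis by (simp only: eq)
    qed
  qed
  then obtain Q where Q: "rel1 Q" and Q_iff: "\<forall>n. Q n \<longleftrightarrow> ?\<Phi> n Q" by (elim exE conjE) (rule that)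
  let ?inv = "\<lambda>n. \<forall>k N. \<exists>x. N < x \<and> X k x \<and> (\<forall>m<n. R m x \<longleftrightarrow> Q m)"
  have "?inv n" for n
  proof (rule rel1_induct[where P = ?inv])
    show "rel1 ?inv" unfolding rel1_def
      by (intro sigs sig_all[OF \<open>ACA\<close>] sig_ex[OF \<open>ACA\<close>] sig_rel2[OF X] sig_rel2[OF R] sig_rel1[OF Q]; simp)
    show "?inv 0"
    proof (intro allI)
      fix k N
      obtain x where "N < x" "X k x" using unbd[of N k] by blast
      then show "\<exists>x. N < x \<and> X k x \<and> (\<forall>m<0. R m x \<longleftrightarrow> Q m)" by (intro exI[of _ x]) simp
    qed
    fix n assume IH: "?inv n"
    have Suc: "(\<forall>m<n + 1. P m) \<longleftrightarrow> (\<forall>m<n. P m) \<and> P n" for P by (auto simp: basic_arithmetic(8))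
    show "?inv (n + 1)"
    proof (cases "Q n")
      case True
      then have "?\<Phi> n Q" by (rule Q_iff[THEN spec, THEN iffD1])
      show ?thesis
      proof (intro allI)
        fix k N
        obtain x where "N < x" "X k x" "\<forall>m<n. R m x \<longleftrightarrow> Q m" "R n x"
          using \<open>?\<Phi> n Q\<close> by blast
        then show "\<exists>x. N < x \<and> X k x \<and> (\<forall>m<n + 1. R m x \<longleftrightarrow> Q m)" unfolding Suc using True by blast
      qed
    next
      case False
      then have "\<not> ?\<Phi> n Q" using Q_iff[THEN spec, THEN iffD2, of n] by (rule contrapos_nn)
      \<comment> \<open>Beyond \<open>N0\<close>, points of \<open>X k0\<close> that respect the
        earlier decisions all fail \<open>R n\<close>. As the \<open>X k\<close> decrease, any given
        \<open>k\<close> and \<open>N\<close> can be met together with \<open>k0\<close> and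
        \<open>N0\<close>.\<close>
      then obtain k0 N0 where no: "\<And>x. N0 < x \<Longrightarrow> X k0 x \<Longrightarrow> (\<forall>m<n. R m x \<longleftrightarrow> Q m) \<Longrightarrow> \<not> R n x"
        by blast
      show ?thesis
      proof (intro allI)
        fix k N
        obtain x where x: "N + N0 < x" "X (k + k0) x" "\<forall>m<n. R m x \<longleftrightarrow> Q m" using IH by blast
        have le: "N \<le> N + N0" "N0 \<le> N + N0" "k \<le> k + k0" "k0 \<le> k + k0" by simp_all
        then have "N < x" "N0 < x" using x(1) by order+
        moreover have "X k x" "X k0 x" using decreasing le x(2) by blast+
        ultimately show "\<exists>x. N < x \<and> X k x \<and> (\<forall>m<n + 1. R m x \<longleftrightarrow> Q m)"
          unfolding Suc using no[of x] x(3) False by blast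
      qed
    qed
  qed
  then show ?thesis using Q by (intro exI[of _ Q] conjI allI) simp_all
qed

text \<open>\<open>D1\<close> and \<open>D2\<close> act like limits along an ultrafilter:
  \<open>D1\<close> gives the limit of the colour of a pair with a third point, \<open>D2\<close>
  that of \<open>D1\<close> for a point with a second one. Each round works within the sets on which
  the earlier limits are attained, so the limits are compatible.\<close>

theorem ACA_imp_RT: "ACA \<Longrightarrow> RT"
  unfolding RT_def
proof (intro allI impI)
  fix f assume ACA and f: "rel3 f"
  define R1 where "R1 m x \<longleftrightarrow> (\<exists>u\<le>m. \<exists>v\<le>m. m = mpair u v \<and> f u v x)" for m x
  have R1: "rel2 R1" unfolding R1_def rel2_def by (intro sigs sig_rel3[OF f]; simp)
  have R1_iff: "R1 (mpair u v) x \<longleftrightarrow> f u v x" for u v x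
    unfolding R1_def using le_mpair(1)[of u v] le_mpair(2)[of v u] by auto
  have "rel2 (\<lambda>k x. True)" unfolding rel2_def by (rule sig_True)
  moreover have "\<exists>x>N. True" for N :: mnat by (rule exI[of _ "N + 1"]) (simp add: basic_arithmetic(8))
  ultimately have "\<exists>Q. rel1 Q \<and> (\<forall>n (k::mnat) N. \<exists>x>N. True \<and> (\<forall>m<n. R1 m x \<longleftrightarrow> Q m))"
    by (intro decide_family[OF \<open>ACA\<close> _ R1, where X = "\<lambda>k x. True"]) simp_all
  then obtain D1 where D1: "rel1 D1" and D1_unbd: "\<forall>n (k::mnat) N. \<exists>x>N. True \<and> (\<forall>m<n. R1 m x \<longleftrightarrow> D1 m)"
    by (elim exE conjE) (rule that)
  define X2 where "X2 k x \<longleftrightarrow> (\<forall>m<k. R1 m x \<longleftrightarrow> D1 m)" for k x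
  define R2 where "R2 m x \<longleftrightarrow> D1 (mpair m x)" for m x
  have X2: "rel2 X2" unfolding X2_def rel2_def by (intro sigs sig_rel1[OF D1] sig_rel2[OF R1]; simp)
  have R2: "rel2 R2" unfolding R2_def rel2_def by (intro sigs sig_rel1[OF D1]; simp)
  have X2_dec: "X2 k x" if "k \<le> l" "X2 l x" for k l x
    unfolding X2_def
  proof (intro allI impI)
    fix m assume "m < k"
    then have "m < l" using that(1) by order
    then show "R1 m x \<longleftrightarrow> D1 m" using that(2) unfolding X2_def by blast
  qed
  have "\<exists>Q. rel1 Q \<and> (\<forall>n k N. \<exists>x>N. X2 k x \<and> (\<forall>m<n. R2 m x \<longleftrightarrow> Q m))"
  proof (rule decide_family[OF \<open>ACA\<close> X2 R2])
    show "X2 k x" if "k \<le> l" "X2 l x" for k l x using that by (rule X2_dec)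
    show "\<exists>x>N. X2 k x" for k N using D1_unbd unfolding X2_def by blast
  qed
  then obtain D2 where D2: "rel1 D2" and D2_unbd: "\<forall>n k N. \<exists>x>N. X2 k x \<and> (\<forall>m<n. R2 m x \<longleftrightarrow> D2 m)"
    by (elim exE conjE) (rule that)
  define X3 where "X3 k x \<longleftrightarrow> X2 k x \<and> (\<forall>m<k. R2 m x \<longleftrightarrow> D2 m)" for k x
  have X3: "rel2 X3" unfolding X3_def rel2_def
    by (intro sigs sig_rel1[OF D2] sig_rel2[OF R2] sig_rel2[OF X2]; simp)
  have X3_dec: "X3 k x" if "k \<le> l" "X3 l x" for k l x
    unfolding X3_def
  proof (intro conjI allI impI)
    show "X2 k x" using that X2_dec unfolding X3_def by blast
    fix m assume "m < k"
    then have "m < l" using that(1) by order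
    then show "R2 m x \<longleftrightarrow> D2 m" using that(2) unfolding X3_def by blast
  qed
  \<comment> \<open>A constant family amounts to a single decision, read off at index 0: one value
    of \<open>D2\<close> is taken without bound in every \<open>X3 k\<close>.\<close>
  have "rel2 (\<lambda>m x. D2 x)" unfolding rel2_def by (intro sig_rel1[OF D2] sigs; simp)
  then have "\<exists>Q. rel1 Q \<and> (\<forall>n k N. \<exists>x>N. X3 k x \<and> (\<forall>m<n. D2 x \<longleftrightarrow> Q m))"
  proof (rule decide_family[OF \<open>ACA\<close> X3])
    show "X3 k x" if "k \<le> l" "X3 l x" for k l x using that by (rule X3_dec)
    show "\<exists>x>N. X3 k x" for k N using D2_unbd unfolding X3_def by blast
  qed
  then obtain D3 where "rel1 D3" and D3: "\<forall>n k N. \<exists>x>N. X3 k x \<and> (\<forall>m<n. D2 x \<longleftrightarrow> D3 m)"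
    by (elim exE conjE) (rule that)
  define b where "b = D3 0"
  have large: "\<exists>x>N. X3 k x \<and> D2 x = b" for k N
  proof -
    obtain x where x: "x > N" "X3 k x" "\<forall>m<1. D2 x \<longleftrightarrow> D3 m" using D3 by blast
    then have "D2 x = b" unfolding b_def by simp
    then show ?thesis using x by blast
  qed
  \<comment> \<open>Besides the colours of triples, the limit colours of points and pairs are held
    at \<open>b\<close>; they guarantee that the set can be extended.\<close>
  let ?\<Phi> = "\<lambda>x P. 0 < x \<and> D2 x = b \<and> (\<forall>u<x. P u \<longrightarrow> D1 (mpair u x) = b) \<and>
    (\<forall>u<x. \<forall>v<x. P u \<longrightarrow> P v \<longrightarrow> u < v \<longrightarrow> f u v x = b)"
  have "\<exists>Q. rel1 Q \<and> (\<forall>n. Q n \<longleftrightarrow> ?\<Phi> n Q)"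
  proof (rule set_recursion)
    show "rel2 (\<lambda>n w. ?\<Phi> n (\<lambda>x. cmem x w))" unfolding rel2_def
      by (intro sigs sig_rel1[OF D2] sig_rel1[OF D1] sig_rel3[OF f]; simp)
    show "?\<Phi> n P \<longleftrightarrow> ?\<Phi> n P'" if "\<And>x. x < n \<Longrightarrow> P x \<longleftrightarrow> P' x" for n P P'
    proof -
      have eq: "(\<forall>u<n. P u \<longrightarrow> S u) \<longleftrightarrow> (\<forall>u<n. P' u \<longrightarrow> S u)"
        "(\<forall>u<n. \<forall>v<n. P u \<longrightarrow> P v \<longrightarrow> S' u v) \<longleftrightarrow> (\<forall>u<n. \<forall>v<n. P' u \<longrightarrow> P' v \<longrightarrow> S' u v)" for S S'
        using that by auto
      show ?thesis by (simp only: eq)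
    qed
  qed
  then obtain Q where Q: "rel1 Q" and Q_iff: "\<forall>n. Q n \<longleftrightarrow> ?\<Phi> n Q" by (elim exE conjE) (rule that)
  have Q_pos: "0 < x" and Q_D2: "D2 x = b" and Q_D1: "\<And>u. u < x \<Longrightarrow> Q u \<Longrightarrow> D1 (mpair u x) = b"
    and Q_f: "\<And>u v. Q u \<Longrightarrow> Q v \<Longrightarrow> u < v \<Longrightarrow> v < x \<Longrightarrow> f u v x = b" if "Q x" for x
  proof -
    have \<Phi>: "?\<Phi> x Q" using that by (rule Q_iff[THEN spec, THEN iffD1])
    then show "0 < x" "D2 x = b" "\<And>u. u < x \<Longrightarrow> Q u \<Longrightarrow> D1 (mpair u x) = b" by blast+
    fix u v assume uv: "Q u" "Q v" "u < v" "v < x"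
    then have "u < x" by order
    then show "f u v x = b" using \<Phi> uv by blast
  qed
  have "\<exists>x. N < x \<and> Q x" for N
  proof (rule ccontr)
    assume "\<not> (\<exists>x. N < x \<and> Q x)"
    then have small: "u \<le> N" if "Q u" for u using that by (meson not_less)
    \<comment> \<open>\<open>mpair N N + 1\<close> exceeds every point up to \<open>N\<close> and
      every code of a pair of them, so \<open>x\<close> realises all limit colours involved.\<close>
    obtain x where x: "N < x" "X3 (mpair N N + 1) x" "D2 x = b" using large by blast
    have R: "R1 m x \<longleftrightarrow> D1 m" "R2 m x \<longleftrightarrow> D2 m" if "m \<le> mpair N N" for m
      using x(2) mnat_less_SucI[OF that] unfolding X3_def X2_def by blast+
    have "0 < x" using x(1) by (rule le_less_trans[OF zero_le])
    moreover have "D1 (mpair u x) = b" if "Q u" for u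
    proof -
      have "u \<le> mpair N N" using small[OF that] le_mpair(1)[of N N] by order
      then have "R2 u x \<longleftrightarrow> D2 u" by (rule R(2))
      then show ?thesis using Q_D2[OF that] unfolding R2_def by simp
    qed
    moreover have "f u v x = b" if "Q u" "Q v" "u < v" for u v
    proof -
      have "mpair u v \<le> mpair N N"
        unfolding mpair_def using small that(1,2) by (intro add_mono mult_mono) auto
      then have "R1 (mpair u v) x \<longleftrightarrow> D1 (mpair u v)" by (rule R(1))
      then show ?thesis using Q_D1[OF that(2,3,1)] unfolding R1_iff by simp
    qed
    ultimately have "?\<Phi> x Q" using x(3) by blast
    then have "Q x" by (rule Q_iff[THEN spec, THEN iffD2])
    then have "x \<le> N" by (rule small)
    then show False using x(1) by order
  qed
  then have "unbounded {x. Q x}" unfolding unbounded_def by simp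
  moreover have "{x. Q x} \<in> coll" using Q by (simp only: rel1_iff_coll)
  moreover have "\<forall>x\<in>{x. Q x}. 0 < x" using Q_pos by simp
  moreover have "\<forall>x\<in>{x. Q x}. \<forall>y\<in>{x. Q x}. \<forall>z\<in>{x. Q x}. x < y \<longrightarrow> y < z \<longrightarrow> f x y z = b"
    using Q_f by simp
  ultimately show "\<exists>H\<in>coll. (\<forall>x\<in>H. 0 < x) \<and> unbounded H \<and>
     (\<exists>b. \<forall>x\<in>H. \<forall>y\<in>H. \<forall>z\<in>H. x < y \<longrightarrow> y < z \<longrightarrow> f x y z = b)"
    by (intro bexI[of _ "{x. Q x}"] conjI exI[of _ b])
qed

theorem theorem2:
  shows "(RCA0 \<turnstile> HT32_apart \<^bold>\<longleftrightarrow> RT32) \<and> (RCA0 \<turnstile> HT32_apart \<^bold>\<longleftrightarrow> FUT32)"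
  using RT_imp_HT HT_imp_FUT FUT_imp_HT HT_imp_ACA ACA_imp_RT
  by (intro provable_by_model) blast+

end
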